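(* Let $\mathcal{Q}_{47}$ be the 47-qubit code, encoding one logical qubit, obtained by encoding the logical qubit in the 5'-qubit code and then encoding each of the 5'-code qubits $1,3,5$ in the 15-qubit Reed-Muller code, while leaving the 5'-code qubits $2,4$ unencoded (so that there are $3\cdot 15+2=47$ physical qubits). Then there is a recovery operation $\mathcal{R}$ on 47 qubits such that: (i) $\mathcal{R}$ corrects an arbitrary error on any single physical qubit of $\mathcal{Q}_{47}$; (ii) each gate of the universal gate set $\{K, T, S, CZ, CCZ\}$, where $K=SH$, can be implemented fault-tolerantly, with respect to $\mathcal{R}$, on logical qubits encoded in $\mathcal{Q}_{47}$.
   Context: Gates: $H$ is the Hadamard gate, $T=\mathrm{diag}(1,e^{i\pi/4})$, $S=T^2=\mathrm{diag}(1,i)$, $K=SH$, and $CZ$, $CCZ$ are the controlled-$Z$ and controlled-controlled-$Z$ gates. A gate set is universal if, on any sufficiently large number of qubits, it generates a dense subgroup of the unitary group up to global phase. 5-qubit code: the stabilizer code with generators $XZZXI$, $IXZZX$, $XIXZZ$, $ZXIXZ$ and logical operators $\overline X=X^{\otimes5}$, $\overline Z=Z^{\otimes5}$. The 5'-qubit code is its image under the local unitary $U=K_1Y_3K_5$ ($K$ on qubits 1 and 5, Pauli $Y$ on qubit 3), with stabilizer generators and logical operators $\overline X,\overline Z$ obtained from those of the 5-qubit code by conjugation $P\mapsto UPU^\dagger$. 15-qubit Reed-Muller code: the qubits are indexed by the nonzero vectors $v\in\mathbb{F}_2^4$. The stabilizer generators are $\prod_{v:v_i=1}X_v$ and $\prod_{v:v_i=1}Z_v$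 for $1\le i\le 4$, and $\prod_{v:v_i=v_j=1}Z_v$ for $1\le i<j\le 4$. The logical operators are $\overline{X}=X^{\otimes 15}$, $\overline{Z}=Z^{\otimes 15}$. Logical basis: for each code, $|\overline 0\rangle,|\overline 1\rangle$ are the $\pm1$ eigenstates of $\overline Z$ in the code space with $\overline X|\overline0\rangle=|\overline1\rangle$. The encoding isometry of the concatenated code is the 5'-code encoding isometry followed by the Reed-Muller encoding isometry on each of the qubits $1,3,5$ and the identity on the qubits $2,4$. The encoded version of a state $|\psi\rangle$ of $r$ logical qubits uses $r$ blocks of 47 physical qubits. A recovery operation is a quantum channel (completely positive trace-preserving map) on 47 qubits. It corrects an error $\mathcal{E}$ if $\mathcal{R}\circ\mathcal{E}$ fixes every state in the code space. Fault-tolerant implementation: an $r$-qubit gate $G$ can be implemented fault-tolerantly with respect to $\mathcal{R}$ if there is a finite sequence of physical unitary gates on the $47r$ physical qubits, each acting on at most three qubits, such that (a) in the absence of errors the sequence maps the encoded version of every $|\psi\rangle$ to the encoded version of $G|\psi\rangle$, up to a global phase; and (b) if one arbitrary single-qubit error (a quantum channel on one physical qubit) occurs on one physical qubit at one point of the sequence (before the first gate, between two consecutive gates, or after the last gate), then applying $\mathcal{R}$ afterwards to each of the $r$ blocks yields the encoded version of $G|\psi\rangle$, up to a global phase. *)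

theory Defs
  imports "HOL-Analysis.Analysis" "HOL-Library.Z2"
begin

section \<open>States and operators of qubit registers\<close>

text \<open>
  A register whose qubits are labelled by a finite type \<^typ>\<open>'q\<close> has the computational basis
  \<^typ>\<open>'q \<Rightarrow> bool\<close>, so its vectors have type \<^typ>\<open>complex ^ ('q \<Rightarrow> bool)\<close>. A single qubit is also
  described with basis \<^typ>\<open>bool\<close> (False is 0 and True is 1), and a family of systems with basis
  \<^typ>\<open>'a\<close>, labelled by \<^typ>\<open>'i\<close>, has basis \<^typ>\<open>'i \<Rightarrow> 'a\<close>.
\<close>

type_synonym 'b state = "complex ^ 'b"
type_synonym 'b op = "complex ^ 'b ^ 'b"

definition adj :: "complex ^ 'a::finite ^ 'b::finite \<Rightarrow> complex ^ 'b ^ 'a" where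
  "adj A = (\<chi> i j. cnj (A $ j $ i))"

definition unitary :: "'b::finite op \<Rightarrow> bool" where
  "unitary U \<longleftrightarrow> adj U ** U = mat 1 \<and> U ** adj U = mat 1"

definition braket :: "'b::finite state \<Rightarrow> 'b state \<Rightarrow> complex" where
  "braket v w = (\<Sum>i\<in>UNIV. cnj (v $ i) * w $ i)"

definition pure :: "'b::finite state \<Rightarrow> 'b op" where
  "pure v = (\<chi> i j. v $ i * cnj (v $ j))"

definition density_operator :: "'b::finite op \<Rightarrow> bool" where
  "density_operator \<rho> \<longleftrightarrow> (\<forall>v. braket v (\<rho> *v v) \<in> \<real>\<^sub>\<ge>\<^sub>0) \<and> trace \<rho> = 1"

definition tensor :: "('i::finite \<Rightarrow> complex ^ 'a::finite ^ 'b::finite) \<Rightarrow> complex ^ ('i \<Rightarrow> 'a) ^ ('i \<Rightarrow> 'b)" where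
  "tensor A = (\<chi> x y. \<Prod>i\<in>UNIV. A i $ x i $ y i)"


section \<open>Quantum channels\<close>

text \<open>Positivity of the \<open>n \<times> n\<close> block matrix with blocks \<open>A i j\<close>, \<open>i, j < n\<close>.\<close>

definition block_positive :: "nat \<Rightarrow> (nat \<Rightarrow> nat \<Rightarrow> 'b::finite op) \<Rightarrow> bool" where
  "block_positive n A \<longleftrightarrow>
     (\<forall>v. (\<Sum>i<n. \<Sum>j<n. braket (v i) (A i j *v v j)) \<in> \<real>\<^sub>\<ge>\<^sub>0)"

text \<open>Complete positivity: \<open>id \<otimes> \<Phi>\<close> is positive for an ancilla of every finite dimension \<open>n\<close>.\<close>

definition completely_positive :: "('b::finite op \<Rightarrow> 'b op) \<Rightarrow> bool" where
  "completely_positive \<Phi> \<longleftrightarrow>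
     (\<forall>n A. block_positive n A \<longrightarrow> block_positive n (\<lambda>i j. \<Phi> (A i j)))"

definition quantum_channel :: "('b::finite op \<Rightarrow> 'b op) \<Rightarrow> bool" where
  "quantum_channel \<Phi> \<longleftrightarrow>
     (\<forall>A B. \<Phi> (A + B) = \<Phi> A + \<Phi> B) \<and>
     (\<forall>c A. \<Phi> (mat c ** A) = mat c ** \<Phi> A) \<and>
     completely_positive \<Phi> \<and>
     (\<forall>A. trace (\<Phi> A) = trace A)"

definition matrix_unit :: "'b::finite \<Rightarrow> 'b \<Rightarrow> 'b op" where
  "matrix_unit a b = (\<chi> i j. if i = a \<and> j = b then 1 else 0)"

text \<open>
  Tensor product of linear maps on operators: the linear map that sends the matrix unit
  \<open>matrix_unit a b\<close> to the tensor product of the images of the \<open>matrix_unit (a i) (b i)\<close>.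
\<close>

definition channel_tensor ::
  "('i::finite \<Rightarrow> 'a::finite op \<Rightarrow> 'a op) \<Rightarrow> ('i \<Rightarrow> 'a) op \<Rightarrow> ('i \<Rightarrow> 'a) op" where
  "channel_tensor \<Phi> M =
     (\<chi> x y. \<Sum>a\<in>UNIV. \<Sum>b\<in>UNIV.
        M $ a $ b * (\<Prod>i\<in>UNIV. \<Phi> i (matrix_unit (a i) (b i)) $ x i $ y i))"

definition channel_at ::
  "'i::finite \<Rightarrow> ('a::finite op \<Rightarrow> 'a op) \<Rightarrow> ('i \<Rightarrow> 'a) op \<Rightarrow> ('i \<Rightarrow> 'a) op" where
  "channel_at i \<Phi> = channel_tensor (\<lambda>j. if j = i then \<Phi> else id)"


section \<open>Gates\<close>

definition mat2 :: "complex \<Rightarrow> complex \<Rightarrow> complex \<Rightarrow> complex \<Rightarrow> bool op" where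
  "mat2 a b c d = (\<chi> i j. if i then (if j then d else c) else (if j then b else a))"

definition pauli_X :: "bool op" where "pauli_X = mat2 0 1 1 0"
definition pauli_Y :: "bool op" where "pauli_Y = mat2 0 (- \<i>) \<i> 0"
definition pauli_Z :: "bool op" where "pauli_Z = mat2 1 0 0 (- 1)"

definition gate_H :: "bool op" where
  "gate_H = mat (1 / complex_of_real (sqrt 2)) ** mat2 1 1 1 (- 1)"
definition gate_T :: "bool op" where "gate_T = mat2 1 0 0 (exp (\<i> * of_real pi / 4))"
definition gate_S :: "bool op" where "gate_S = mat2 1 0 0 \<i>"
definition gate_K :: "bool op" where "gate_K = gate_S ** gate_H"

definition on_one_qubit :: "bool op \<Rightarrow> (1 \<Rightarrow> bool) op" where
  "on_one_qubit G = tensor (\<lambda>_. G)"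

definition gate_CZ :: "(2 \<Rightarrow> bool) op" where
  "gate_CZ = (\<chi> x y. if x = y then (if \<forall>i. x i then - 1 else 1) else 0)"

definition gate_CCZ :: "(3 \<Rightarrow> bool) op" where
  "gate_CCZ = (\<chi> x y. if x = y then (if \<forall>i. x i then - 1 else 1) else 0)"


section \<open>Universality\<close>

text \<open>The gate \<open>G\<close>, applied to the qubits \<open>f k\<close> (\<open>f\<close> injective) of a larger register.\<close>

definition place :: "('k::finite \<Rightarrow> 'q::finite) \<Rightarrow> ('k \<Rightarrow> bool) op \<Rightarrow> ('q \<Rightarrow> bool) op" where
  "place f G =
     (\<chi> x y. if \<forall>q. q \<notin> range f \<longrightarrow> x q = y q then G $ (x \<circ> f) $ (y \<circ> f) else 0)"

definition placements :: "('k::finite \<Rightarrow> bool) op \<Rightarrow> ('q::finite \<Rightarrow> bool) op set" where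
  "placements G = {place f G | f. inj f}"

definition K_T_S_CZ_CCZ_gates :: "('n::finite \<Rightarrow> bool) op set" where
  "K_T_S_CZ_CCZ_gates =
     placements (on_one_qubit gate_K) \<union> placements (on_one_qubit gate_T) \<union>
     placements (on_one_qubit gate_S) \<union> placements gate_CZ \<union> placements gate_CCZ"

inductive_set generated_group :: "'b::finite op set \<Rightarrow> 'b op set" for G where
  one: "mat 1 \<in> generated_group G"
| gate: "W \<in> generated_group G \<Longrightarrow> g \<in> G \<Longrightarrow> g ** W \<in> generated_group G"
| inverse: "W \<in> generated_group G \<Longrightarrow> g \<in> G \<Longrightarrow> adj g ** W \<in> generated_group G"

definition dense_up_to_phase :: "'b::finite op set \<Rightarrow> bool" where
  "dense_up_to_phase A \<longleftrightarrow>
     A \<subseteq> Collect unitary \<and>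
     Collect unitary \<subseteq> closure {mat c ** W | c W. cmod c = 1 \<and> W \<in> A}"


section \<open>Stabilizer codes\<close>

definition stabilized_space :: "'b::finite op set \<Rightarrow> 'b state set" where
  "stabilized_space G = {v. \<forall>g\<in>G. g *v v = v}"

definition logical_basis ::
  "'b::finite op set \<Rightarrow> 'b op \<Rightarrow> 'b op \<Rightarrow> 'b state \<Rightarrow> 'b state \<Rightarrow> bool" where
  "logical_basis G LX LZ v0 v1 \<longleftrightarrow>
     v0 \<in> stabilized_space G \<and> v1 \<in> stabilized_space G \<and> norm v0 = 1 \<and> norm v1 = 1 \<and>
     LZ *v v0 = v0 \<and> LZ *v v1 = - v1 \<and> LX *v v0 = v1"

text \<open>
  The encoding isometry that sends the basis states 0 and 1 to the logical basis states. For the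
  codes below the logical basis is unique up to a common phase, which the choice operator fixes.
\<close>

definition encoder :: "'b::finite op set \<Rightarrow> 'b op \<Rightarrow> 'b op \<Rightarrow> complex ^ bool ^ 'b" where
  "encoder G LX LZ =
     (SOME V. \<exists>v0 v1. logical_basis G LX LZ v0 v1 \<and> V = (\<chi> x b. if b then v1 $ x else v0 $ x))"


subsection \<open>The 5'-qubit code\<close>

datatype qubit5 = Q1 | Q2 | Q3 | Q4 | Q5

lemma UNIV_qubit5: "UNIV = {Q1, Q2, Q3, Q4, Q5}"
  by (auto intro: qubit5.exhaust)

instance qubit5 :: finite
  by standard (simp add: UNIV_qubit5)

definition tensor5 ::
  "bool op \<Rightarrow> bool op \<Rightarrow> bool op \<Rightarrow> bool op \<Rightarrow> bool op \<Rightarrow> (qubit5 \<Rightarrow> bool) op" where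
  "tensor5 a b c d e =
     tensor (\<lambda>q. case q of Q1 \<Rightarrow> a | Q2 \<Rightarrow> b | Q3 \<Rightarrow> c | Q4 \<Rightarrow> d | Q5 \<Rightarrow> e)"

definition five_generators :: "(qubit5 \<Rightarrow> bool) op set" where
  "five_generators =
    {tensor5 pauli_X pauli_Z pauli_Z pauli_X (mat 1),
     tensor5 (mat 1) pauli_X pauli_Z pauli_Z pauli_X,
     tensor5 pauli_X (mat 1) pauli_X pauli_Z pauli_Z,
     tensor5 pauli_Z pauli_X (mat 1) pauli_X pauli_Z}"

definition five_U :: "(qubit5 \<Rightarrow> bool) op" where
  "five_U = tensor5 gate_K (mat 1) pauli_Y (mat 1) gate_K"

definition five_conj :: "(qubit5 \<Rightarrow> bool) op \<Rightarrow> (qubit5 \<Rightarrow> bool) op" where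
  "five_conj P = five_U ** P ** adj five_U"

definition enc5' :: "complex ^ bool ^ (qubit5 \<Rightarrow> bool)" where
  "enc5' = encoder (five_conj ` five_generators)
             (five_conj (tensor (\<lambda>_. pauli_X))) (five_conj (tensor (\<lambda>_. pauli_Z)))"


subsection \<open>The 15-qubit Reed-Muller code\<close>

instance bit :: finite
proof
  have "(UNIV :: bit set) = {0, 1}"
    by (auto intro: bit.exhaust)
  then show "finite (UNIV :: bit set)"
    by (metis finite.emptyI finite_insert)
qed

typedef qubit15 = "{v :: bit ^ 4. v \<noteq> 0}" morphisms vec_of Abs_qubit15
  by (rule exI[of _ 1]) simp

instance qubit15 :: finite
proof
  show "finite (UNIV :: qubit15 set)"
    by (rule finite_imageD[of vec_of]) (auto simp: inj_on_def vec_of_inject)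
qed

definition tensor_on :: "'q::finite set \<Rightarrow> bool op \<Rightarrow> ('q \<Rightarrow> bool) op" where
  "tensor_on A P = tensor (\<lambda>q. if q \<in> A then P else mat 1)"

definition rm_generators :: "(qubit15 \<Rightarrow> bool) op set" where
  "rm_generators =
     {tensor_on {v. vec_of v $ i = 1} pauli_X | i. True} \<union>
     {tensor_on {v. vec_of v $ i = 1} pauli_Z | i. True} \<union>
     {tensor_on {v. vec_of v $ i = 1 \<and> vec_of v $ j = 1} pauli_Z | i j. i \<noteq> j}"

definition enc15 :: "complex ^ bool ^ (qubit15 \<Rightarrow> bool)" where
  "enc15 = encoder rm_generators (tensor (\<lambda>_. pauli_X)) (tensor (\<lambda>_. pauli_Z))"


subsection \<open>The 47-qubit code\<close>

datatype qubit47 = Block1 qubit15 | Bare2 | Block3 qubit15 | Bare4 | Block5 qubit15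

lemma UNIV_qubit47:
  "UNIV = range Block1 \<union> {Bare2} \<union> range Block3 \<union> {Bare4} \<union> range Block5"
proof -
  have "q \<in> range Block1 \<union> {Bare2} \<union> range Block3 \<union> {Bare4} \<union> range Block5" for q
    by (cases q) simp_all
  then show ?thesis
    by blast
qed

instance qubit47 :: finite
  by standard (simp add: UNIV_qubit47)

text \<open>
  The Reed-Muller encoder on the 5'-code qubits 1, 3, 5, tensored with the identity on the
  qubits 2 and 4.
\<close>

definition rm_layer :: "complex ^ (qubit5 \<Rightarrow> bool) ^ (qubit47 \<Rightarrow> bool)" where
  "rm_layer = (\<chi> x y.
     enc15 $ (x \<circ> Block1) $ y Q1 *
     mat 1 $ x Bare2 $ y Q2 *
     enc15 $ (x \<circ> Block3) $ y Q3 *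
     mat 1 $ x Bare4 $ y Q4 *
     enc15 $ (x \<circ> Block5) $ y Q5)"

definition enc47 :: "complex ^ bool ^ (qubit47 \<Rightarrow> bool)" where
  "enc47 = rm_layer ** enc5'"

definition code_space47 :: "(qubit47 \<Rightarrow> bool) state set" where
  "code_space47 = range (\<lambda>\<phi>. enc47 *v \<phi>)"

definition encode :: "('r::finite \<Rightarrow> bool) state \<Rightarrow> ('r \<Rightarrow> qubit47 \<Rightarrow> bool) state" where
  "encode \<psi> = tensor (\<lambda>_. enc47) *v \<psi>"


section \<open>Error correction and fault tolerance\<close>

definition corrects ::
  "((qubit47 \<Rightarrow> bool) op \<Rightarrow> (qubit47 \<Rightarrow> bool) op) \<Rightarrow>
   ((qubit47 \<Rightarrow> bool) op \<Rightarrow> (qubit47 \<Rightarrow> bool) op) \<Rightarrow> bool" where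
  "corrects R E \<longleftrightarrow>
     (\<forall>\<rho>. density_operator \<rho> \<and> range (\<lambda>v. \<rho> *v v) \<subseteq> code_space47 \<longrightarrow> R (E \<rho>) = \<rho>)"

text \<open>
  \<open>W\<close> acts on the set \<open>A\<close> of physical qubits of a family of blocks, that is,
  \<open>W\<close> is the tensor product of an operator on \<open>A\<close> and the identity on the other qubits:
  an entry \<open>W $ x $ y\<close> vanishes unless \<open>x\<close> and \<open>y\<close> agree outside \<open>A\<close>, and then
  depends only on the restrictions of \<open>x\<close> and \<open>y\<close> to \<open>A\<close>.
\<close>

definition acts_on :: "('r::finite \<times> 'p::finite) set \<Rightarrow> ('r \<Rightarrow> 'p \<Rightarrow> bool) op \<Rightarrow> bool" where
  "acts_on A W \<longleftrightarrow>
     (\<forall>x y. W $ x $ y =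
        (if \<forall>j p. (j, p) \<notin> A \<longrightarrow> x j p = y j p
         then W $ (\<lambda>j p. (j, p) \<in> A \<and> x j p) $ (\<lambda>j p. (j, p) \<in> A \<and> y j p)
         else 0))"

text \<open>The gates in a list are applied from left to right.\<close>

definition run_vector :: "'b::finite op list \<Rightarrow> 'b state \<Rightarrow> 'b state" where
  "run_vector Ws v = fold (\<lambda>W v. W *v v) Ws v"

definition run :: "'b::finite op list \<Rightarrow> 'b op \<Rightarrow> 'b op" where
  "run Ws \<rho> = fold (\<lambda>W \<rho>. W ** \<rho> ** adj W) Ws \<rho>"

text \<open>
  In the last condition, the error \<open>E\<close> hits the physical qubit \<open>p\<close> of block \<open>j\<close> after
  the first \<open>k\<close> gates. Equality of density operators is equality up to a global phase.
\<close>

definition fault_tolerant ::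
  "((qubit47 \<Rightarrow> bool) op \<Rightarrow> (qubit47 \<Rightarrow> bool) op) \<Rightarrow> ('r::finite \<Rightarrow> bool) op \<Rightarrow> bool" where
  "fault_tolerant R G \<longleftrightarrow>
     (\<exists>Ws :: ('r \<Rightarrow> qubit47 \<Rightarrow> bool) op list.
        (\<forall>W\<in>set Ws. unitary W \<and> (\<exists>A. card A \<le> 3 \<and> acts_on A W)) \<and>
        (\<exists>c. cmod c = 1 \<and> (\<forall>\<psi>. norm \<psi> = 1 \<longrightarrow>
           run_vector Ws (encode \<psi>) = c *s encode (G *v \<psi>))) \<and>
        (\<forall>k\<le>length Ws. \<forall>j p E \<psi>. quantum_channel E \<and> norm \<psi> = 1 \<longrightarrow>
           channel_tensor (\<lambda>_. R)
             (run (drop k Ws) (channel_at j (channel_at p E) (run (take k Ws) (pure (encode \<psi>)))))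
           = pure (encode (G *v \<psi>))))"

end

theory Submission
  imports Defs
begin

text \<open>
  The recovery decodes the three Reed-Muller blocks and then the 5'-code, each of distance three.
  The gate \<open>K\<close> is transversal in the 5'-code. The one-qubit gates that it requires on the blocks need
  not be fault tolerant, because an error during such a gate ruins one block at most, that is, one
  qubit of the 5'-code.

  Up to a stabilizer and a sign the logical \<open>Z\<close> of the 5'-code is \<open>Z\<^sub>1 Z\<^sub>3 Z\<^sub>5\<close>, so on every basis
  state that occurs in a code state the sum modulo 2 of the three blocks is a Reed-Muller codeword
  that carries the logical bit. Reed-Muller codewords are affine functions on \<open>F\<^sub>2\<^sup>4\<close> restricted to
  the 15 nonzero points. Hence the product of the phases that \<open>T\<close>, \<open>S\<close>, \<open>CZ\<close> or \<open>CCZ\<close> (up to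
  inversion) assign to the bits of the codewords at the 15 points is the phase of the logical gate.
  The factors of this product are realized by diagonal gates on at most three qubits with the same
  index \<open>v\<close>; an error in such a circuit damages at most one qubit in each block.

  For universality, \<open>K\<close> and \<open>T\<close> generate a rotation of infinite order. The closure of the generated
  group therefore contains all one-qubit phases, by commutators all multiply controlled phases, and
  finally all plane rotations, which together with the phases generate the unitary group.
\<close>

section \<open>Complex matrices and tensor products\<close>

text \<open>The local unitary of the 5'-code turns a weight-three form of the logical Z into Z on
  qubits 1, 3 and 5, so only these need a Reed-Muller block, and the diagonal circuits never touch
  the bare qubits 2 and 4. The recovery must survive two patterns of damage: one block that is
  completely wrong (during \<open>K\<close>), and one wrong qubit in each of the three blocks (in a
  diagonal circuit). Decoding the blocks before the 5'-code covers both.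

  Errors are channels, but no states are estimated. A channel is a sum of terms
  \<open>A l ** M ** B l\<close>, so it suffices to follow an arbitrary one-qubit matrix through the
  circuit and to show that recovery, circuit and error together act on encoded states as a scalar
  times the ideal gate. The scalars are never computed.

  The encoders come from a choice operator. Every fact about them, in particular which basis states
  occur in a code state, is therefore derived from the stabilizers and the logical operators
  alone.\<close>

lemma matrix_ext: "(\<And>i j. A $ i $ j = B $ i $ j) \<Longrightarrow> A = (B :: 'a ^ 'n ^ 'm)"
  by (simp add: vec_eq_iff)

lemma mult_nth: "(A ** B) $ i $ j = (\<Sum>k\<in>UNIV. A $ i $ k * B $ k $ j)"
  by (simp add: matrix_matrix_mult_def)

lemma mult_vec_nth: "(A *v v) $ i = (\<Sum>k\<in>UNIV. A $ i $ k * v $ k)"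
  by (simp add: matrix_vector_mult_def)

lemma mat_nth: "mat c $ i $ j = (if i = j then c else 0)"
  by (simp add: mat_def)

lemma adj_nth [simp]: "adj A $ i $ j = cnj (A $ j $ i)"
  by (simp add: adj_def)

lemma if_mult_sum:
  "(\<Sum>k\<in>UNIV. (if i = k then f k else 0) * g k) = f i * (g i :: complex)"
  "(\<Sum>k\<in>UNIV. (if k = i then f k else 0) * g k) = f i * (g i :: complex)"
  "(\<Sum>k\<in>UNIV. g k * (if k = i then f k else 0)) = g i * (f i :: complex)"
  "(\<Sum>k\<in>UNIV. g k * (if i = k then f k else 0)) = g i * (f i :: complex)"
  for i :: "'n::finite"
  by (simp_all add: if_distrib if_distribR cong: if_cong)

lemma if_sum: "(\<Sum>k\<in>S. if P then f k else 0) = (if P then \<Sum>k\<in>S. f k else 0)"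
  by simp

lemma smult_nth [simp]: "(mat c ** A) $ i $ j = c * (A $ i $ j :: complex)"
  by (simp add: mult_nth mat_nth if_mult_sum)

lemma mult_mat_nth [simp]: "(A ** mat c) $ i $ j = A $ i $ j * (c :: complex)"
  by (simp add: mult_nth mat_nth if_mult_sum)

lemma mat_commute: "A ** mat c = mat c ** (A :: complex ^ 'n::finite ^ 'm::finite)"
  by (rule matrix_ext) (simp add: mult.commute)

lemma mat_mult_mat [simp]: "mat a ** mat b = (mat (a * b) :: complex ^ 'n::finite ^ 'n)"
  by (rule matrix_ext) (simp add: mat_nth)

lemma mat_mult_mat_left [simp]:
  "mat a ** (mat b ** A) = mat (a * b) ** (A :: complex ^ 'n::finite ^ 'm::finite)"
  by (simp add: matrix_mul_assoc)

lemma mult_mat_left: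
  "A ** (mat b ** B) = mat b ** (A ** (B :: complex ^ 'n::finite ^ 'm::finite))"
  by (metis mat_commute matrix_mul_assoc)

lemma mat_mult_vec [simp]: "mat c *v v = c *s (v :: complex ^ 'n::finite)"
  by (simp add: vec_eq_iff mult_vec_nth mat_nth if_mult_sum)

lemma matrix_sum_left: "(\<Sum>i\<in>S. f i) ** B = (\<Sum>i\<in>S. f i ** (B :: complex ^ 'n::finite ^ 'm::finite))"
  by (rule matrix_ext) (simp add: mult_nth sum_distrib_right sum.swap[of _ S])

lemma matrix_sum_right: "B ** (\<Sum>i\<in>S. f i) = (\<Sum>i\<in>S. (B :: complex ^ 'n::finite ^ 'm::finite) ** f i)"
  by (rule matrix_ext) (simp add: mult_nth sum_distrib_left sum.swap[of _ S])

lemma mat_sum: "mat (\<Sum>i\<in>S. f i) = (\<Sum>i\<in>S. mat (f i) :: complex ^ 'n::finite ^ 'n)"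
  by (rule matrix_ext) (simp add: mat_nth)

lemma adj_mult: "adj (A ** B) = adj B ** adj A"
  by (rule matrix_ext) (simp add: mult_nth mult.commute)

lemma adj_adj [simp]: "adj (adj A) = A"
  by (rule matrix_ext) simp

lemma adj_mat [simp]: "adj (mat c) = mat (cnj c)"
  by (rule matrix_ext) (simp add: mat_nth)

lemma adj_sum: "adj (\<Sum>i\<in>S. f i) = (\<Sum>i\<in>S. adj (f i))"
  by (rule matrix_ext) simp

lemma unitaryD: "unitary U \<Longrightarrow> adj U ** U = mat 1" "unitary U \<Longrightarrow> U ** adj U = mat 1"
  by (simp_all add: unitary_def)

lemma unitary_cancel:
  assumes "unitary U"
  shows "adj U ** (U ** A) = A" "U ** (adj U ** A) = A"
  using assms by (simp_all add: matrix_mul_assoc unitary_def)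

lemma unitary_mult: "unitary U \<Longrightarrow> unitary V \<Longrightarrow> unitary (U ** V)"
  unfolding unitary_def adj_mult by (metis matrix_mul_assoc matrix_mul_lid)

lemma unitary_adj: "unitary U \<Longrightarrow> unitary (adj U)"
  by (simp add: unitary_def)

lemma unitary_mat_1: "unitary (mat 1)"
  by (simp add: unitary_def)

lemma trace_mult_commute:
  "trace (A ** B) = trace (B ** (A :: complex ^ 'n::finite ^ 'm::finite))"
  unfolding trace_def mult_nth by (subst sum.swap) (simp add: mult.commute)

lemma trace_sum: "trace (\<Sum>i\<in>S. f i) = (\<Sum>i\<in>S. trace (f i))"
  unfolding trace_def by (simp add: sum.swap[of _ S])

lemma trace_smult: "trace (mat c ** A) = c * trace (A :: complex ^ 'n::finite ^ 'n)"
  by (simp add: trace_def sum_distrib_left)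

lemma matrix_unit_nth: "matrix_unit a b $ i $ j = (if i = a \<and> j = b then 1 else 0)"
  by (simp add: matrix_unit_def)

lemma mult_matrix_unit: "(A ** matrix_unit a b) $ x $ y = (if y = b then A $ x $ a else 0)"
  using if_mult_sum(3)[of "\<lambda>k. A $ x $ k" a "\<lambda>_. 1"]
  by (cases "y = b") (simp_all add: mult_nth matrix_unit_nth)

lemma mult_matrix_unit_mult:
  "(A ** matrix_unit a b ** B) $ x $ y = A $ x $ a * B $ b $ y"
  unfolding mult_nth[of "A ** matrix_unit a b"] mult_matrix_unit
  by (rule if_mult_sum(2))

lemma matrix_unit_sum: "M = (\<Sum>a\<in>UNIV. \<Sum>b\<in>UNIV. mat (M $ a $ b) ** matrix_unit a b)"
proof (rule matrix_ext)
  fix i j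
  have "(\<Sum>a\<in>UNIV. \<Sum>b\<in>UNIV. mat (M $ a $ b) ** matrix_unit a b) $ i $ j =
      (\<Sum>a\<in>UNIV. if a = i then (\<Sum>b\<in>UNIV. if b = j then M $ a $ b else 0) else 0)"
    unfolding sum_component smult_nth matrix_unit_nth
    by (intro sum.cong) (simp_all add: if_mult_sum)
  also have "\<dots> = M $ i $ j"
    by simp
  finally show "M $ i $ j = (\<Sum>a\<in>UNIV. \<Sum>b\<in>UNIV. mat (M $ a $ b) ** matrix_unit a b) $ i $ j" ..
qed

lemma trace_matrix_unit: "trace (matrix_unit a b) = (if a = b then 1 else 0)"
proof -
  have "trace (matrix_unit a b) = (\<Sum>i\<in>UNIV. if i = a then (if a = b then 1 else 0) else 0)"
    unfolding trace_def matrix_unit_nth by (intro sum.cong) auto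
  then show ?thesis by simp
qed

text \<open>The trace pairing is nondegenerate: pairing with \<open>matrix_unit j i\<close> reads
  off the entry at \<open>i\<close>, \<open>j\<close>. This turns preservation of the trace into an
  identity of operators.\<close>

lemma eq_mat_1_if_trace:
  assumes "\<And>M :: 'n::finite op. trace (X ** M) = trace M"
  shows "X = mat 1"
proof (rule matrix_ext)
  fix i j
  have "trace (X ** matrix_unit j i) = X $ i $ j"
    by (subst trace_def) (simp add: mult_matrix_unit)
  then show "X $ i $ j = mat 1 $ i $ j"
    using assms[of "matrix_unit j i"] by (auto simp: trace_matrix_unit mat_nth)
qed

lemma prod_sum_UNIV:
  "(\<Prod>i\<in>UNIV. \<Sum>a\<in>UNIV. f i a) = (\<Sum>h\<in>UNIV. \<Prod>i\<in>UNIV. f i (h i) :: complex)"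
  for f :: "'i::finite \<Rightarrow> 'a::finite \<Rightarrow> complex"
  using prod_sum_PiE[of UNIV "\<lambda>_. UNIV" f] by (simp add: PiE_UNIV_domain)

section \<open>Tensor products and operators on a single factor\<close>

lemma tensor_nth: "tensor A $ x $ y = (\<Prod>i\<in>UNIV. A i $ x i $ y i)"
  by (simp add: tensor_def)

lemma tensor_mult: "tensor A ** tensor B = tensor (\<lambda>i. A i ** B i)"
  by (rule matrix_ext) (simp add: mult_nth tensor_nth prod_sum_UNIV prod.distrib)

lemma adj_tensor: "adj (tensor A) = tensor (\<lambda>i. adj (A i))"
  by (rule matrix_ext) (simp add: tensor_nth)

lemma prod_indicator: "(\<Prod>i\<in>UNIV. if P i then 1 else 0 :: complex) = (if \<forall>i. P i then 1 else 0)"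
  for P :: "'i::finite \<Rightarrow> bool"
  by auto

lemma tensor_mat_1: "tensor (\<lambda>_. mat 1) = mat 1"
  by (rule matrix_ext) (simp add: tensor_nth mat_nth prod_indicator fun_eq_iff)

lemma tensor_smult: "tensor (\<lambda>i. mat (c i) ** A i) = mat (\<Prod>i\<in>UNIV. c i) ** tensor A"
  by (rule matrix_ext) (simp add: tensor_nth prod.distrib)

lemma tensor_sum:
  "tensor (\<lambda>i. \<Sum>l\<in>UNIV. A i l) = (\<Sum>\<kappa>\<in>UNIV. tensor (\<lambda>i. A i (\<kappa> i)))"
  for A :: "'i::finite \<Rightarrow> 'l::finite \<Rightarrow> complex ^ 'a::finite ^ 'b::finite"
  by (rule matrix_ext) (simp add: tensor_nth prod_sum_UNIV)

lemma unitary_tensor: "(\<And>i. unitary (A i)) \<Longrightarrow> unitary (tensor A)"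
  by (simp add: unitary_def adj_tensor tensor_mult tensor_mat_1)

definition local_op :: "'i::finite \<Rightarrow> 'a::finite op \<Rightarrow> ('i \<Rightarrow> 'a) op" where
  "local_op q E = tensor (\<lambda>i. if i = q then E else mat 1)"

lemma local_op_nth: "local_op q E $ x $ y = (if \<forall>i. i \<noteq> q \<longrightarrow> x i = y i then E $ x q $ y q else 0)"
proof -
  have "local_op q E $ x $ y = E $ x q $ y q * (\<Prod>i\<in>UNIV-{q}. mat 1 $ x i $ y i)"
    unfolding local_op_def tensor_nth by (subst prod.remove[of _ q]) (auto intro!: prod.cong)
  also have "(\<Prod>i\<in>UNIV-{q}. mat 1 $ x i $ y i) = (if \<forall>i. i \<noteq> q \<longrightarrow> x i = y i then 1 else 0 :: complex)"
    by (auto simp: mat_nth)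
  finally show ?thesis by auto
qed

lemma local_op_mult: "local_op q A ** local_op q B = local_op q (A ** B)"
  unfolding local_op_def tensor_mult by (rule arg_cong[of _ _ tensor]) auto

lemma local_op_mat_1 [simp]: "local_op q (mat 1) = mat 1"
  by (simp add: local_op_def tensor_mat_1 cong: if_cong)

lemma adj_local_op: "adj (local_op q A) = local_op q (adj A)"
  unfolding local_op_def adj_tensor by (rule arg_cong[of _ _ tensor]) auto

lemma local_op_sum: "local_op q (\<Sum>l\<in>S. A l) = (\<Sum>l\<in>S. local_op q (A l))"
proof (rule matrix_ext)
  fix x y
  show "local_op q (\<Sum>l\<in>S. A l) $ x $ y = (\<Sum>l\<in>S. local_op q (A l)) $ x $ y"
    unfolding sum_component local_op_nth if_sum ..
qed

lemma local_op_smult: "local_op q (mat c ** A) = mat c ** local_op q A"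
  by (rule matrix_ext) (auto simp: local_op_nth)

lemma unitary_local_op: "unitary A \<Longrightarrow> unitary (local_op q A)"
  by (simp add: unitary_def adj_local_op local_op_mult)

section \<open>Two-by-two matrices and the one-qubit gates\<close>

lemma mat2_nth [simp]:
  "mat2 a b c d $ False $ False = a" "mat2 a b c d $ False $ True = b"
  "mat2 a b c d $ True $ False = c" "mat2 a b c d $ True $ True = d"
  by (simp_all add: mat2_def)

lemma bool_op_eq_iff:
  "A = B \<longleftrightarrow> A $ False $ False = B $ False $ False \<and> A $ False $ True = B $ False $ True \<and>
     A $ True $ False = B $ True $ False \<and> A $ True $ True = (B :: bool op) $ True $ True"
  unfolding vec_eq_iff by (metis (full_types))

lemma bool_mult_nth: "(A ** B) $ i $ j = A $ i $ False * B $ False $ j + A $ i $ True * B $ True $ j"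
  for A :: "complex ^ bool ^ 'm::finite"
  by (simp add: mult_nth UNIV_bool add.commute)

lemma mat2_mult:
  "mat2 a b c d ** mat2 a' b' c' d' =
     mat2 (a * a' + b * c') (a * b' + b * d') (c * a' + d * c') (c * b' + d * d')"
  by (simp add: bool_op_eq_iff bool_mult_nth)

lemma smult_mat2: "mat k ** mat2 a b c d = mat2 (k * a) (k * b) (k * c) (k * d)"
  by (simp add: bool_op_eq_iff)

lemma adj_mat2: "adj (mat2 a b c d) = mat2 (cnj a) (cnj c) (cnj b) (cnj d)"
  by (simp add: bool_op_eq_iff)

lemma mat_mat2: "mat k = mat2 k 0 0 k"
  by (simp add: bool_op_eq_iff mat_nth)

lemma mat2_inject [simp]:
  "mat2 a b c d = mat2 a' b' c' d' \<longleftrightarrow> a = a' \<and> b = b' \<and> c = c' \<and> d = d'"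
  by (simp add: bool_op_eq_iff)

lemma gate_K_mat2:
  "gate_K = mat2 (1 / complex_of_real (sqrt 2)) (1 / complex_of_real (sqrt 2))
                 (\<i> / complex_of_real (sqrt 2)) (- \<i> / complex_of_real (sqrt 2))"
  by (simp add: gate_K_def gate_S_def gate_H_def smult_mat2 mat2_mult)

lemma sqrt2_mult: "complex_of_real (sqrt 2) * complex_of_real (sqrt 2) = 2"
  by (metis of_real_mult of_real_numeral real_sqrt_mult_self abs_numeral)

lemma exp_pi_i_4: "exp (\<i> * complex_of_real pi / 4) = cis (pi / 4)"
  by (simp add: cis_conv_exp)

lemma unitary_gate_K: "unitary gate_K"
  by (simp add: unitary_def gate_K_mat2 adj_mat2 mat2_mult mat_mat2 sqrt2_mult field_simps)

lemma unitary_gate_T: "unitary gate_T"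
  by (simp add: unitary_def gate_T_def adj_mat2 mat2_mult mat_mat2 exp_pi_i_4 cis_cnj cis_mult)

lemma unitary_gate_S: "unitary gate_S"
  by (simp add: unitary_def gate_S_def adj_mat2 mat2_mult mat_mat2)

section \<open>Density of the gate set\<close>

subsection \<open>Single-qubit gates\<close>

text \<open>The Chebyshev recursion for \<open>2 * cos (k * \<phi>)\<close>, scaled by one factor
  \<open>sqrt 2\<close> per step, stays in the ring generated by \<open>sqrt 2\<close>. Modulo
  \<open>sqrt 2\<close> it multiplies by \<open>1 - sqrt 2\<close>, that is by 1, so
  \<open>a\<close> remains odd. Two consecutive values are carried because the recursion has order
  two; oddness is claimed for the later one, since the value at 0 is 2.\<close>

lemma cos_multiples_sqrt2:
  fixes \<phi> :: real
  assumes "2 * cos \<phi> * sqrt 2 = 1 - sqrt 2"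
  shows "\<exists>a b a' b'. odd a \<and>
           2 * cos (real (Suc k) * \<phi>) * sqrt 2 ^ Suc k = of_int a + of_int b * sqrt 2 \<and>
           2 * cos (real k * \<phi>) * sqrt 2 ^ k = of_int a' + of_int b' * sqrt 2"
proof (induction k)
  case 0
  have "odd (1 :: int) \<and> 2 * cos (real (Suc 0) * \<phi>) * sqrt 2 ^ Suc 0 = of_int 1 + of_int (-1) * sqrt 2 \<and>
           2 * cos (real 0 * \<phi>) * sqrt 2 ^ 0 = of_int 2 + of_int 0 * sqrt 2"
    using assms by simp
  then show ?case by blast
next
  case (Suc k)
  then obtain a b a' b' :: int where o: "odd a"
    and 1: "2 * cos (real (Suc k) * \<phi>) * sqrt 2 ^ Suc k = a + b * sqrt 2"
    and 2: "2 * cos (real k * \<phi>) * sqrt 2 ^ k = a' + b' * sqrt 2"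
    by blast
  have "cos (real (Suc (Suc k)) * \<phi>) + cos (real k * \<phi>) = 2 * cos \<phi> * cos (real (Suc k) * \<phi>)"
    using cos_add[of "real (Suc k) * \<phi>" \<phi>] cos_diff[of "real (Suc k) * \<phi>" \<phi>]
    by (simp add: algebra_simps)
  then have c: "cos (real (Suc (Suc k)) * \<phi>) = 2 * cos \<phi> * cos (real (Suc k) * \<phi>) - cos (real k * \<phi>)"
    by simp
  have "2 * cos (real (Suc (Suc k)) * \<phi>) * sqrt 2 ^ Suc (Suc k) =
      (2 * cos \<phi> * sqrt 2) * (2 * cos (real (Suc k) * \<phi>) * sqrt 2 ^ Suc k)
      - 2 * (2 * cos (real k * \<phi>) * sqrt 2 ^ k)"
    unfolding c by (simp add: algebra_simps)
  also have "\<dots> = of_int (a - 2 * b - 2 * a') + of_int (b - a - 2 * b') * sqrt 2"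
    unfolding 1 2 assms by (simp add: algebra_simps)
  finally have "odd (a - 2 * b - 2 * a') \<and> 2 * cos (real (Suc (Suc k)) * \<phi>) * sqrt 2 ^ Suc (Suc k) =
      of_int (a - 2 * b - 2 * a') + of_int (b - a - 2 * b') * sqrt 2"
    using o by simp
  with 1 show ?case by blast
qed

text \<open>
  If \<open>2 cos \<phi> = (1 - \<surd>2) / \<surd>2\<close> then \<open>2 cos (k \<phi>)\<close> has valuation \<open>- k\<close> at the prime
  \<open>\<surd>2\<close> of \<open>\<int>[\<surd>2]\<close>, and so differs from 2.
\<close>

lemma irrational_angle:
  fixes \<phi> :: real
  assumes "2 * cos \<phi> * sqrt 2 = 1 - sqrt 2"
  shows "\<phi> / (2 * pi) \<notin> \<rat>"
proof
  assume "\<phi> / (2 * pi) \<in> \<rat>"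
  then obtain p q :: int where "0 < q" and pq: "\<phi> / (2 * pi) = p / q"
    by (auto elim: Rats_cases')
  then obtain k where k: "q = int (Suc k)"
    by (metis gr0_implies_Suc zero_less_imp_eq_int)
  have "real (Suc k) * \<phi> = 2 * pi * p"
    using pq k by (simp add: field_simps)
  then have "cos (real (Suc k) * \<phi>) = 1"
    by (metis cos_int_2pin mult.assoc mult.commute)
  then obtain a b :: int where o: "odd a" and e: "2 * sqrt 2 ^ Suc k = a + b * sqrt 2"
    using cos_multiples_sqrt2[OF assms, of k] by auto
  show False
  \<comment> \<open>The power \<open>sqrt 2 ^ Suc k\<close> is an integer or an integer times
    \<open>sqrt 2\<close>. In both cases isolating \<open>sqrt 2\<close> and squaring makes
    \<open>a\<close> even.\<close>
  proof (cases "even (Suc k)")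
    case True
    then obtain m where m: "Suc k = 2 * m" by (elim evenE)
    have "real_of_int ((2 * 2 ^ m - a)\<^sup>2) = (b * sqrt 2)\<^sup>2"
      using e unfolding m by (simp add: power_mult)
    then have "real_of_int ((2 * 2 ^ m - a)\<^sup>2) = real_of_int (2 * b\<^sup>2)"
      by (simp add: power_mult_distrib)
    then have "(2 * 2 ^ m - a)\<^sup>2 = 2 * b\<^sup>2"
      unfolding of_int_eq_iff .
    then have "even ((2 * 2 ^ m - a)\<^sup>2)" by simp
    then show False using o by simp
  next
    case False
    then obtain m where m: "Suc k = 2 * m + 1" by (elim oddE)
    have "(2 * 2 ^ m - b) * sqrt 2 = a"
      using e unfolding m power_add power_mult by (simp add: algebra_simps)
    then have "((2 * 2 ^ m - b) * sqrt 2)\<^sup>2 = (real_of_int a)\<^sup>2" by simp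
    then have "real_of_int (2 * (2 * 2 ^ m - b)\<^sup>2) = real_of_int (a\<^sup>2)"
      unfolding power_mult_distrib by simp
    then have "2 * (2 * 2 ^ m - b)\<^sup>2 = a\<^sup>2"
      unfolding of_int_eq_iff .
    then have "even (a\<^sup>2)" by (metis dvd_triv_left)
    then show False using o by simp
  qed
qed

text \<open>The multiples of an irrational angle are dense modulo a full turn (Kronecker), so every
  \<open>R x\<close> is a limit of values \<open>R (real k * \<phi>)\<close>.\<close>

lemma closed_contains_rotations:
  fixes R :: "real \<Rightarrow> 'a::metric_space"
  assumes "closed A" and cont: "continuous_on UNIV R" and per: "\<And>x k. R (x + 2 * pi * of_int k) = R x"
    and irr: "\<phi> / (2 * pi) \<notin> \<rat>" and mem: "\<And>k::nat. R (real k * \<phi>) \<in> A"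
  shows "R x \<in> A"
proof -
  have "\<exists>y. R y \<in> A \<and> \<bar>y - x\<bar> < 1 / real (Suc n)" for n
  proof -
    obtain h k where k: "k > 0" "\<bar>of_int k * (\<phi> / (2 * pi)) - of_int h - x / (2 * pi)\<bar> < 1 / real (Suc n) / (2 * pi)"
      by (rule sequence_of_fractional_parts_is_dense[OF irr, of "1 / real (Suc n) / (2 * pi)" "x / (2 * pi)"]) auto
    \<comment> \<open>Subtracting \<open>h\<close> full turns leaves \<open>R\<close> unchanged and
      brings the angle close to \<open>x\<close>.\<close>
    let ?y = "real (nat k) * \<phi> + 2 * pi * of_int (- h)"
    have "?y - x = 2 * pi * (of_int k * (\<phi> / (2 * pi)) - of_int h - x / (2 * pi))"
      using k(1) by (simp add: field_simps)
    then have "\<bar>?y - x\<bar> = 2 * pi * \<bar>of_int k * (\<phi> / (2 * pi)) - of_int h - x / (2 * pi)\<bar>"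
      by (simp add: abs_mult)
    also have "\<dots> < 2 * pi * (1 / real (Suc n) / (2 * pi))"
      using k(2) by (intro mult_strict_left_mono) simp_all
    finally have "\<bar>?y - x\<bar> < 1 / real (Suc n)"
      by simp
    moreover have "R ?y \<in> A"
      unfolding per by (rule mem)
    ultimately show ?thesis by blast
  qed
  then obtain y where y: "\<And>n. R (y n) \<in> A" "\<And>n. \<bar>y n - x\<bar> < 1 / real (Suc n)"
    by metis
  have "y \<longlonglongrightarrow> x"
  proof (rule LIMSEQ_I)
    fix r :: real assume "0 < r"
    then obtain N where N: "1 / real (Suc N) < r"
      using nat_approx_posE by blast
    have "norm (y n - x) < r" if "n \<ge> N" for n
    proof -
      have "1 / real (Suc n) \<le> 1 / real (Suc N)"
        using that by (simp add: field_simps)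
      then show ?thesis using y(2)[of n] N by simp
    qed
    then show "\<exists>no. \<forall>n\<ge>no. norm (y n - x) < r" by blast
  qed
  then have "(\<lambda>n. R (y n)) \<longlonglongrightarrow> R x"
    using continuous_on_tendsto_compose[OF cont, of y x] by simp
  with y(1) show ?thesis
    using closed_sequentially[OF \<open>closed A\<close>, of "\<lambda>n. R (y n)"] by simp
qed

text \<open>For a unit vector (nx, nz) this is exp(- i x (nx X + nz Z)). The next two families are
  exp(- i x Y) and exp(i x Z).\<close>

definition rot :: "real \<Rightarrow> real \<Rightarrow> real \<Rightarrow> bool op" where
  "rot nx nz x =
     mat2 (of_real (cos x) - \<i> * of_real nz * of_real (sin x)) (- (\<i> * of_real nx * of_real (sin x)))
          (- (\<i> * of_real nx * of_real (sin x))) (of_real (cos x) + \<i> * of_real nz * of_real (sin x))"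

definition rot_y :: "real \<Rightarrow> bool op" where
  "rot_y x = mat2 (of_real (cos x)) (- of_real (sin x)) (of_real (sin x)) (of_real (cos x))"

definition diag_phase :: "real \<Rightarrow> bool op" where
  "diag_phase x = mat2 (cis x) 0 0 (cis (- x))"

definition hadamard :: "bool op" where
  "hadamard = mat2 (1 / sqrt 2) (1 / sqrt 2) (1 / sqrt 2) (- (1 / sqrt 2))"

text \<open>The reason is that a X + b Z squares to the identity. Free variables in place of the
  imaginary unit and the trigonometric values leave pure ring algebra.\<close>

lemma rot_mult_aux:
  fixes a b c s c' s' i :: complex
  assumes "a * a + b * b = 1" "i * i = - 1"
  shows "mat2 (c - i * b * s) (- (i * a * s)) (- (i * a * s)) (c + i * b * s) **
      mat2 (c' - i * b * s') (- (i * a * s')) (- (i * a * s')) (c' + i * b * s') =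
      mat2 ((c * c' - s * s') - i * b * (s * c' + c * s')) (- (i * a * (s * c' + c * s')))
        (- (i * a * (s * c' + c * s'))) ((c * c' - s * s') + i * b * (s * c' + c * s'))"
proof -
  have "(i * b * s) * (i * b * s') + (i * a * s) * (i * a * s') = (i * i) * (a * a + b * b) * (s * s')"
    by (simp add: algebra_simps)
  also have "\<dots> = - (s * s')" by (simp add: assms)
  finally show ?thesis
    unfolding mat2_mult mat2_inject by (simp add: algebra_simps)
qed

lemma of_real_unit_vector:
  assumes "nx\<^sup>2 + nz\<^sup>2 = 1"
  shows "complex_of_real nx * complex_of_real nx + complex_of_real nz * complex_of_real nz = 1"
  using assms by (simp add: power2_eq_square flip: of_real_mult of_real_add)

lemma i_times_i: "\<i> * \<i> = - 1"
  by simp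

lemma rot_add:
  assumes "nx\<^sup>2 + nz\<^sup>2 = 1"
  shows "rot nx nz x ** rot nx nz y = rot nx nz (x + y)"
  unfolding rot_def rot_mult_aux[OF of_real_unit_vector[OF assms] i_times_i]
    cos_add sin_add of_real_add of_real_diff of_real_mult ..

text \<open>A quarter turn of the Bloch sphere about the axis (a, b) of the x-z plane carries the
  orthogonal axis (- b, a) of that plane to the y axis. Here \<open>r\<close> is the common value of
  cosine and sine at \<open>pi / 4\<close>.\<close>

lemma rot_conj_aux:
  fixes a b c s r i :: complex
  assumes "a * a + b * b = 1" "i * i = - 1" "2 * (r * r) = 1"
  shows "mat2 (r + i * b * r) (i * a * r) (i * a * r) (r - i * b * r) **
      mat2 (c - i * a * s) (i * b * s) (i * b * s) (c + i * a * s) **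
      mat2 (r - i * b * r) (- (i * a * r)) (- (i * a * r)) (r + i * b * r) =
      mat2 c (- s) s c"
proof -
  have a: "a * a = 1 - b * b" using assms(1) by (simp add: algebra_simps)
  have aa: "a * (a * x) = x - b * (b * x)" for x
    unfolding mult.assoc[symmetric] a by (simp add: left_diff_distrib)
  have ii: "i * (i * x) = - x" for x
    using assms(2) by (simp flip: mult.assoc)
  have r: "r * r = 1 / 2" using assms(3) by (simp add: field_simps)
  have rr: "r * (r * x) = x / 2" for x
    unfolding mult.assoc[symmetric] r by simp
  show ?thesis
    unfolding mat2_mult mat2_inject by (simp add: algebra_simps a aa assms(2) ii r rr) (simp add: field_simps)
qed

lemma rot_power_mem:
  assumes "nx\<^sup>2 + nz\<^sup>2 = 1" and "\<And>M N. M \<in> A \<Longrightarrow> N \<in> A \<Longrightarrow> M ** N \<in> A" and "mat 1 \<in> A" and "rot nx nz x \<in> A"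
  shows "rot nx nz (real k * x) \<in> A"
proof (induction k)
  case 0
  have "rot nx nz 0 = mat 1" by (simp add: rot_def mat_mat2)
  then show ?case using assms(3) by simp
next
  case (Suc k)
  have "rot nx nz (real (Suc k) * x) = rot nx nz x ** rot nx nz (real k * x)"
    by (simp add: rot_add[OF assms(1)] algebra_simps)
  then show ?case using Suc assms by simp
qed

lemma continuous_on_mat2:
  assumes "continuous_on S a" "continuous_on S b" "continuous_on S c" "continuous_on S d"
  shows "continuous_on S (\<lambda>x. mat2 (a x) (b x) (c x) (d x))"
  unfolding mat2_def
proof (intro continuous_on_vec_lambda)
  fix i j
  show "continuous_on S (\<lambda>x. if i then if j then d x else c x else if j then b x else a x)"
    using assms by (cases i; cases j) simp_all
qed

lemma continuous_on_rot: "continuous_on S (rot nx nz)"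
  unfolding rot_def by (intro continuous_on_mat2 continuous_intros)

lemma rot_periodic: "rot nx nz (x + 2 * pi * of_int k) = rot nx nz x"
  unfolding rot_def cos_add sin_add cos_int_2pin sin_int_2pin by simp

text \<open>A palindrome in symmetric matrices is symmetric, so the product has no Y component: up
  to a phase it is a rotation about an axis in the x-z plane. The phase is a square root of the
  determinant, and \<open>c * r\<close> becomes the cosine of the angle.\<close>

lemma THTHT_eq:
  defines "c \<equiv> complex_of_real (cos (pi / 8))" and "s \<equiv> complex_of_real (sin (pi / 8))"
    and "r \<equiv> complex_of_real (1 / sqrt 2)"
  shows "gate_T ** hadamard ** gate_T ** hadamard ** gate_T =
    mat (cis (3 * pi / 8)) ** mat2 (c * r - \<i> * (c * r)) (- (\<i> * s)) (- (\<i> * s)) (c * r + \<i> * (c * r))"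
proof -
  define \<eta> where "\<eta> = cis (pi / 8)"
  have r: "r * r = 1 / 2"
    by (simp add: r_def field_simps sqrt2_mult)
  have e: "\<eta> = c + \<i> * s" "cnj \<eta> = c - \<i> * s"
    by (simp_all add: \<eta>_def c_def s_def complex_eq_iff)
  have en: "cnj \<eta> * \<eta> = 1" by (simp add: \<eta>_def cis_cnj cis_mult)
  have w: "cis (pi / 4) = \<eta> * \<eta>" "cis (3 * pi / 8) = \<eta> * \<eta> * \<eta>"
    by (simp_all add: \<eta>_def cis_mult field_simps)
  have "cis (pi / 4) = r * (1 + \<i>)"
    unfolding r_def by (simp add: complex_eq_iff cos_45 sin_45 real_div_sqrt field_simps)
  then have w': "\<eta> * \<eta> = r * (1 + \<i>)" by (simp add: w)
  have p: "1 + \<eta> * \<eta> = 2 * c * \<eta>"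
  proof -
    have "1 + \<eta> * \<eta> = (cnj \<eta> + \<eta>) * \<eta>" using en by (simp add: algebra_simps)
    moreover have "cnj \<eta> + \<eta> = 2 * c" unfolding e(2) by (simp add: e(1))
    ultimately show ?thesis by simp
  qed
  have q: "1 - \<eta> * \<eta> = - (2 * \<i> * s * \<eta>)"
  proof -
    have "1 - \<eta> * \<eta> = (cnj \<eta> - \<eta>) * \<eta>" using en by (simp add: algebra_simps)
    moreover have "cnj \<eta> - \<eta> = - (2 * \<i> * s)" unfolding e(2) by (simp add: e(1))
    ultimately show ?thesis by simp
  qed
  have t: "gate_T = mat2 1 0 0 (\<eta> * \<eta>)" by (simp add: gate_T_def exp_pi_i_4 w)
  have h: "hadamard = mat2 r r r (- r)" by (simp add: hadamard_def r_def)
  have "hadamard ** gate_T ** hadamard =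
      mat (r * r) ** mat2 (1 + \<eta> * \<eta>) (1 - \<eta> * \<eta>) (1 - \<eta> * \<eta>) (1 + \<eta> * \<eta>)"
    unfolding h t mat2_mult smult_mat2 by (simp add: algebra_simps)
  also have "\<dots> = mat2 (c * \<eta>) (- (\<i> * s * \<eta>)) (- (\<i> * s * \<eta>)) (c * \<eta>)"
    unfolding r p q smult_mat2 by simp
  finally have hth: "hadamard ** gate_T ** hadamard = \<dots>" .
  have "gate_T ** hadamard ** gate_T ** hadamard ** gate_T =
      gate_T ** (hadamard ** gate_T ** hadamard) ** gate_T"
    by (simp add: matrix_mul_assoc)
  also have "\<dots> = mat2 (c * \<eta>) (- (\<i> * s * (\<eta> * \<eta> * \<eta>))) (- (\<i> * s * (\<eta> * \<eta> * \<eta>)))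
      (c * (\<eta> * \<eta>) * (\<eta> * \<eta> * \<eta>))"
    unfolding hth unfolding t mat2_mult by (simp add: algebra_simps)
  also have "c * \<eta> = \<eta> * \<eta> * \<eta> * (c * r - \<i> * (c * r))"
  proof -
    have "\<eta> * \<eta> * \<eta> * (c * r - \<i> * (c * r)) = r * (1 + \<i>) * \<eta> * (c * r - \<i> * (c * r))"
      by (simp add: w')
    also have "\<dots> = r * r * ((1 + \<i>) * (1 - \<i>)) * c * \<eta>" by (simp add: algebra_simps)
    also have "\<dots> = c * \<eta>" unfolding r by (simp add: algebra_simps)
    finally show ?thesis ..
  qed
  also have "c * (\<eta> * \<eta>) * (\<eta> * \<eta> * \<eta>) = \<eta> * \<eta> * \<eta> * (c * r + \<i> * (c * r))"
    by (subst w') (simp add: algebra_simps)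
  finally show ?thesis
    unfolding w smult_mat2 by (simp add: algebra_simps)
qed

lemma hadamard_conj:
  "hadamard ** (mat2 a b c d ** hadamard) =
     mat (1 / 2) ** mat2 (a + b + c + d) (a - b + c - d) (a + b - c - d) (a - b - c + d)"
proof -
  define r where "r = complex_of_real (1 / sqrt 2)"
  have r: "r * r = 1 / 2" by (simp add: r_def sqrt2_mult)
  have rr: "r * (r * x) = x / 2" for x using r by (simp flip: mult.assoc)
  have h: "hadamard = mat2 r r r (- r)" by (simp add: hadamard_def r_def)
  show ?thesis
    unfolding h smult_mat2 mat2_mult mat2_inject by (simp add: algebra_simps r rr)
qed

text \<open>In particular Y becomes Z, by which rotations about y turn into diagonal phases.\<close>

lemma gate_K_conj:
  "adj gate_K ** mat2 a b c d ** gate_K =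
     mat (1 / 2) ** mat2 (a + d + \<i> * (b - c)) (a - d - \<i> * (b + c)) (a - d + \<i> * (b + c)) (a + d - \<i> * (b - c))"
proof -
  define r where "r = complex_of_real (1 / sqrt 2)"
  have r: "r * r = 1 / 2" by (simp add: r_def sqrt2_mult)
  have rr: "r * (r * x) = x / 2" for x using r by (simp flip: mult.assoc)
  have k: "gate_K = mat2 r r (\<i> * r) (- \<i> * r)" "cnj r = r" by (simp_all add: gate_K_mat2 r_def)
  show ?thesis
    unfolding k(1) adj_mat2 smult_mat2 mat2_mult mat2_inject by (simp add: k(2) algebra_simps r rr)
qed

text \<open>THTHT yields all rotations about one axis of the x-z plane. Conjugation by H X gives the
  orthogonal axis in this plane, a quarter turn about the first axis carries the second to y, and
  \<open>K\<close> carries y to z.\<close>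

lemma closed_contains_diag_phase:
  assumes "closed A" and mult: "\<And>M N. M \<in> A \<Longrightarrow> N \<in> A \<Longrightarrow> M ** N \<in> A"
    and phase: "\<And>c. cmod c = 1 \<Longrightarrow> mat c \<in> A"
    and gates: "gate_K \<in> A" "adj gate_K \<in> A" "gate_T \<in> A" "gate_S \<in> A" "adj gate_S \<in> A"
  shows "hadamard \<in> A" "pauli_X \<in> A" "diag_phase x \<in> A"
proof -
  have one: "mat 1 \<in> A" using phase[of 1] by simp
  have eq: "hadamard = adj gate_S ** gate_K"
    by (simp add: hadamard_def gate_S_def gate_K_mat2 adj_mat2 mat2_mult)
  show H: "hadamard \<in> A" unfolding eq by (intro mult gates)
  have eq: "pauli_X = hadamard ** (gate_S ** gate_S) ** hadamard"
    by (simp add: hadamard_def gate_S_def mat2_mult pauli_X_def sqrt2_mult field_simps)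
  show X: "pauli_X \<in> A" unfolding eq by (intro mult gates H)
  define c where "c = cos (pi / 8)"
  define s where "s = sin (pi / 8)"
  define \<phi> where "\<phi> = arccos (c / sqrt 2)"
  have "0 < c" unfolding c_def by (intro cos_gt_zero_pi) auto
  have cs: "c\<^sup>2 + s\<^sup>2 = 1" by (simp add: c_def s_def)
  have c2: "c\<^sup>2 = (1 + sqrt 2 / 2) / 2"
  proof -
    have "cos (pi / 4) = 2 * c\<^sup>2 - 1" using cos_double_cos[of "pi / 8"] by (simp add: c_def)
    then have "c\<^sup>2 = (1 + cos (pi / 4)) / 2" by simp
    then show ?thesis unfolding cos_45 .
  qed
  have "c \<le> 1" by (simp add: c_def)
  moreover have "1 \<le> sqrt 2" by simp
  ultimately have "c \<le> sqrt 2" by linarith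
  then have "c / sqrt 2 \<le> 1" by simp
  then have cos: "cos \<phi> = c / sqrt 2" unfolding \<phi>_def using \<open>0 < c\<close> by (intro cos_arccos) (auto intro: order_trans[of _ 0])
  then have cos2: "(cos \<phi>)\<^sup>2 = c\<^sup>2 / 2" by (simp add: power_divide)
  then have sin2: "(sin \<phi>)\<^sup>2 = 1 - c\<^sup>2 / 2" by (simp add: sin_squared_eq)
  have "c\<^sup>2 \<le> 1" using \<open>c \<le> 1\<close> \<open>0 < c\<close> by (simp add: power_le_one)
  then have sin0: "sin \<phi> \<noteq> 0" using sin2 by auto
  define nx where "nx = s / sin \<phi>"
  define nz where "nz = c / sqrt 2 / sin \<phi>"
  have nn: "nx\<^sup>2 + nz\<^sup>2 = 1"
  proof -
    have "s\<^sup>2 + c\<^sup>2 / 2 = (sin \<phi>)\<^sup>2" unfolding sin2 using cs by simp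
    moreover have "nx\<^sup>2 + nz\<^sup>2 = (s\<^sup>2 + c\<^sup>2 / 2) / (sin \<phi>)\<^sup>2"
      unfolding nx_def nz_def power_divide add_divide_distrib by simp
    ultimately show ?thesis using sin0 by simp
  qed
  \<comment> \<open>The angle is doubled because \<open>cos \<phi>\<close> involves
    \<open>cos (pi / 8)\<close>, whereas \<open>cos (2 * \<phi>)\<close> is
    \<open>c\<^sup>2 - 1\<close> and lies in the field of \<open>sqrt 2\<close>, as
    \<open>irrational_angle\<close> demands.\<close>
  have "2 * cos (2 * \<phi>) * sqrt 2 = 2 * (c\<^sup>2 - 1) * sqrt 2"
    using cos_double_cos[of \<phi>] cos2 by simp
  also have "\<dots> = 1 - sqrt 2" unfolding c2 by (simp add: field_simps)
  finally have irr: "2 * \<phi> / (2 * pi) \<notin> \<rat>" by (rule irrational_angle)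
  have eq: "rot nx nz \<phi> = mat (cis (- (3 * pi / 8))) ** (gate_T ** hadamard ** gate_T ** hadamard ** gate_T)"
    unfolding THTHT_eq using sin0
    by (simp add: rot_def nx_def nz_def cos c_def s_def cis_mult)
  have "rot nx nz \<phi> \<in> A" unfolding eq by (intro mult H gates phase norm_cis)
  then have "rot nx nz (2 * \<phi>) \<in> A" using rot_power_mem[OF nn mult one, of \<phi> 2] by simp
  then have R: "rot nx nz x \<in> A" for x
    using closed_contains_rotations[where R = "rot nx nz", OF \<open>closed A\<close> continuous_on_rot rot_periodic irr]
      rot_power_mem[OF nn mult one, of "2 * \<phi>"] by blast
  have eq: "rot (- nz) nx x = hadamard ** pauli_X ** rot nx nz x ** pauli_X ** hadamard" for x
  proof -
    have "hadamard ** pauli_X ** rot nx nz x ** pauli_X ** hadamard =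
        hadamard ** ((pauli_X ** rot nx nz x ** pauli_X) ** hadamard)"
      by (simp add: matrix_mul_assoc)
    then show ?thesis
      unfolding pauli_X_def rot_def mat2_mult hadamard_conj smult_mat2 by simp
  qed
  have R': "rot (- nz) nx x \<in> A" for x unfolding eq by (intro mult H X R)
  have Y: "rot_y x \<in> A" for x
  proof -
    have eq: "rot_y x = rot nx nz (- (pi / 4)) ** rot (- nz) nx x ** rot nx nz (pi / 4)"
      using rot_conj_aux[OF of_real_unit_vector[OF nn] i_times_i, of "of_real (sqrt 2 / 2)"
          "of_real (cos x)" "of_real (sin x)"]
      by (simp add: rot_def rot_y_def cos_45 sin_45 sqrt2_mult)
    show ?thesis unfolding eq by (intro mult R R')
  qed
  have eq: "diag_phase x = adj gate_K ** rot_y (- x) ** gate_K"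
    by (simp add: gate_K_conj rot_y_def diag_phase_def smult_mat2 complex_eq_iff)
  show "diag_phase x \<in> A" unfolding eq by (intro mult gates Y)
qed

subsection \<open>The closure of the generated group\<close>

definition phase_closure :: "'b::finite op set \<Rightarrow> 'b op set" where
  "phase_closure G = closure {mat c ** W | c W. cmod c = 1 \<and> W \<in> generated_group G}"

lemma generated_group_mult:
  "V \<in> generated_group G \<Longrightarrow> W \<in> generated_group G \<Longrightarrow> V ** W \<in> generated_group G"
  by (induction rule: generated_group.induct)
     (auto simp flip: matrix_mul_assoc intro: generated_group.intros)

lemma generated_group_gate:
  "g \<in> G \<Longrightarrow> g \<in> generated_group G" "g \<in> G \<Longrightarrow> adj g \<in> generated_group G"
  using generated_group.gate[OF generated_group.one, of g G]
    generated_group.inverse[OF generated_group.one, of g G] by simp_all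

lemma generated_group_adj: "W \<in> generated_group G \<Longrightarrow> adj W \<in> generated_group G"
  by (induction rule: generated_group.induct)
     (auto simp: adj_mult intro: generated_group.one generated_group_mult generated_group_gate)

lemma generated_group_unitary:
  "W \<in> generated_group G \<Longrightarrow> (\<And>g. g \<in> G \<Longrightarrow> unitary g) \<Longrightarrow> unitary W"
  by (induction rule: generated_group.induct) (auto intro: unitary_mult unitary_adj unitary_mat_1)

lemma tendsto_matrix_mult:
  fixes A :: "complex ^ 'n::finite ^ 'm::finite"
  assumes "(f \<longlongrightarrow> A) F" "(g \<longlongrightarrow> B) F"
  shows "((\<lambda>x. f x ** g x) \<longlongrightarrow> A ** B) F"
  unfolding matrix_matrix_mult_def
  by (intro tendsto_vec_lambda tendsto_sum tendsto_mult tendsto_vec_nth assms)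

lemma tendsto_adj: "(f \<longlongrightarrow> A) F \<Longrightarrow> ((\<lambda>x. adj (f x)) \<longlongrightarrow> adj A) F"
  unfolding adj_def by (intro tendsto_vec_lambda tendsto_cnj tendsto_vec_nth)

lemma phase_closure_mult:
  assumes "V \<in> phase_closure G" "W \<in> phase_closure G"
  shows "V ** W \<in> phase_closure G"
proof -
  let ?S = "{mat c ** W | c W. cmod c = 1 \<and> W \<in> generated_group G}"
  obtain v where v: "\<And>n. v n \<in> ?S" "v \<longlonglongrightarrow> V"
    using assms(1) unfolding phase_closure_def closure_sequential by blast
  obtain w where w: "\<And>n. w n \<in> ?S" "w \<longlonglongrightarrow> W"
    using assms(2) unfolding phase_closure_def closure_sequential by blast
  have "v n ** w n \<in> ?S" for n
  proof -
    obtain c d V W where "v n = mat c ** V" "w n = mat d ** W" "cmod c = 1" "cmod d = 1"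
      "V \<in> generated_group G" "W \<in> generated_group G"
      using v(1)[of n] w(1)[of n] by blast
    moreover have "(mat c ** V) ** (mat d ** W) = mat (c * d) ** (V ** W)"
      by (metis mat_commute mat_mult_mat matrix_mul_assoc)
    moreover have "cmod (c * d) = 1" using \<open>cmod c = 1\<close> \<open>cmod d = 1\<close> by (simp add: norm_mult)
    moreover have "V ** W \<in> generated_group G"
      using \<open>V \<in> generated_group G\<close> \<open>W \<in> generated_group G\<close> by (rule generated_group_mult)
    ultimately show ?thesis by (intro CollectI exI[of _ "c * d"] exI[of _ "V ** W"]) simp
  qed
  then show ?thesis
    unfolding phase_closure_def closure_sequential using tendsto_matrix_mult[OF v(2) w(2)]
    by (intro exI[of _ "\<lambda>n. v n ** w n"]) blast
qed

lemma phase_closure_adj: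
  assumes "V \<in> phase_closure G"
  shows "adj V \<in> phase_closure G"
proof -
  let ?S = "{mat c ** W | c W. cmod c = 1 \<and> W \<in> generated_group G}"
  obtain v where v: "\<And>n. v n \<in> ?S" "v \<longlonglongrightarrow> V"
    using assms(1) unfolding phase_closure_def closure_sequential by blast
  have "adj (v n) \<in> ?S" for n
  proof -
    obtain c V where "v n = mat c ** V" "cmod c = 1" "V \<in> generated_group G"
      using v(1)[of n] by blast
    then have "adj (v n) = mat (cnj c) ** adj V" "cmod (cnj c) = 1" "adj V \<in> generated_group G"
      by (simp_all add: adj_mult mat_commute generated_group_adj)
    then show ?thesis by blast
  qed
  then show ?thesis
    unfolding phase_closure_def closure_sequential using tendsto_adj[OF v(2)]
    by (intro exI[of _ "\<lambda>n. adj (v n)"]) blast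
qed

lemma phase_closure_generated: "cmod c = 1 \<Longrightarrow> W \<in> generated_group G \<Longrightarrow> mat c ** W \<in> phase_closure G"
  unfolding phase_closure_def by (intro subsetD[OF closure_subset]) blast

lemma phase_closure_phase: "cmod c = 1 \<Longrightarrow> mat c \<in> phase_closure G"
  using phase_closure_generated[OF _ generated_group.one] by (metis matrix_mul_rid)

lemma phase_closure_gate: "g \<in> G \<Longrightarrow> g \<in> phase_closure G"
  using phase_closure_generated[of 1 g G] generated_group_gate by (metis matrix_mul_lid norm_one)

text \<open>The equations that define unitarity are continuous and pass to limits.\<close>

lemma phase_closure_unitary:
  assumes "W \<in> phase_closure G" and u: "\<And>g. g \<in> G \<Longrightarrow> unitary g"
  shows "unitary W"
proof -
  let ?S = "{mat c ** W | c W. cmod c = 1 \<and> W \<in> generated_group G}"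
  obtain v where v: "\<And>n. v n \<in> ?S" "v \<longlonglongrightarrow> W"
    using assms(1) unfolding phase_closure_def closure_sequential by blast
  have uv: "unitary (v n)" for n
  proof -
    obtain c V where "v n = mat c ** V" "cmod c = 1" "V \<in> generated_group G"
      using v(1)[of n] by blast
    moreover from this have "unitary (mat c)"
      by (simp add: unitary_def complex_norm_square[symmetric] mult.commute)
    ultimately show ?thesis using generated_group_unitary[OF _ u] unitary_mult by metis
  qed
  have "(\<lambda>n. adj (v n) ** v n) \<longlonglongrightarrow> adj W ** W" "(\<lambda>n. v n ** adj (v n)) \<longlonglongrightarrow> W ** adj W"
    by (intro tendsto_matrix_mult tendsto_adj v)+
  then show ?thesis
    using uv by (simp add: unitary_def LIMSEQ_const_iff)
qed

subsection \<open>Controlled operations\<close>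

text \<open>A uniformly controlled gate: the bits other than \<open>q\<close> select the matrix
  applied to \<open>q\<close>. \<open>F\<close> receives the whole row state; that it ignores the
  bit at \<open>q\<close> is assumed where it matters. One-qubit gates, \<open>CZ\<close> and
  multiply controlled gates all have this shape and share one product rule.\<close>

definition controlled :: "'n::finite \<Rightarrow> (('n \<Rightarrow> bool) \<Rightarrow> bool op) \<Rightarrow> ('n \<Rightarrow> bool) op" where
  "controlled q F = (\<chi> x y. if \<forall>p. p \<noteq> q \<longrightarrow> x p = y p then F x $ x q $ y q else 0)"

lemma controlled_nth:
  "controlled q F $ x $ y = (if \<forall>p. p \<noteq> q \<longrightarrow> x p = y p then F x $ x q $ y q else 0)"
  by (simp add: controlled_def)

lemma sum_agree_off:
  "(\<Sum>k\<in>UNIV. if \<forall>p. p \<noteq> q \<longrightarrow> x p = k p then f k else 0) =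
     (f (x(q := False)) + f (x(q := True)) :: complex)"
  for q :: "'n::finite"
proof -
  have "k \<in> {x(q := False), x(q := True)}" if "\<forall>p. p \<noteq> q \<longrightarrow> x p = k p" for k
    using that by (cases "k q") (auto simp: fun_eq_iff)
  then have "(\<Sum>k\<in>UNIV. if \<forall>p. p \<noteq> q \<longrightarrow> x p = k p then f k else 0) =
      (\<Sum>k\<in>{x(q := False), x(q := True)}. if \<forall>p. p \<noteq> q \<longrightarrow> x p = k p then f k else 0)"
    by (intro sum.mono_neutral_right) auto
  also have "\<dots> = f (x(q := False)) + f (x(q := True))"
    using fun_upd_same[of x q] by (subst sum.insert) (auto dest: fun_cong[of _ _ q])
  finally show ?thesis .
qed

text \<open>\<open>F\<close> is evaluated at the row \<open>x\<close> itself, but \<open>G\<close>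
  at the intermediate state, which may differ from \<open>x\<close> at \<open>q\<close>; hence the
  condition on \<open>G\<close>.\<close>

lemma controlled_mult:
  assumes "\<And>x b. G (x(q := b)) = G x"
  shows "controlled q F ** controlled q G = controlled q (\<lambda>x. F x ** G x)"
proof (rule matrix_ext)
  fix x z
  have "(controlled q F ** controlled q G) $ x $ z =
      (\<Sum>k\<in>UNIV. if \<forall>p. p \<noteq> q \<longrightarrow> x p = k p then F x $ x q $ k q * controlled q G $ k $ z else 0)"
    unfolding mult_nth by (intro sum.cong) (auto simp: controlled_nth)
  also have "\<dots> = controlled q (\<lambda>x. F x ** G x) $ x $ z"
    unfolding sum_agree_off by (auto simp: controlled_nth bool_mult_nth assms)
  finally show "(controlled q F ** controlled q G) $ x $ z = controlled q (\<lambda>x. F x ** G x) $ x $ z" .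
qed

lemma controlled_const_mult:
  "controlled q F ** controlled q (\<lambda>_. M) = controlled q (\<lambda>x. F x ** M)"
  by (rule controlled_mult) simp

lemma controlled_mat: "controlled q (\<lambda>_. mat c) = mat c"
  by (rule matrix_ext) (auto simp: controlled_nth mat_nth fun_eq_iff)

lemma controlled_cong: "(\<And>x. F x = G x) \<Longrightarrow> controlled q F = controlled q G"
  by (rule matrix_ext) (auto simp: controlled_nth)

lemma adj_controlled_const: "adj (controlled q (\<lambda>_. M)) = controlled q (\<lambda>_. adj M)"
  by (rule matrix_ext) (auto simp: controlled_nth)

text \<open>Pulled back along a continuous embedding, the closure becomes a closed set of two-by-two
  matrices, where \<open>closed_contains_diag_phase\<close> applies.\<close>

lemma closed_controlled_const: "closed {M. controlled q (\<lambda>_. M) \<in> phase_closure G}"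
proof -
  have if_const: "continuous_on UNIV (\<lambda>M. if P then f M else 0)" if "continuous_on UNIV f"
    for P and f :: "bool op \<Rightarrow> complex"
    using that by (cases P) simp_all
  have "continuous_on UNIV (\<lambda>M. controlled q (\<lambda>_. M))"
    unfolding controlled_def
    by (intro continuous_on_vec_lambda if_const continuous_intros)
  moreover have "closed (phase_closure G)" by (simp add: phase_closure_def)
  ultimately show ?thesis
    using closed_vimage[of "phase_closure G" "\<lambda>M. controlled q (\<lambda>_. M)"] by (simp add: vimage_def)
qed

section \<open>Gates placed on qubits of a larger register\<close>

lemma place_on_one_qubit: "place (\<lambda>_. q) (on_one_qubit M) = controlled q (\<lambda>_. M)"
  by (rule matrix_ext) (auto simp: place_def on_one_qubit_def tensor_def controlled_nth UNIV_1)

lemma place_gate_CZ: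
  fixes f :: "2 \<Rightarrow> 'n::finite"
  assumes "inj f"
  shows "place f gate_CZ = controlled (f 1) (\<lambda>x. if x (f 2) then pauli_Z else mat 1)"
proof (rule matrix_ext)
  fix x y :: "'n \<Rightarrow> bool"
  have n: "f 1 \<noteq> f 2" using assms by (simp add: inj_eq)
  have r: "range f = {f 1, f 2}" by (auto simp: UNIV_2)
  have e: "x \<circ> f = y \<circ> f \<longleftrightarrow> x (f 1) = y (f 1) \<and> x (f 2) = y (f 2)"
    by (auto simp: fun_eq_iff forall_2)
  show "place f gate_CZ $ x $ y = controlled (f 1) (\<lambda>x. if x (f 2) then pauli_Z else mat 1) $ x $ y"
    unfolding place_def gate_CZ_def controlled_nth r e vec_lambda_beta forall_2
    using n by (cases "x (f 1)"; cases "x (f 2)"; cases "y (f 1)"; cases "y (f 2)") (auto simp: pauli_Z_def mat_nth intro: exI[of _ "f 2"])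
qed

lemma place_mult:
  assumes "inj f"
  shows "place f A ** place f B = place f (A ** B)"
proof (rule matrix_ext)
  fix x z
  let ?e = "\<lambda>x y. \<forall>q. q \<notin> range f \<longrightarrow> x q = y q"
  have inv: "inv f (f k) = k" for k using assms by simp
  have "(place f A ** place f B) $ x $ z =
      (\<Sum>k\<in>{k. ?e x k}. if ?e k z then A $ (x \<circ> f) $ (k \<circ> f) * B $ (k \<circ> f) $ (z \<circ> f) else 0)"
    unfolding mult_nth by (intro sum.mono_neutral_cong_right) (auto simp: place_def)
  also have "\<dots> = (\<Sum>k\<in>{k. ?e x k}. if ?e x z then A $ (x \<circ> f) $ (k \<circ> f) * B $ (k \<circ> f) $ (z \<circ> f) else 0)"
    by (intro sum.cong if_cong) auto
  \<comment> \<open>States that agree with \<open>x\<close> off \<open>range f\<close> correspond to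
    states \<open>g\<close> of the small register; the witness glues \<open>g\<close> into
    \<open>x\<close>.\<close>
  also have "\<dots> = (\<Sum>g\<in>UNIV. if ?e x z then A $ (x \<circ> f) $ g * B $ g $ (z \<circ> f) else 0)"
    by (rule sum.reindex_bij_witness[of _ "\<lambda>g q. if q \<in> range f then g (inv f q) else x q" "\<lambda>k. k \<circ> f"])
       (auto simp: fun_eq_iff inv)
  also have "\<dots> = place f (A ** B) $ x $ z"
    unfolding if_sum by (simp only: place_def mult_nth vec_lambda_beta)
  finally show "(place f A ** place f B) $ x $ z = place f (A ** B) $ x $ z" .
qed

lemma place_mat_1: "place f (mat 1) = mat 1"
  for f :: "'k::finite \<Rightarrow> 'q::finite"
proof (rule matrix_ext)
  fix x y :: "'q \<Rightarrow> bool"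
  have "(\<forall>q. q \<notin> range f \<longrightarrow> x q = y q) \<and> x \<circ> f = y \<circ> f \<longleftrightarrow> x = y"
    unfolding fun_eq_iff o_apply by (metis rangeE)
  then show "place f (mat 1) $ x $ y = mat 1 $ x $ y"
    by (auto simp: place_def mat_nth)
qed

lemma adj_place: "adj (place f A) = place f (adj A)"
  by (rule matrix_ext) (auto simp: place_def)

lemma unitary_place: "inj f \<Longrightarrow> unitary A \<Longrightarrow> unitary (place f A)"
  by (simp add: unitary_def adj_place place_mult place_mat_1)

lemma unitary_diag_sign:
  "unitary (\<chi> x y. if x = y then (if P x then - 1 else 1) else 0)"
proof -
  define D :: "'a op" where "D = (\<chi> x y. if x = y then (if P x then - 1 else 1) else 0)"
  have "adj D = D" by (rule matrix_ext) (auto simp: D_def)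
  moreover have "D ** D = mat 1"
    by (rule matrix_ext) (simp add: D_def mult_nth if_mult_sum mat_nth)
  ultimately show ?thesis unfolding D_def[symmetric] by (simp add: unitary_def)
qed

lemma unitary_on_one_qubit: "unitary M \<Longrightarrow> unitary (on_one_qubit M)"
  by (simp add: on_one_qubit_def unitary_tensor)

lemma unitary_gates: "g \<in> K_T_S_CZ_CCZ_gates \<Longrightarrow> unitary g"
  unfolding K_T_S_CZ_CCZ_gates_def placements_def gate_CZ_def gate_CCZ_def
  by (auto intro!: unitary_place unitary_on_one_qubit unitary_gate_K unitary_gate_T unitary_gate_S
      unitary_diag_sign)

abbreviation gate_closure :: "('n::finite \<Rightarrow> bool) op set" where
  "gate_closure \<equiv> phase_closure K_T_S_CZ_CCZ_gates"

lemma gate_closure_one_qubit_gate: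
  assumes "M = gate_K \<or> M = gate_T \<or> M = gate_S"
  shows "controlled q (\<lambda>_. M) \<in> gate_closure"
proof (rule phase_closure_gate)
  have "inj (\<lambda>_ :: 1. q)" by (simp add: inj_def)
  then have "place (\<lambda>_ :: 1. q) (on_one_qubit M) \<in> placements (on_one_qubit M)"
    unfolding placements_def by blast
  then show "controlled q (\<lambda>_. M) \<in> K_T_S_CZ_CCZ_gates"
    unfolding place_on_one_qubit K_T_S_CZ_CCZ_gates_def using assms by auto
qed

lemma gate_closure_one_qubit:
  "controlled q (\<lambda>_. hadamard) \<in> gate_closure"
  "controlled q (\<lambda>_. pauli_X) \<in> gate_closure"
  "controlled q (\<lambda>_. diag_phase x) \<in> gate_closure"
proof -
  let ?A = "{M. controlled q (\<lambda>_. M) \<in> gate_closure}"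
  have mult: "M ** N \<in> ?A" if "M \<in> ?A" "N \<in> ?A" for M N
    using that phase_closure_mult[of "controlled q (\<lambda>_. M)" _ "controlled q (\<lambda>_. N)"]
    by (simp add: controlled_const_mult)
  have adj: "adj M \<in> ?A" if "M \<in> ?A" for M
    using that phase_closure_adj[of "controlled q (\<lambda>_. M)"] by (simp add: adj_controlled_const)
  have phase: "mat c \<in> ?A" if "cmod c = 1" for c
    using phase_closure_phase[OF that] by (simp add: controlled_mat)
  have gates: "gate_K \<in> ?A" "gate_T \<in> ?A" "gate_S \<in> ?A"
    by (simp_all add: gate_closure_one_qubit_gate)
  show "controlled q (\<lambda>_. hadamard) \<in> gate_closure"
    "controlled q (\<lambda>_. pauli_X) \<in> gate_closure"
    "controlled q (\<lambda>_. diag_phase x) \<in> gate_closure"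
    using closed_contains_diag_phase[OF closed_controlled_const mult phase gates(1) adj[OF gates(1)]
        gates(2,3) adj[OF gates(3)]] by simp_all
qed

text \<open>Hadamard gates on the target turn a controlled Z into a controlled X.\<close>

lemma gate_closure_CX_1:
  assumes "c \<noteq> q"
  shows "controlled q (\<lambda>x. if x c then pauli_X else mat 1) \<in> gate_closure"
proof -
  let ?f = "\<lambda>i :: 2. if i = 1 then q else c"
  have "inj ?f" using assms by (auto simp: inj_def forall_2)
  then have "place ?f gate_CZ \<in> gate_closure"
    unfolding K_T_S_CZ_CCZ_gates_def placements_def by (intro phase_closure_gate) blast
  then have "controlled q (\<lambda>x. if x c then pauli_Z else mat 1) \<in> gate_closure"
    using place_gate_CZ[OF \<open>inj ?f\<close>] by simp
  then have "controlled q (\<lambda>_. hadamard) ** controlled q (\<lambda>x. if x c then pauli_Z else mat 1) **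
      controlled q (\<lambda>_. hadamard) \<in> gate_closure"
    by (intro phase_closure_mult gate_closure_one_qubit)
  also have "controlled q (\<lambda>_. hadamard) ** controlled q (\<lambda>x. if x c then pauli_Z else mat 1) **
      controlled q (\<lambda>_. hadamard) =
      controlled q (\<lambda>x. hadamard ** (if x c then pauli_Z else mat 1) ** hadamard)"
    using assms by (simp add: controlled_mult)
  also have "\<dots> = controlled q (\<lambda>x. if x c then pauli_X else mat 1)"
  proof (rule controlled_cong)
    fix x :: "'a \<Rightarrow> bool"
    show "hadamard ** (if x c then pauli_Z else mat 1) ** hadamard = (if x c then pauli_X else mat 1)"
      using hadamard_conj[of 1 0 0 1] hadamard_conj[of 1 0 0 "- 1"]
      by (simp add: pauli_Z_def pauli_X_def mat_mat2 smult_mat2 mat2_mult flip: matrix_mul_assoc)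
  qed
  finally show ?thesis .
qed

lemma pauli_X_mult: "pauli_X ** pauli_X = mat 1"
  by (simp add: pauli_X_def mat2_mult mat_mat2)

lemma gate_closure_CX:
  assumes "c \<noteq> q"
  shows "controlled q (\<lambda>x. if x c = b then pauli_X else mat 1) \<in> gate_closure"
proof (cases b)
  case True
  then show ?thesis using gate_closure_CX_1[OF assms] by simp
next
  case False
  \<comment> \<open>An additional unconditional X exchanges the roles of the two control
    values.\<close>
  have "controlled q (\<lambda>x. if x c then pauli_X else mat 1) ** controlled q (\<lambda>_. pauli_X) \<in> gate_closure"
    by (intro phase_closure_mult gate_closure_CX_1 gate_closure_one_qubit assms)
  also have "controlled q (\<lambda>x. if x c then pauli_X else mat 1) ** controlled q (\<lambda>_. pauli_X) =
      controlled q (\<lambda>x. if x c = b then pauli_X else mat 1)"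
    unfolding controlled_const_mult by (rule controlled_cong) (simp add: False pauli_X_mult)
  finally show ?thesis .
qed

text \<open>
  One more control on a diagonal gate comes from its commutator with a controlled \<open>X\<close>, because
  \<open>X\<close> inverts the gate.
\<close>

lemma gate_closure_controlled_diag_phase:
  assumes "finite S" "q \<notin> S"
  shows "controlled q (\<lambda>x. if \<forall>s\<in>S. x s = p s then diag_phase \<theta> else mat 1) \<in> gate_closure"
  using assms
proof (induction S arbitrary: \<theta> rule: finite_induct)
  case empty
  then show ?case by (simp add: gate_closure_one_qubit)
next
  case (insert c S)
  let ?D = "\<lambda>\<theta>. \<lambda>x. if \<forall>s\<in>S. x s = p s then diag_phase \<theta> else mat 1"
  let ?X = "\<lambda>x. if x c = p c then pauli_X else mat 1"
  have "c \<noteq> q" "q \<notin> S" using insert by auto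
  have X: "?X (x(q := b)) = ?X x" for x b using \<open>c \<noteq> q\<close> by simp
  have D: "?D \<theta> (x(q := b)) = ?D \<theta> x" for x b \<theta>
  proof -
    have "(\<forall>s\<in>S. (x(q := b)) s = p s) \<longleftrightarrow> (\<forall>s\<in>S. x s = p s)" using \<open>q \<notin> S\<close> by auto
    then show ?thesis by simp
  qed
  \<comment> \<open>The half angles cancel when the new control is off and add up to \<theta> when
    it is on.\<close>
  have "controlled q (?D (\<theta> / 2)) ** (controlled q ?X ** (controlled q (?D (- \<theta> / 2)) ** controlled q ?X)) \<in> gate_closure"
    using insert \<open>c \<noteq> q\<close> by (intro phase_closure_mult gate_closure_CX) auto
  also have "controlled q (?D (\<theta> / 2)) ** (controlled q ?X ** (controlled q (?D (- \<theta> / 2)) ** controlled q ?X)) =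
      controlled q (\<lambda>x. ?D (\<theta> / 2) x ** (?X x ** (?D (- \<theta> / 2) x ** ?X x)))"
  proof -
    have "controlled q (?D (- \<theta> / 2)) ** controlled q ?X = controlled q (\<lambda>x. ?D (- \<theta> / 2) x ** ?X x)"
      by (rule controlled_mult) (rule X)
    moreover have "controlled q ?X ** controlled q (\<lambda>x. ?D (- \<theta> / 2) x ** ?X x) =
        controlled q (\<lambda>x. ?X x ** (?D (- \<theta> / 2) x ** ?X x))"
      by (rule controlled_mult) (simp only: X D)
    moreover have "controlled q (?D (\<theta> / 2)) ** controlled q (\<lambda>x. ?X x ** (?D (- \<theta> / 2) x ** ?X x)) =
        controlled q (\<lambda>x. ?D (\<theta> / 2) x ** (?X x ** (?D (- \<theta> / 2) x ** ?X x)))"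
      by (rule controlled_mult) (simp only: X D)
    ultimately show ?thesis by simp
  qed
  also have "\<dots> = controlled q (\<lambda>x. if \<forall>s\<in>insert c S. x s = p s then diag_phase \<theta> else mat 1)"
    by (rule controlled_cong)
       (auto simp: pauli_X_mult diag_phase_def pauli_X_def mat2_mult mat_mat2 cis_mult)
  finally show ?case .
qed

definition phase_on :: "'n set \<Rightarrow> ('n \<Rightarrow> bool) \<Rightarrow> real \<Rightarrow> ('n::finite \<Rightarrow> bool) op" where
  "phase_on S p \<theta> = (\<chi> x y. if x = y then (if \<forall>s\<in>S. x s = p s then cis \<theta> else 1) else 0)"

lemma phase_on_nth:
  "phase_on S p \<theta> $ x $ y = (if x = y then (if \<forall>s\<in>S. x s = p s then cis \<theta> else 1) else 0)"
  by (simp add: phase_on_def)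

text \<open>A phase \<theta> with one more condition is the phase \<theta>/2 on \<open>S\<close>
  times a controlled \<open>diag_phase\<close> on \<open>q\<close>, which contributes another
  \<theta>/2 where \<open>x q = p q\<close> and undoes the first one elsewhere. The recursion ends
  in a global phase.\<close>

lemma gate_closure_phase_on: "finite S \<Longrightarrow> phase_on S p \<theta> \<in> gate_closure"
proof (induction S arbitrary: \<theta> rule: finite_induct)
  case empty
  have "phase_on {} p \<theta> = mat (cis \<theta>)"
    by (rule matrix_ext) (simp add: phase_on_nth mat_nth)
  then show ?case by (simp add: phase_closure_phase)
next
  case (insert q S)
  let ?\<sigma> = "if p q then - \<theta> / 2 else \<theta> / 2"
  let ?D = "\<lambda>x. if \<forall>s\<in>S. x s = p s then diag_phase ?\<sigma> else mat 1"
  have "phase_on S p (\<theta> / 2) ** controlled q ?D \<in> gate_closure"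
    using insert by (intro phase_closure_mult gate_closure_controlled_diag_phase) auto
  also have "phase_on S p (\<theta> / 2) ** controlled q ?D = phase_on (insert q S) p \<theta>"
  proof (rule matrix_ext)
    fix x y :: "'a \<Rightarrow> bool"
    have "(phase_on S p (\<theta> / 2) ** controlled q ?D) $ x $ y =
        (if \<forall>s\<in>S. x s = p s then cis (\<theta> / 2) else 1) * controlled q ?D $ x $ y"
      by (simp add: mult_nth phase_on_nth if_mult_sum)
    also have "\<dots> = phase_on (insert q S) p \<theta> $ x $ y"
    proof (cases "\<forall>r. r \<noteq> q \<longrightarrow> x r = y r")
      case True
      then have "x = y \<longleftrightarrow> x q = y q" by (auto simp: fun_eq_iff)
      then show ?thesis
        using True by (cases "x q"; cases "y q"; cases "p q")
          (auto simp: controlled_nth phase_on_nth diag_phase_def mat_nth cis_mult)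
    next
      case False
      then have "x \<noteq> y" by auto
      then show ?thesis using False by (auto simp: controlled_nth phase_on_nth)
    qed
    finally show "(phase_on S p (\<theta> / 2) ** controlled q ?D) $ x $ y = phase_on (insert q S) p \<theta> $ x $ y" .
  qed
  finally show ?case .
qed

lemma phase_on_UNIV_apply: "(phase_on UNIV a \<theta> *v v) $ x = (if x = a then cis \<theta> else 1) * v $ x"
proof -
  have "(\<forall>s. x s = a s) \<longleftrightarrow> x = a" by auto
  then show ?thesis
    by (simp add: mult_vec_nth phase_on_nth if_mult_sum)
qed

subsection \<open>Reduction of unitary matrices by plane rotations\<close>

text \<open>The real Givens rotation in the plane of two basis states.\<close>

definition plane_rot :: "'b \<Rightarrow> 'b \<Rightarrow> real \<Rightarrow> 'b::finite op" where
  "plane_rot a b \<theta> = (\<chi> x y.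
     if x = a then (if y = a then of_real (cos \<theta>) else if y = b then - of_real (sin \<theta>) else 0)
     else if x = b then (if y = a then of_real (sin \<theta>) else if y = b then of_real (cos \<theta>) else 0)
     else if x = y then 1 else 0)"

lemma plane_rot_apply:
  assumes "a \<noteq> b"
  shows "(plane_rot a b \<theta> *v v) $ x =
    (if x = a then of_real (cos \<theta>) * v $ a - of_real (sin \<theta>) * v $ b
     else if x = b then of_real (sin \<theta>) * v $ a + of_real (cos \<theta>) * v $ b else v $ x)"
proof -
  have two: "(\<Sum>y\<in>UNIV. (if y = a then s else if y = b then t else 0) * v $ y) = s * v $ a + t * v $ b" for s t
  proof -
    have "(\<Sum>y\<in>UNIV. (if y = a then s else if y = b then t else 0) * v $ y) =
        (\<Sum>y\<in>UNIV. (if y = a then s else 0) * v $ y + (if y = b then t else 0) * v $ y)"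
      using assms by (intro sum.cong) auto
    then show ?thesis by (simp add: sum.distrib if_mult_sum)
  qed
  show ?thesis
    using assms by (auto simp: mult_vec_nth plane_rot_def two if_mult_sum)
qed

lemma plane_rot_swap: "a \<noteq> b \<Longrightarrow> plane_rot b a \<theta> = plane_rot a b (- \<theta>)"
  by (rule matrix_ext) (simp add: plane_rot_def)

text \<open>The quarter turn in the plane of \<open>b\<close> and \<open>c\<close> carries the axis
  \<open>b\<close> to the axis \<open>c\<close> and fixes \<open>a\<close>.\<close>

lemma plane_rot_conj:
  assumes "a \<noteq> b" "a \<noteq> c" "b \<noteq> c"
  shows "plane_rot a c \<theta> = plane_rot b c (pi / 2) ** plane_rot a b \<theta> ** plane_rot b c (- (pi / 2))"
  unfolding matrix_eq matrix_vector_mul_assoc[symmetric] vec_eq_iff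
proof (intro allI)
  fix v x
  show "(plane_rot a c \<theta> *v v) $ x =
      (plane_rot b c (pi / 2) *v (plane_rot a b \<theta> *v (plane_rot b c (- (pi / 2)) *v v))) $ x"
    unfolding plane_rot_apply[OF assms(1)] plane_rot_apply[OF assms(2)] plane_rot_apply[OF assms(3)]
    using assms by simp
qed

lemma rot_y_conj: "rot_y \<theta> = gate_K ** diag_phase (- \<theta>) ** adj gate_K"
proof -
  have "diag_phase (- \<theta>) = adj gate_K ** rot_y \<theta> ** gate_K"
    unfolding rot_y_def gate_K_conj by (simp add: diag_phase_def smult_mat2 complex_eq_iff)
  then show ?thesis
    by (simp flip: matrix_mul_assoc add: unitaryD[OF unitary_gate_K] unitary_cancel[OF unitary_gate_K])
qed

text \<open>Two basis states that differ only at \<open>q\<close> span the plane on which a y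
  rotation of \<open>q\<close> acts when all other qubits control it.\<close>

lemma gate_closure_plane_rot_adjacent:
  "plane_rot (p(q := False)) (p(q := True)) \<theta> \<in> gate_closure"
proof -
  let ?C = "\<lambda>x. \<forall>s\<in>- {q}. x s = p s"
  let ?D = "\<lambda>x. if ?C x then diag_phase (- \<theta>) else mat 1"
  have K: "controlled q (\<lambda>_. gate_K) \<in> gate_closure" by (simp add: gate_closure_one_qubit_gate)
  have D: "?D (x(q := b)) = ?D x" for x b
  proof -
    have "?C (x(q := b)) \<longleftrightarrow> ?C x" by auto
    then show ?thesis by simp
  qed
  have "controlled q (\<lambda>_. gate_K) ** controlled q ?D ** adj (controlled q (\<lambda>_. gate_K)) \<in> gate_closure"
    by (intro phase_closure_mult phase_closure_adj K gate_closure_controlled_diag_phase) auto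
  also have "controlled q (\<lambda>_. gate_K) ** controlled q ?D = controlled q (\<lambda>x. gate_K ** ?D x)"
    by (rule controlled_mult) (rule D)
  also have "\<dots> ** adj (controlled q (\<lambda>_. gate_K)) = controlled q (\<lambda>x. if ?C x then rot_y \<theta> else mat 1)"
    unfolding adj_controlled_const controlled_const_mult
    by (rule controlled_cong) (simp add: rot_y_conj unitaryD[OF unitary_gate_K])
  also have "\<dots> = plane_rot (p(q := False)) (p(q := True)) \<theta>"
  proof (rule matrix_ext)
    fix x y
    define P where "P = ?C"
    have P: "?C z \<longleftrightarrow> P z" for z by (simp add: P_def)
    have e: "z = p(q := b) \<longleftrightarrow> P z \<and> z q = b" for z b
      by (auto simp: P_def fun_eq_iff)
    show "controlled q (\<lambda>x. if ?C x then rot_y \<theta> else mat 1) $ x $ y =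
        plane_rot (p(q := False)) (p(q := True)) \<theta> $ x $ y"
    proof (cases "\<forall>r. r \<noteq> q \<longrightarrow> x r = y r")
      case True
      then have "P x = P y" "x = y \<longleftrightarrow> x q = y q" by (auto simp: fun_eq_iff P_def)
      then show ?thesis
        unfolding controlled_nth plane_rot_def vec_lambda_beta e P if_P[OF True]
        by (cases "x q"; cases "y q") (simp_all add: rot_y_def mat_nth)
    next
      case False
      then have "x \<noteq> y" "\<not> (P x \<and> P y)" by (auto simp: P_def)
      then show ?thesis
        unfolding controlled_nth plane_rot_def vec_lambda_beta e P if_not_P[OF False]
        by (cases "P x") simp_all
    qed
  qed
  finally show ?thesis .
qed

text \<open>Induction on the Hamming distance: \<open>c\<close> is one step from \<open>b\<close>
  towards \<open>a\<close>, and a quarter turn in the plane of \<open>c\<close> and \<open>b\<close>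
  extends the rotation from \<open>c\<close> to \<open>b\<close>.\<close>

lemma gate_closure_plane_rot: "a \<noteq> b \<Longrightarrow> plane_rot a b \<theta> \<in> gate_closure"
proof (induction "card {q. a q \<noteq> b q}" arbitrary: b \<theta> rule: less_induct)
  case less
  then obtain q where q: "a q \<noteq> b q" by blast
  define c where "c = b(q := a q)"
  have cb: "c \<noteq> b" using q by (auto simp: c_def fun_eq_iff)
  have adjacent: "plane_rot c b \<theta> \<in> gate_closure" for \<theta>
  proof (cases "b q")
    case True
    then have "c = b(q := False)" "b = b(q := True)" using q by (auto simp: c_def fun_eq_iff)
    then show ?thesis using gate_closure_plane_rot_adjacent[of b q \<theta>] by simp
  next
    case False
    then have "c = b(q := True)" "b = b(q := False)" using q by (auto simp: c_def fun_eq_iff)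
    then have "plane_rot b c (- \<theta>) \<in> gate_closure"
      using gate_closure_plane_rot_adjacent[of b q "- \<theta>"] by simp
    then show ?thesis using plane_rot_swap[of c b "- \<theta>"] cb by simp
  qed
  show ?case
  proof (cases "c = a")
    case True
    then show ?thesis using adjacent by simp
  next
    case False
    have "card {r. a r \<noteq> c r} < card {r. a r \<noteq> b r}"
      using q by (intro psubset_card_mono) (auto simp: c_def)
    then have "plane_rot a c \<theta> \<in> gate_closure" using less.hyps False by metis
    then show ?thesis
      using False cb less.prems adjacent plane_rot_conj[of a c b \<theta>]
      by (simp add: phase_closure_mult)
  qed
qed

lemma cis_Arg_mult: "cis (- Arg z) * z = of_real (cmod z)"
proof -
  have "cis (- Arg z) * z = cis (- Arg z) * rcis (cmod z) (Arg z)" by (simp only: rcis_cmod_Arg)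
  also have "\<dots> = of_real (cmod z)" by (simp add: rcis_def mult.left_commute cis_mult)
  finally show ?thesis .
qed

text \<open>Two phases make the entries at \<open>a\<close> and \<open>b\<close> real and
  nonnegative; a plane rotation then annihilates the entry at \<open>b\<close>.\<close>

lemma rotate_to_axis:
  fixes v :: "('n::finite \<Rightarrow> bool) state"
  assumes "a \<noteq> b"
  obtains W where "W \<in> gate_closure" "(W *v v) $ b = 0"
    "\<And>u x. x \<noteq> a \<Longrightarrow> x \<noteq> b \<Longrightarrow> (W *v u) $ x = u $ x"
    "\<And>x. x \<noteq> a \<Longrightarrow> x \<noteq> b \<Longrightarrow> W *v axis x 1 = axis x 1"
proof -
  \<comment> \<open>\<open>Arg z\<close> is the polar angle of the point whose coordinates are the
    two moduli, which is the angle to rotate back by.\<close>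
  define z where "z = Complex (cmod (v $ a)) (cmod (v $ b))"
  have re: "cmod (v $ a) = cmod z * cos (Arg z)" and im: "cmod (v $ b) = cmod z * sin (Arg z)"
    using rcis_cmod_Arg[of z] by (metis Re_rcis z_def complex.sel(1), metis Im_rcis z_def complex.sel(2))
  define W where "W = plane_rot a b (- Arg z) ** (phase_on UNIV a (- Arg (v $ a)) ** phase_on UNIV b (- Arg (v $ b)))"
  have W: "W *v u = plane_rot a b (- Arg z) *v (phase_on UNIV a (- Arg (v $ a)) *v (phase_on UNIV b (- Arg (v $ b)) *v u))" for u
    by (simp add: W_def matrix_vector_mul_assoc matrix_mul_assoc)
  show thesis
  proof
    show "W \<in> gate_closure"
      unfolding W_def by (intro phase_closure_mult gate_closure_plane_rot gate_closure_phase_on assms) auto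
    show "(W *v v) $ b = 0"
      using assms unfolding W plane_rot_apply[OF assms]
      by (simp add: phase_on_UNIV_apply cis_Arg_mult re im)
    show "(W *v u) $ x = u $ x" if "x \<noteq> a" "x \<noteq> b" for u x
      using that unfolding W plane_rot_apply[OF assms] by (simp add: phase_on_UNIV_apply)
    show "W *v axis x 1 = axis x 1" if "x \<noteq> a" "x \<noteq> b" for x
      using that assms unfolding W vec_eq_iff plane_rot_apply[OF assms]
      by (simp add: phase_on_UNIV_apply axis_def)
  qed
qed

text \<open>The entries in \<open>A\<close> are eliminated one at a time. That \<open>W\<close>
  fixes the basis vectors outside \<open>insert a A\<close> protects columns that have already been
  reduced.\<close>

lemma reduce_to_axis:
  fixes v :: "('n::finite \<Rightarrow> bool) state"
  assumes "finite A" "a \<notin> A" "\<And>x. x \<notin> insert a A \<Longrightarrow> v $ x = 0"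
  shows "\<exists>W\<in>gate_closure. (\<forall>x. x \<notin> insert a A \<longrightarrow> W *v axis x 1 = axis x 1) \<and> (\<exists>r. W *v v = r *s axis a 1)"
  using assms
proof (induction A arbitrary: v rule: finite_induct)
  case empty
  have "mat 1 *v v = v $ a *s axis a 1"
    using empty by (simp add: vec_eq_iff axis_def)
  moreover have "mat 1 \<in> gate_closure" by (rule phase_closure_phase) simp
  ultimately show ?case by (intro bexI[of _ "mat 1"]) auto
next
  case (insert b A)
  then have "a \<noteq> b" by auto
  obtain V where V: "V \<in> gate_closure" "(V *v v) $ b = 0"
    "\<And>u x. x \<noteq> a \<Longrightarrow> x \<noteq> b \<Longrightarrow> (V *v u) $ x = u $ x"
    "\<And>x. x \<noteq> a \<Longrightarrow> x \<noteq> b \<Longrightarrow> V *v axis x 1 = axis x 1"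
    using rotate_to_axis[where v = v, OF \<open>a \<noteq> b\<close>] by blast
  have "(V *v v) $ x = 0" if "x \<notin> insert a A" for x
    using that V(2) V(3)[of x v] insert.prems(2)[of x] by (cases "x = b") auto
  then obtain W r where W: "W \<in> gate_closure" "\<And>x. x \<notin> insert a A \<Longrightarrow> W *v axis x 1 = axis x 1"
    "W *v (V *v v) = r *s axis a 1"
    using insert.IH[of "V *v v"] insert.prems by blast
  have "W ** V \<in> gate_closure" using W V by (intro phase_closure_mult)
  moreover have "(W ** V) *v axis x 1 = axis x 1" if "x \<notin> insert a (insert b A)" for x
    using that by (simp add: W(2) V(4) flip: matrix_vector_mul_assoc)
  moreover have "(W ** V) *v v = r *s axis a 1"
    using W(3) by (simp add: matrix_vector_mul_assoc)
  ultimately show ?case by blast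
qed

lemma mult_axis_nth: "(A *v axis x 1) $ i = (A $ i $ x :: complex)"
  by (simp add: mult_vec_nth axis_def if_mult_sum)

text \<open>Reduction of \<open>U\<close> to the identity column by column; \<open>A\<close> is the
  set of columns still to be treated.\<close>

lemma gate_closure_unitary_fixing:
  fixes U :: "('n::finite \<Rightarrow> bool) op"
  assumes "finite A" "unitary U" "\<And>x. x \<notin> A \<Longrightarrow> U *v axis x 1 = axis x 1"
  shows "U \<in> gate_closure"
  using assms
proof (induction A arbitrary: U rule: finite_induct)
  case empty
  have "U = mat 1"
    by (rule matrix_ext) (metis empty.prems(2) empty_iff matrix_vector_mul_lid mult_axis_nth)
  then show ?case by (simp add: phase_closure_phase)
next
  case (insert a A)
  define v where "v = U *v axis a 1"
  \<comment> \<open>Column \<open>x\<close> is already a basis vector, so its orthogonality to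
    column \<open>a\<close> makes this entry vanish.\<close>
  have "v $ x = 0" if x: "x \<notin> insert a A" for x
  proof -
    have col: "U $ i $ x = (if i = x then 1 else 0)" for i
    proof -
      have "U $ i $ x = axis x 1 $ i" using insert.prems(2)[OF x] by (metis mult_axis_nth)
      then show ?thesis by (simp add: axis_def)
    qed
    have "(\<Sum>i\<in>UNIV. cnj (U $ i $ x) * U $ i $ a) = (adj U ** U) $ x $ a"
      by (simp add: mult_nth)
    also have "\<dots> = 0" using x insert.prems(1) by (auto simp: unitary_def mat_nth)
    finally show ?thesis
      by (simp add: col if_distrib[of cnj] if_mult_sum v_def mult_axis_nth cong: if_cong)
  qed
  then obtain W r where W: "W \<in> gate_closure" "\<And>x. x \<notin> insert a A \<Longrightarrow> W *v axis x 1 = axis x 1"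
    "W *v v = r *s axis a 1"
    using reduce_to_axis[of A a v] insert.hyps by blast
  define P where "P = phase_on UNIV a (- Arg r)"
  have P: "P \<in> gate_closure" unfolding P_def by (rule gate_closure_phase_on) simp
  have uW: "unitary W" "unitary P"
    using W(1) P phase_closure_unitary unitary_gates by blast+
  have WU: "(W ** U) *v axis a 1 = r *s axis a 1"
    using W(3) by (simp add: v_def matrix_vector_mul_assoc)
  have "cmod r = 1"
  proof -
    have col: "(W ** U) $ i $ a = (if i = a then r else 0)" for i
      using WU by (simp add: vec_eq_iff mult_axis_nth) (simp add: axis_def)
    have "(\<Sum>i\<in>UNIV. cnj ((W ** U) $ i $ a) * (W ** U) $ i $ a) = (adj (W ** U) ** (W ** U)) $ a $ a"
      by (simp add: mult_nth[of "adj (W ** U)"])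
    also have "\<dots> = 1" using unitary_mult[OF uW(1) insert.prems(1)] by (simp add: unitary_def mat_nth)
    finally have "cnj r * r = 1"
      by (simp add: col if_distrib[of cnj] if_mult_sum cong: if_cong)
    then have "complex_of_real ((cmod r)\<^sup>2) = 1"
      unfolding complex_norm_square by (simp add: mult.commute)
    then have "(cmod r)\<^sup>2 = 1" by (simp only: of_real_eq_1_iff)
    then show ?thesis using norm_ge_zero[of r] by (auto simp: power2_eq_1_iff)
  qed
  have "(P ** (W ** U)) *v axis x 1 = axis x 1" if "x \<notin> A" for x
  proof (cases "x = a")
    case True
    have "(P ** (W ** U)) *v axis a 1 = P *v (r *s axis a 1)"
      unfolding matrix_vector_mul_assoc[of P "W ** U", symmetric] WU ..
    also have "\<dots> = axis a 1"
      unfolding P_def vec_eq_iff phase_on_UNIV_apply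
      by (simp add: axis_def cis_Arg_mult \<open>cmod r = 1\<close>)
    finally show ?thesis using True by simp
  next
    case False
    then have "P *v axis x 1 = axis x 1"
      unfolding P_def vec_eq_iff phase_on_UNIV_apply by (simp add: axis_def)
    then show ?thesis
      using that False insert.prems(2)[of x] by (simp add: W(2) flip: matrix_vector_mul_assoc)
  qed
  then have "P ** (W ** U) \<in> gate_closure"
    using uW insert.prems(1) by (intro insert.IH unitary_mult) auto
  then have "adj W ** (adj P ** (P ** (W ** U))) \<in> gate_closure"
    using phase_closure_mult phase_closure_adj W(1) P by blast
  then show ?case by (simp add: unitary_cancel uW)
qed

theorem universality: "dense_up_to_phase (generated_group (K_T_S_CZ_CCZ_gates :: ('n::finite \<Rightarrow> bool) op set))"
proof -
  have "U \<in> gate_closure" if "unitary U" for U :: "('n \<Rightarrow> bool) op"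
    using gate_closure_unitary_fixing[of UNIV U] that by simp
  then show ?thesis
    unfolding dense_up_to_phase_def phase_closure_def using generated_group_unitary unitary_gates by auto
qed

section \<open>Channels in Kraus form\<close>

lemma mult3_nth: "(X ** M ** Y) $ x $ y = (\<Sum>a\<in>UNIV. \<Sum>b\<in>UNIV. X $ x $ a * M $ a $ b * Y $ b $ y)"
  unfolding mult_nth sum_distrib_right by (rule sum.swap)

lemma braket_add_right: "braket v (w + w') = braket v w + braket v w'"
  by (simp add: braket_def algebra_simps sum.distrib)

lemma braket_add_left: "braket (v + v') w = braket v w + braket v' w"
  by (simp add: braket_def algebra_simps sum.distrib)

lemma braket_scale_right: "braket v (c *s w) = c * braket v w"
  by (simp add: braket_def sum_distrib_left mult.left_commute)

lemma braket_scale_left: "braket (c *s v) w = cnj c * braket v w"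
  by (simp add: braket_def sum_distrib_left mult.assoc)

lemma braket_sum_right: "braket v (\<Sum>k\<in>S. f k) = (\<Sum>k\<in>S. braket v (f k))"
  by (simp add: braket_def sum_distrib_left sum.swap[of _ S])

lemma braket_commute: "braket v w = cnj (braket w v)"
  by (simp add: braket_def mult.commute)

lemma braket_mult_right: "braket v (A *v w) = braket (adj A *v v) w"
proof -
  have "braket v (A *v w) = (\<Sum>i\<in>UNIV. \<Sum>j\<in>UNIV. cnj (v $ i) * A $ i $ j * w $ j)"
    by (simp add: braket_def mult_vec_nth sum_distrib_left mult.assoc)
  also have "\<dots> = (\<Sum>j\<in>UNIV. \<Sum>i\<in>UNIV. cnj (v $ i) * A $ i $ j * w $ j)"
    by (rule sum.swap)
  also have "\<dots> = braket (adj A *v v) w"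
    by (simp add: braket_def mult_vec_nth sum_distrib_left sum_distrib_right mult_ac)
  finally show ?thesis .
qed

lemma sum_matrix_vector: "(\<Sum>k\<in>S. f k) *v w = (\<Sum>k\<in>S. f k *v (w :: complex ^ 'n::finite))"
  by (simp add: vec_eq_iff mult_vec_nth sum_distrib_right sum.swap[of _ S])

lemma sum_nonneg_Reals: "(\<And>k. k \<in> S \<Longrightarrow> f k \<in> \<real>\<^sub>\<ge>\<^sub>0) \<Longrightarrow> (\<Sum>k\<in>S. f k) \<in> (\<real>\<^sub>\<ge>\<^sub>0 :: complex set)"
  by (induction S rule: infinite_finite_induct) (auto intro: nonneg_Reals_add_I)

lemma matrix_add_rdistrib: "(A + B) ** C = A ** C + B ** (C :: complex ^ 'n::finite ^ 'm::finite)"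
  by (rule matrix_ext) (simp add: mult_nth distrib_right sum.distrib)

lemma prod_indicator_on:
  "finite S \<Longrightarrow> (\<Prod>i\<in>S. if P i then 1 else 0 :: complex) = (if \<forall>i\<in>S. P i then 1 else 0)"
  by (induction S rule: finite_induct) auto

definition kraus :: "('k::finite \<Rightarrow> 'b::finite op) \<Rightarrow> 'b op \<Rightarrow> 'b op" where
  "kraus Kr M = (\<Sum>k\<in>UNIV. Kr k ** M ** adj (Kr k))"

lemma trace_two_sided:
  "trace (\<Sum>l\<in>S. A l ** M ** B l) = trace ((\<Sum>l\<in>S. B l ** A l) ** (M :: 'b::finite op))"
proof -
  have "trace (A l ** M ** B l) = trace (B l ** A l ** M)" for l
    using trace_mult_commute[of "A l ** M" "B l"] by (simp only: matrix_mul_assoc)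
  then show ?thesis by (simp add: trace_sum matrix_sum_left)
qed

lemma quantum_channel_kraus:
  assumes "(\<Sum>k\<in>UNIV. adj (Kr k) ** Kr k) = mat 1"
  shows "quantum_channel (kraus Kr)"
  unfolding quantum_channel_def
proof (intro conjI allI)
  fix A B :: "'a op" and c
  show "kraus Kr (A + B) = kraus Kr A + kraus Kr B"
    by (simp add: kraus_def matrix_add_ldistrib matrix_add_rdistrib sum.distrib)
  show "kraus Kr (mat c ** A) = mat c ** kraus Kr A"
    unfolding kraus_def matrix_sum_right by (intro sum.cong refl) (simp add: mult_mat_left matrix_mul_assoc[symmetric])
  show "trace (kraus Kr A) = trace A"
    unfolding kraus_def trace_two_sided assms by simp
  show "completely_positive (kraus Kr)"
    unfolding completely_positive_def block_positive_def
  proof (intro allI impI)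
    fix n and A :: "nat \<Rightarrow> nat \<Rightarrow> 'a op" and v :: "nat \<Rightarrow> 'a state"
    assume pos: "\<forall>v. (\<Sum>i<n. \<Sum>j<n. braket (v i) (A i j *v v j)) \<in> \<real>\<^sub>\<ge>\<^sub>0"
    \<comment> \<open>Each Kraus operator moves into the test vectors, where positivity of the input
      blocks applies.\<close>
    have "(\<Sum>i<n. \<Sum>j<n. braket (v i) (kraus Kr (A i j) *v v j)) =
        (\<Sum>i<n. \<Sum>j<n. \<Sum>k\<in>UNIV. braket (adj (Kr k) *v v i) (A i j *v (adj (Kr k) *v v j)))"
      by (simp add: kraus_def sum_matrix_vector braket_sum_right braket_mult_right[of _ "Kr _"]
          flip: matrix_vector_mul_assoc)
    also have "\<dots> = (\<Sum>i<n. \<Sum>k\<in>UNIV. \<Sum>j<n. braket (adj (Kr k) *v v i) (A i j *v (adj (Kr k) *v v j)))"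
      by (intro sum.cong refl sum.swap)
    also have "\<dots> = (\<Sum>k\<in>UNIV. \<Sum>i<n. \<Sum>j<n. braket (adj (Kr k) *v v i) (A i j *v (adj (Kr k) *v v j)))"
      by (rule sum.swap)
    also have "\<dots> \<in> \<real>\<^sub>\<ge>\<^sub>0"
      by (rule sum_nonneg_Reals) (rule pos[rule_format])
    finally show "(\<Sum>i<n. \<Sum>j<n. braket (v i) (kraus Kr (A i j) *v v j)) \<in> \<real>\<^sub>\<ge>\<^sub>0" .
  qed
qed

text \<open>Distributivity over the sites: \<open>\<kappa>\<close> picks one term of the sum at
  every site. For the recovery this is one measurement outcome per block.\<close>

lemma channel_tensor_two_sided:
  fixes A B :: "'i::finite \<Rightarrow> 'l::finite \<Rightarrow> 'a::finite op"
  assumes "\<And>i M. \<Phi> i M = (\<Sum>l\<in>UNIV. A i l ** M ** B i l)"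
  shows "channel_tensor \<Phi> M = (\<Sum>\<kappa>\<in>UNIV. tensor (\<lambda>i. A i (\<kappa> i)) ** M ** tensor (\<lambda>i. B i (\<kappa> i)))"
proof (rule matrix_ext)
  fix x y
  have "channel_tensor \<Phi> M $ x $ y =
      (\<Sum>a\<in>UNIV. \<Sum>b\<in>UNIV. \<Sum>\<kappa>\<in>UNIV.
        tensor (\<lambda>i. A i (\<kappa> i)) $ x $ a * M $ a $ b * tensor (\<lambda>i. B i (\<kappa> i)) $ b $ y)"
    by (simp add: channel_tensor_def assms mult_matrix_unit_mult prod_sum_UNIV tensor_nth
        sum_distrib_left prod.distrib mult.assoc mult.left_commute)
  also have "\<dots> = (\<Sum>a\<in>UNIV. \<Sum>\<kappa>\<in>UNIV. \<Sum>b\<in>UNIV.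
        tensor (\<lambda>i. A i (\<kappa> i)) $ x $ a * M $ a $ b * tensor (\<lambda>i. B i (\<kappa> i)) $ b $ y)"
    by (intro sum.cong refl sum.swap)
  also have "\<dots> = (\<Sum>\<kappa>\<in>UNIV. \<Sum>a\<in>UNIV. \<Sum>b\<in>UNIV.
        tensor (\<lambda>i. A i (\<kappa> i)) $ x $ a * M $ a $ b * tensor (\<lambda>i. B i (\<kappa> i)) $ b $ y)"
    by (rule sum.swap)
  also have "\<dots> = (\<Sum>\<kappa>\<in>UNIV. tensor (\<lambda>i. A i (\<kappa> i)) ** M ** tensor (\<lambda>i. B i (\<kappa> i))) $ x $ y"
    by (simp add: mult3_nth)
  finally show "channel_tensor \<Phi> M $ x $ y = \<dots>" .
qed

lemma local_op_nth_mult: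
  "local_op q E $ x $ y = (if \<forall>i. i \<noteq> q \<longrightarrow> x i = y i then 1 else 0) * E $ x q $ y q"
  by (auto simp: local_op_nth)

text \<open>Proved directly, so that a single index runs over the terms at \<open>j\<close> instead
  of a function over all sites. The right factors are unrelated to the left ones, since an error is
  not taken in Kraus form.\<close>

lemma channel_at_two_sided:
  fixes A B :: "'l::finite \<Rightarrow> 'a::finite op"
  assumes "\<And>M. \<Phi> M = (\<Sum>l\<in>UNIV. A l ** M ** B l)"
  shows "channel_at j \<Phi> M = (\<Sum>l\<in>UNIV. local_op j (A l) ** M ** local_op j (B l))"
proof (rule matrix_ext)
  fix x y
  have "(\<Prod>i\<in>UNIV. (if i = j then \<Phi> else id) (matrix_unit (a i) (b i)) $ x i $ y i) =
      (\<Sum>l\<in>UNIV. local_op j (A l) $ x $ a * local_op j (B l) $ b $ y)" for a b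
  proof -
    have "(\<Prod>i\<in>UNIV. (if i = j then \<Phi> else id) (matrix_unit (a i) (b i)) $ x i $ y i) =
        \<Phi> (matrix_unit (a j) (b j)) $ x j $ y j * (\<Prod>i\<in>UNIV-{j}. if x i = a i \<and> y i = b i then 1 else 0)"
      by (subst prod.remove[of _ j]) (auto simp: matrix_unit_nth intro!: prod.cong)
    also have "(\<Prod>i\<in>UNIV-{j}. if x i = a i \<and> y i = b i then 1 else 0 :: complex) =
        (if \<forall>i. i \<noteq> j \<longrightarrow> x i = a i then 1 else 0) * (if \<forall>i. i \<noteq> j \<longrightarrow> b i = y i then 1 else 0)"
      by (subst prod_indicator_on) auto
    also have "\<Phi> (matrix_unit (a j) (b j)) $ x j $ y j = (\<Sum>l\<in>UNIV. A l $ x j $ a j * B l $ b j $ y j)"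
      by (simp add: assms mult_matrix_unit_mult)
    also have "\<dots> * ((if \<forall>i. i \<noteq> j \<longrightarrow> x i = a i then 1 else 0) * (if \<forall>i. i \<noteq> j \<longrightarrow> b i = y i then 1 else 0)) =
        (\<Sum>l\<in>UNIV. local_op j (A l) $ x $ a * local_op j (B l) $ b $ y)"
      unfolding local_op_nth_mult sum_distrib_right
      by (intro sum.cong refl) (simp only: mult_ac)
    finally show ?thesis .
  qed
  then have "channel_at j \<Phi> M $ x $ y = (\<Sum>a\<in>UNIV. \<Sum>b\<in>UNIV. \<Sum>l\<in>UNIV.
      local_op j (A l) $ x $ a * M $ a $ b * local_op j (B l) $ b $ y)"
    by (simp add: channel_at_def channel_tensor_def sum_distrib_left mult.assoc mult.left_commute)
  also have "\<dots> = (\<Sum>a\<in>UNIV. \<Sum>l\<in>UNIV. \<Sum>b\<in>UNIV.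
      local_op j (A l) $ x $ a * M $ a $ b * local_op j (B l) $ b $ y)"
    by (intro sum.cong refl sum.swap)
  also have "\<dots> = (\<Sum>l\<in>UNIV. \<Sum>a\<in>UNIV. \<Sum>b\<in>UNIV.
      local_op j (A l) $ x $ a * M $ a $ b * local_op j (B l) $ b $ y)"
    by (rule sum.swap)
  also have "\<dots> = (\<Sum>l\<in>UNIV. local_op j (A l) ** M ** local_op j (B l)) $ x $ y"
    by (simp add: mult3_nth)
  finally show "channel_at j \<Phi> M $ x $ y = \<dots>" .
qed

lemma quantum_channel_sum:
  assumes "quantum_channel E"
  shows "E (\<Sum>i\<in>S. f i) = (\<Sum>i\<in>S. E (f i))"
proof -
  have add: "E (A + B) = E A + E B" for A B
    using assms by (simp add: quantum_channel_def)
  have "E 0 = 0" using add[of 0 0] by simp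
  then show ?thesis
    by (induction S rule: infinite_finite_induct) (simp_all add: add)
qed

text \<open>By linearity \<open>E\<close> is determined on matrix units: the term (a, b, c, d) takes
  the entry of \<open>M\<close> at \<open>a\<close>, \<open>b\<close> to the position
  \<open>c\<close>, \<open>d\<close> with the weight found there in the image of
  \<open>matrix_unit a b\<close>. Preservation of the trace then identifies the sum of the
  \<open>B l ** A l\<close>.\<close>

lemma quantum_channel_two_sided:
  fixes E :: "'a::finite op \<Rightarrow> 'a op"
  assumes "quantum_channel E"
  shows "\<exists>A B :: 'a \<times> 'a \<times> 'a \<times> 'a \<Rightarrow> 'a op.
    (\<forall>M. E M = (\<Sum>l\<in>UNIV. A l ** M ** B l)) \<and> (\<Sum>l\<in>UNIV. B l ** A l) = mat 1"
proof -
  define A :: "'a \<times> 'a \<times> 'a \<times> 'a \<Rightarrow> 'a op" where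
    "A = (\<lambda>(a, b, c, d). mat (E (matrix_unit a b) $ c $ d) ** matrix_unit c a)"
  define B :: "'a \<times> 'a \<times> 'a \<times> 'a \<Rightarrow> 'a op" where
    "B = (\<lambda>(a, b, c, d). matrix_unit b d)"
  have mu: "mat (M $ a $ b) ** matrix_unit c d = matrix_unit c a ** M ** matrix_unit b d" for M a b c d
  proof (rule matrix_ext)
    fix i j
    have "(matrix_unit c a ** M ** matrix_unit b d) $ i $ j = (if j = d then (matrix_unit c a ** M) $ i $ b else 0)"
      by (rule mult_matrix_unit)
    also have "(matrix_unit c a ** M) $ i $ b = (if i = c then M $ a $ b else 0)"
      by (cases "i = c") (simp_all add: mult_nth matrix_unit_nth if_mult_sum(2)[of a "\<lambda>_. 1", simplified])
    finally show "(mat (M $ a $ b) ** matrix_unit c d) $ i $ j = (matrix_unit c a ** M ** matrix_unit b d) $ i $ j"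
      by (simp add: matrix_unit_nth)
  qed
  have AMB: "A (a, b, c, d) ** M ** B (a, b, c, d) =
      mat (M $ a $ b) ** (mat (E (matrix_unit a b) $ c $ d) ** matrix_unit c d)" for a b c d M
  proof -
    have "A (a, b, c, d) ** M ** B (a, b, c, d) =
        mat (E (matrix_unit a b) $ c $ d) ** (matrix_unit c a ** M ** matrix_unit b d)"
      by (simp add: A_def B_def matrix_mul_assoc)
    then show ?thesis unfolding mu[symmetric] by (simp add: mult.commute)
  qed
  have E: "E M = (\<Sum>l\<in>UNIV. A l ** M ** B l)" for M
  proof -
    have "E M = E (\<Sum>a\<in>UNIV. \<Sum>b\<in>UNIV. mat (M $ a $ b) ** matrix_unit a b)"
      using matrix_unit_sum[of M] by simp
    also have "\<dots> = (\<Sum>a\<in>UNIV. \<Sum>b\<in>UNIV. mat (M $ a $ b) ** E (matrix_unit a b))"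
      using assms unfolding quantum_channel_sum[OF assms] by (simp add: quantum_channel_def)
    also have "\<dots> = (\<Sum>a\<in>UNIV. \<Sum>b\<in>UNIV. mat (M $ a $ b) **
        (\<Sum>c\<in>UNIV. \<Sum>d\<in>UNIV. mat (E (matrix_unit a b) $ c $ d) ** matrix_unit c d))"
      by (simp only: matrix_unit_sum[symmetric])
    also have "\<dots> = (\<Sum>a\<in>UNIV. \<Sum>b\<in>UNIV. \<Sum>c\<in>UNIV. \<Sum>d\<in>UNIV. A (a, b, c, d) ** M ** B (a, b, c, d))"
      unfolding matrix_sum_right
      by (simp only: AMB)
    also have "\<dots> = (\<Sum>l\<in>UNIV. A l ** M ** B l)"
      by (simp add: sum.cartesian_product split_def flip: UNIV_Times_UNIV)
    finally show ?thesis .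
  qed
  have "trace ((\<Sum>l\<in>UNIV. B l ** A l) ** M) = trace M" for M
    unfolding trace_two_sided[symmetric] E[symmetric] using assms by (simp add: quantum_channel_def)
  then have "(\<Sum>l\<in>UNIV. B l ** A l) = mat 1" by (rule eq_mat_1_if_trace)
  with E show ?thesis by blast
qed

section \<open>Circuits\<close>

primrec circuit_op :: "'b::finite op list \<Rightarrow> 'b op" where
  "circuit_op [] = mat 1"
| "circuit_op (W # Ws) = circuit_op Ws ** W"

lemma circuit_op_append: "circuit_op (Ws @ Vs) = circuit_op Vs ** circuit_op Ws"
  by (induction Ws) (simp_all add: matrix_mul_assoc)

lemma run_vector_eq: "run_vector Ws v = circuit_op Ws *v v"
  by (induction Ws arbitrary: v) (simp_all add: run_vector_def matrix_vector_mul_assoc)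

lemma run_eq: "run Ws \<rho> = circuit_op Ws ** \<rho> ** adj (circuit_op Ws)"
  by (induction Ws arbitrary: \<rho>) (simp_all add: run_def adj_mult matrix_mul_assoc)

lemma unitary_circuit_op: "(\<And>W. W \<in> set Ws \<Longrightarrow> unitary W) \<Longrightarrow> unitary (circuit_op Ws)"
  by (induction Ws) (auto intro: unitary_mult unitary_mat_1)

lemma pure_mult: "pure (A *v v) = A ** pure v ** adj A"
  by (rule matrix_ext)
     (simp add: pure_def mult3_nth mult_vec_nth sum_product mult_ac)

lemma trace_pure: "norm v = 1 \<Longrightarrow> trace (pure v) = 1"
proof -
  assume v: "norm v = 1"
  have "trace (pure v) = of_real (\<Sum>i\<in>UNIV. (cmod (v $ i))\<^sup>2)"
    by (simp add: trace_def pure_def complex_norm_square[symmetric])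
  also have "(\<Sum>i\<in>UNIV. (cmod (v $ i))\<^sup>2) = (norm v)\<^sup>2"
    by (simp add: norm_vec_def L2_set_def sum_nonneg)
  finally show ?thesis using v by simp
qed

lemma trace_isometry: "adj V ** V = mat 1 \<Longrightarrow> trace (V ** M ** adj V) = trace M"
  using trace_mult_commute[of V "M ** adj V"] by (simp flip: matrix_mul_assoc)

section \<open>Criteria for error correction and fault tolerance\<close>

text \<open>
  If every Kraus operator maps the damaged code states back to multiples of the code states, with
  a factor that depends only on the error, then the error is undone up to a total factor, which
  is 1 because all maps preserve the trace.
\<close>

lemma recovery_eq_pure:
  fixes K :: "'k::finite \<Rightarrow> 'b::finite op" and A B :: "'l::finite \<Rightarrow> 'b op" and V :: "complex ^ 'c::finite ^ 'b"
  assumes K: "(\<Sum>k\<in>UNIV. adj (K k) ** K k) = mat 1" and AB: "(\<Sum>l\<in>UNIV. B l ** A l) = mat 1"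
    and D: "unitary D" and T: "unitary T" and V: "adj V ** V = mat 1" and V': "adj V' ** V' = mat 1"
    and eA: "\<And>k l. \<exists>e. K k ** D ** A l ** T ** V = mat e ** V'"
    and eB: "\<And>k l. \<exists>e. K k ** D ** adj (B l) ** T ** V = mat e ** V'"
    and \<sigma>: "trace \<sigma> = 1"
  shows "(\<Sum>k\<in>UNIV. K k ** (D ** (\<Sum>l\<in>UNIV. A l ** (T ** (V ** \<sigma> ** adj V) ** adj T) ** B l) ** adj D) ** adj (K k)) =
    V' ** \<sigma> ** adj V'" (is "?L = ?R")
proof -
  obtain e where e: "\<And>k l. K k ** D ** A l ** T ** V = mat (e k l) ** V'" using eA by metis
  \<comment> \<open>\<open>B l\<close> stands to the right of the state, so it is handled through
    its adjoint, which acts on encoded vectors from the left.\<close>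
  obtain f where f: "\<And>k l. K k ** D ** adj (B l) ** T ** V = mat (f k l) ** V'" using eB by metis
  have t: "K k ** (D ** (A l ** (T ** (V ** \<sigma> ** adj V) ** adj T) ** B l) ** adj D) ** adj (K k) =
      mat (e k l * cnj (f k l)) ** ?R" for k l
  proof -
    have "K k ** (D ** (A l ** (T ** (V ** \<sigma> ** adj V) ** adj T) ** B l) ** adj D) ** adj (K k) =
        (K k ** D ** A l ** T ** V) ** \<sigma> ** adj (K k ** D ** adj (B l) ** T ** V)"
      by (simp add: adj_mult matrix_mul_assoc)
    also have "\<dots> = mat (e k l) ** (V' ** \<sigma> ** adj V') ** mat (cnj (f k l))"
      unfolding e f by (simp add: adj_mult matrix_mul_assoc)
    also have "\<dots> = mat (e k l * cnj (f k l)) ** ?R"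
      by (simp add: mat_commute mult.commute)
    finally show ?thesis .
  qed
  define C where "C = (\<Sum>k\<in>UNIV. \<Sum>l\<in>UNIV. e k l * cnj (f k l))"
  have L: "?L = mat C ** ?R"
    unfolding C_def mat_sum matrix_sum_left matrix_sum_right t ..
  have "trace ?L = trace (D ** (\<Sum>l\<in>UNIV. A l ** (T ** (V ** \<sigma> ** adj V) ** adj T) ** B l) ** adj D)"
    unfolding trace_two_sided K by simp
  also have "\<dots> = trace (\<Sum>l\<in>UNIV. A l ** (T ** (V ** \<sigma> ** adj V) ** adj T) ** B l)"
    by (rule trace_isometry) (rule unitaryD[OF D])
  also have "\<dots> = trace (T ** (V ** \<sigma> ** adj V) ** adj T)"
    unfolding trace_two_sided AB by simp
  also have "\<dots> = trace (V ** \<sigma> ** adj V)"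
    by (rule trace_isometry) (rule unitaryD[OF T])
  also have "\<dots> = 1" using trace_isometry[OF V] \<sigma> by simp
  finally have "C * trace ?R = 1" unfolding L trace_smult .
  then have "C = 1" using trace_isometry[OF V'] \<sigma> by simp
  with L show ?thesis by simp
qed

lemma local_op_two_sided_1:
  "(\<Sum>l\<in>UNIV. B l ** A l) = mat 1 \<Longrightarrow> (\<Sum>l\<in>UNIV. local_op j (B l) ** local_op j (A l)) = mat 1"
  unfolding local_op_mult local_op_sum[symmetric] by simp

text \<open>Fault tolerance becomes a statement about operators: \<open>P\<close> is any matrix on
  the damaged qubit, because it stands for the left factors of the error and for the adjoints of the
  right factors, and \<open>\<kappa>\<close> chooses one Kraus operator of the recovery for every
  block.\<close>

lemma fault_tolerantI:
  fixes Kr :: "'k::finite \<Rightarrow> (qubit47 \<Rightarrow> bool) op" and G :: "('r::finite \<Rightarrow> bool) op"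
  defines "ENC \<equiv> tensor (\<lambda>_ :: 'r. enc47)"
  assumes K: "(\<Sum>k\<in>UNIV. adj (Kr k) ** Kr k) = mat 1" and V: "adj enc47 ** enc47 = mat 1"
    and G: "unitary G"
    and Ws: "\<And>W. W \<in> set Ws \<Longrightarrow> unitary W \<and> (\<exists>A. card A \<le> 3 \<and> acts_on A W)"
    and c: "cmod c = 1" "circuit_op Ws ** ENC = mat c ** (ENC ** G)"
    and err: "\<And>k j p P \<kappa>. \<exists>e. tensor (\<lambda>j. Kr (\<kappa> j)) ** circuit_op (drop k Ws) **
        local_op j (local_op p P) ** circuit_op (take k Ws) ** ENC = mat e ** (ENC ** G)"
  shows "fault_tolerant (kraus Kr) G"
proof -
  have ENC: "adj ENC ** ENC = mat 1"
    by (simp add: ENC_def adj_tensor tensor_mult V tensor_mat_1)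
  have ENCG: "adj (ENC ** G) ** (ENC ** G) = mat 1"
  proof -
    have "adj (ENC ** G) ** (ENC ** G) = adj G ** (adj ENC ** ENC) ** G"
      by (simp add: adj_mult matrix_mul_assoc)
    then show ?thesis using ENC unitaryD(1)[OF G] by simp
  qed
  have ct: "channel_tensor (\<lambda>_ :: 'r. kraus Kr) M =
      (\<Sum>\<kappa>\<in>UNIV. tensor (\<lambda>j. Kr (\<kappa> j)) ** M ** adj (tensor (\<lambda>j. Kr (\<kappa> j))))" for M
    unfolding adj_tensor by (rule channel_tensor_two_sided) (simp add: kraus_def)
  have K': "(\<Sum>\<kappa>\<in>UNIV. adj (tensor (\<lambda>j :: 'r. Kr (\<kappa> j))) ** tensor (\<lambda>j. Kr (\<kappa> j))) = mat 1"
    unfolding adj_tensor tensor_mult tensor_sum[symmetric, of "\<lambda>_ k. adj (Kr k) ** Kr k"] K tensor_mat_1 ..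
  have "channel_tensor (\<lambda>_. kraus Kr)
      (run (drop k Ws) (channel_at j (channel_at p E) (run (take k Ws) (pure (encode \<psi>))))) =
      pure (encode (G *v \<psi>))" if "quantum_channel E" "norm \<psi> = 1" for k j p E \<psi>
  proof -
    obtain A B :: "bool \<times> bool \<times> bool \<times> bool \<Rightarrow> bool op" where E: "\<And>M. E M = (\<Sum>l\<in>UNIV. A l ** M ** B l)" "(\<Sum>l\<in>UNIV. B l ** A l) = mat 1"
      using quantum_channel_two_sided[OF \<open>quantum_channel E\<close>] by blast
    have ch: "channel_at j (channel_at p E) M =
        (\<Sum>l\<in>UNIV. local_op j (local_op p (A l)) ** M ** local_op j (local_op p (B l)))" for M
      by (intro channel_at_two_sided E)
    have u: "unitary (circuit_op (take k Ws))" "unitary (circuit_op (drop k Ws))"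
      using Ws by (auto intro!: unitary_circuit_op dest: in_set_takeD in_set_dropD)
    have "trace (pure \<psi>) = 1" using that by (simp add: trace_pure)
    then show ?thesis
      unfolding ct run_eq ch encode_def pure_mult ENC_def[symmetric] matrix_vector_mul_assoc
      by (intro recovery_eq_pure[OF K' local_op_two_sided_1[OF local_op_two_sided_1[OF E(2)]] u(2,1) ENC ENCG])
         (simp_all add: adj_local_op err)
  qed
  moreover have "run_vector Ws (encode \<psi>) = c *s encode (G *v \<psi>)" for \<psi>
    unfolding run_vector_eq encode_def ENC_def[symmetric] matrix_vector_mul_assoc c(2)
    by (simp flip: matrix_vector_mul_assoc)
  ultimately show ?thesis
    unfolding fault_tolerant_def using Ws c(1) by blast
qed

lemma braket_axis: "braket (axis i 1) (M *v axis j 1) = M $ i $ j"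
  by (simp add: braket_def mult_vec_nth axis_def if_distrib[of cnj] if_mult_sum cong: if_cong)

text \<open>Polarization: the vectors e_i + e_j and e_i + i e_j test the imaginary and the real part
  of the difference between the entries.\<close>

lemma hermitian_if_real:
  assumes "\<And>v. braket v (M *v v) \<in> \<real>"
  shows "adj M = M"
proof (rule matrix_ext)
  fix i j
  have r: "Im (braket v (M *v v)) = 0" for v
    using assms[of v] by (simp add: complex_is_Real_iff)
  have "braket (axis i 1 + c *s axis j 1) (M *v (axis i 1 + c *s axis j 1)) =
      M $ i $ i + c * M $ i $ j + (cnj c * M $ j $ i + cnj c * (c * M $ j $ j))" for c
    by (simp add: matrix_vector_right_distrib vector_scalar_commute braket_add_left braket_add_right
        braket_scale_left braket_scale_right braket_axis distrib_left)
  from r[of "axis i 1 + 1 *s axis j 1"] r[of "axis i 1 + \<i> *s axis j 1"]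
    r[of "axis i 1"] r[of "axis j 1"] this[of 1] this[of \<i>]
  show "adj M $ i $ j = M $ i $ j"
    by (simp add: braket_axis complex_eq_iff)
qed

text \<open>A density operator with range in the code space is Hermitian, hence supported there on
  both sides. It is therefore the encoding of the logical operator \<sigma>, to which
  \<open>recovery_eq_pure\<close> applies.\<close>

lemma correctsI:
  fixes Kr :: "'k::finite \<Rightarrow> (qubit47 \<Rightarrow> bool) op"
  assumes K: "(\<Sum>k\<in>UNIV. adj (Kr k) ** Kr k) = mat 1" and V: "adj enc47 ** enc47 = mat 1"
    and err: "\<And>k P. \<exists>e. Kr k ** local_op p P ** enc47 = mat e ** enc47"
    and E: "quantum_channel E"
  shows "corrects (kraus Kr) (channel_at p E)"
  unfolding corrects_def
proof (intro allI impI)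
  fix \<rho> :: "(qubit47 \<Rightarrow> bool) op"
  assume \<rho>: "density_operator \<rho> \<and> range ((*v) \<rho>) \<subseteq> code_space47"
  let ?\<Pi> = "enc47 ** adj enc47"
  have "adj \<rho> = \<rho>"
    using \<rho> nonneg_Reals_subset_Reals by (intro hermitian_if_real) (auto simp: density_operator_def)
  have "?\<Pi> ** \<rho> = \<rho>"
    unfolding matrix_eq
  proof
    fix v
    obtain \<phi> where "\<rho> *v v = enc47 *v \<phi>" using \<rho> by (auto simp: code_space47_def)
    then show "(?\<Pi> ** \<rho>) *v v = \<rho> *v v"
      by (metis V matrix_mul_assoc matrix_mul_rid matrix_vector_mul_assoc)
  qed
  then have "\<rho> ** ?\<Pi> = \<rho>"
    using \<open>adj \<rho> = \<rho>\<close> by (metis adj_adj adj_mult)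
  define \<sigma> where "\<sigma> = adj enc47 ** \<rho> ** enc47"
  have eq: "\<rho> = enc47 ** \<sigma> ** adj enc47"
    unfolding \<sigma>_def using \<open>?\<Pi> ** \<rho> = \<rho>\<close> \<open>\<rho> ** ?\<Pi> = \<rho>\<close> by (metis matrix_mul_assoc)
  have "trace \<sigma> = 1"
    using \<rho> trace_isometry[OF V, of \<sigma>] by (simp add: density_operator_def flip: eq)
  obtain A B :: "bool \<times> bool \<times> bool \<times> bool \<Rightarrow> bool op" where AB: "\<And>M. E M = (\<Sum>l\<in>UNIV. A l ** M ** B l)" "(\<Sum>l\<in>UNIV. B l ** A l) = mat 1"
    using quantum_channel_two_sided[OF E] by blast
  have ch: "channel_at p E M = (\<Sum>l\<in>UNIV. local_op p (A l) ** M ** local_op p (B l))" for M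
    by (intro channel_at_two_sided AB)
  have "kraus Kr (channel_at p E (enc47 ** \<sigma> ** adj enc47)) = enc47 ** \<sigma> ** adj enc47"
    using recovery_eq_pure[OF K local_op_two_sided_1[OF AB(2)] unitary_mat_1 unitary_mat_1 V V _ _ \<open>trace \<sigma> = 1\<close>, of p] err
    unfolding kraus_def ch by (simp add: adj_local_op)
  then show "kraus Kr (channel_at p E \<rho>) = \<rho>" using eq by simp
qed

section \<open>Stabilizer codes of distance three\<close>

subsection \<open>Pauli operators\<close>

text \<open>The operator \<open>X\<^sup>a Z\<^sup>b\<close>; every Pauli operator is a multiple of such a product.\<close>

definition pauli_xz :: "bool \<Rightarrow> bool \<Rightarrow> bool op" where
  "pauli_xz a b = (\<chi> x y. if x = (y \<noteq> a) then (if b \<and> y then - 1 else 1) else 0)"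

definition pauli_string :: "('q::finite \<Rightarrow> bool) \<Rightarrow> ('q \<Rightarrow> bool) \<Rightarrow> ('q \<Rightarrow> bool) op" where
  "pauli_string a b = tensor (\<lambda>q. pauli_xz (a q) (b q))"

text \<open>This is -1 to the power of the inner product of \<open>a\<close> and \<open>b\<close>
  over F_2.\<close>

definition parity_sign :: "('q::finite \<Rightarrow> bool) \<Rightarrow> ('q \<Rightarrow> bool) \<Rightarrow> complex" where
  "parity_sign a b = (\<Prod>q\<in>UNIV. if a q \<and> b q then - 1 else 1)"

lemma pauli_xz_simps:
  "pauli_xz False False = mat 1" "pauli_xz True False = pauli_X" "pauli_xz False True = pauli_Z"
  by (simp_all add: bool_op_eq_iff pauli_xz_def mat_nth pauli_X_def pauli_Z_def)

lemma pauli_xz_mult: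
  "pauli_xz a b ** pauli_xz a' b' = mat (if b \<and> a' then - 1 else 1) ** pauli_xz (a \<noteq> a') (b \<noteq> b')"
  by (cases a; cases b; cases a'; cases b') (simp_all add: bool_op_eq_iff bool_mult_nth pauli_xz_def mat_nth)

lemma adj_pauli_xz: "adj (pauli_xz a b) = mat (if a \<and> b then - 1 else 1) ** pauli_xz a b"
  by (cases a; cases b) (simp_all add: bool_op_eq_iff pauli_xz_def)

text \<open>Half sums and half differences of the diagonal entries give the coefficients of 1 and Z;
  the other two entries give those of X and XZ.\<close>

lemma pauli_xz_decomposition:
  "\<exists>c. E = (\<Sum>a\<in>UNIV. \<Sum>b\<in>UNIV. mat (c a b) ** pauli_xz a b)"
proof -
  define c where "c = (\<lambda>a b. if a then (E $ True $ False + (if b then - 1 else 1) * E $ False $ True) / 2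
    else (E $ False $ False + (if b then - 1 else 1) * E $ True $ True) / 2)"
  have "E = (\<Sum>a\<in>UNIV. \<Sum>b\<in>UNIV. mat (c a b) ** pauli_xz a b)"
    by (simp add: bool_op_eq_iff UNIV_bool pauli_xz_def c_def field_simps)
  then show ?thesis by blast
qed

lemma parity_sign_cases: "parity_sign a b = 1 \<or> parity_sign a b = - 1"
proof -
  have "(\<Prod>q\<in>S. if a q \<and> b q then - 1 else 1 :: complex) = 1 \<or>
      (\<Prod>q\<in>S. if a q \<and> b q then - 1 else 1 :: complex) = - 1" if "finite S" for S
    using that by (induction S rule: finite_induct) auto
  then show ?thesis by (simp add: parity_sign_def)
qed

lemma pauli_string_mult:
  "pauli_string a b ** pauli_string a' b' =
     mat (parity_sign b a') ** pauli_string (\<lambda>q. a q \<noteq> a' q) (\<lambda>q. b q \<noteq> b' q)"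
  unfolding pauli_string_def tensor_mult pauli_xz_mult tensor_smult parity_sign_def ..

text \<open>The sign is -1 to the symplectic product of the labels. The two strings commute exactly
  when \<open>parity_sign b c = parity_sign d a\<close>, the form in which commutation is stated
  below.\<close>

lemma pauli_string_commute:
  "pauli_string a b ** pauli_string c d =
     mat (parity_sign b c * parity_sign d a) ** (pauli_string c d ** pauli_string a b)"
proof -
  have "(\<lambda>q. c q \<noteq> a q) = (\<lambda>q. a q \<noteq> c q)" "(\<lambda>q. d q \<noteq> b q) = (\<lambda>q. b q \<noteq> d q)" by auto
  then show ?thesis
    unfolding pauli_string_mult mat_mult_mat_left using parity_sign_cases[of d a] by auto
qed

lemma adj_pauli_string: "adj (pauli_string a b) = mat (parity_sign a b) ** pauli_string a b"
  unfolding pauli_string_def adj_tensor adj_pauli_xz tensor_smult parity_sign_def ..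

lemma unitary_pauli_xz: "unitary (pauli_xz a b)"
  by (cases a; cases b) (simp_all add: unitary_def bool_op_eq_iff bool_mult_nth pauli_xz_def mat_nth)

lemma unitary_pauli_string: "unitary (pauli_string a b)"
  unfolding pauli_string_def by (intro unitary_tensor unitary_pauli_xz)

lemma pauli_string_0: "pauli_string (\<lambda>_. False) (\<lambda>_. False) = mat 1"
  by (simp add: pauli_string_def pauli_xz_simps tensor_mat_1)

lemma local_op_pauli_xz:
  "local_op q (pauli_xz a b) = pauli_string (\<lambda>p. p = q \<and> a) (\<lambda>p. p = q \<and> b)"
  unfolding local_op_def pauli_string_def
  by (rule arg_cong[of _ _ tensor]) (auto simp: pauli_xz_simps)

lemma pauli_string_apply:
  "(pauli_string a b *v w) $ x = parity_sign b (\<lambda>q. x q \<noteq> a q) * w $ (\<lambda>q. x q \<noteq> a q)"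
proof -
  have "pauli_string a b $ x $ k = (if (\<lambda>q. x q \<noteq> a q) = k then parity_sign b k else 0)" for k
  proof (cases "(\<lambda>q. x q \<noteq> a q) = k")
    case True
    then have "x q = (k q \<noteq> a q)" for q by auto
    then show ?thesis using True by (simp add: pauli_string_def tensor_nth pauli_xz_def parity_sign_def)
  next
    case False
    then obtain q where "x q \<noteq> (k q \<noteq> a q)" by (auto simp: fun_eq_iff)
    then have "\<exists>q. pauli_xz (a q) (b q) $ x q $ k q = 0" by (intro exI[of _ q]) (simp add: pauli_xz_def)
    then show ?thesis using False by (simp add: pauli_string_def tensor_nth)
  qed
  then show ?thesis by (simp add: mult_vec_nth if_mult_sum)
qed

subsection \<open>Encoders\<close>

lemma braket_self: "braket v v = of_real ((norm v)\<^sup>2)"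
proof -
  have "(norm v)\<^sup>2 = (\<Sum>i\<in>UNIV. (cmod (v $ i))\<^sup>2)"
    by (simp add: norm_vec_def L2_set_def sum_nonneg)
  then show ?thesis
    unfolding braket_def by (simp only: of_real_sum complex_norm_square mult.commute)
qed

text \<open>These facts hold for every logical basis, hence for the one that the choice operator
  picks. Its two vectors are orthogonal as eigenvectors of the unitary \<open>LZ\<close> for
  different eigenvalues.\<close>

lemma encoder_properties:
  assumes ex: "logical_basis G LX LZ w0 w1" and LX: "LX ** LX = mat 1" and LZ: "unitary LZ"
  defines "V \<equiv> encoder G LX LZ"
  shows "adj V ** V = mat 1" "g \<in> G \<Longrightarrow> g ** V = V" "LZ ** V = V ** pauli_Z" "LX ** V = V ** pauli_X"
proof -
  have "\<exists>v0 v1. logical_basis G LX LZ v0 v1 \<and> V = (\<chi> x b. if b then v1 $ x else v0 $ x)"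
    unfolding V_def encoder_def by (rule someI_ex) (use ex in blast)
  then obtain v0 v1 where b: "logical_basis G LX LZ v0 v1" and V: "V = (\<chi> x b. if b then v1 $ x else v0 $ x)"
    by blast
  note b = b[unfolded logical_basis_def stabilized_space_def]
  have col: "(A ** V) $ x $ b = (A *v (if b then v1 else v0)) $ x" for A :: "complex ^ 'a ^ 'c::finite" and x b
    by (simp add: V mult_nth mult_vec_nth)
  have Vn: "V $ x $ b = (if b then v1 else v0) $ x" for x b by (simp add: V)
  have X1: "LX *v v1 = v0"
  proof -
    have "LX *v v1 = LX *v (LX *v v0)" using b by simp
    then show ?thesis by (simp add: matrix_vector_mul_assoc LX)
  qed
  have "braket v0 v1 = braket v0 (adj LZ *v (LZ *v v1))"
    using unitaryD(1)[OF LZ] by (simp add: matrix_vector_mul_assoc)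
  also have "\<dots> = - braket v0 v1"
    using b braket_scale_right[of v0 "- 1" v1] by (simp add: braket_mult_right[of v0])
  finally have o: "braket v0 v1 = 0" by simp
  have "adj V ** V = mat 1 \<longleftrightarrow> braket v0 v0 = 1 \<and> braket v1 v1 = 1 \<and> braket v0 v1 = 0 \<and> braket v1 v0 = 0"
    by (auto simp: bool_op_eq_iff mult_nth Vn braket_def mat_nth)
  then show "adj V ** V = mat 1"
    using o braket_commute[of v1 v0] b by (simp add: braket_self)
  show "g ** V = V" if "g \<in> G"
    using b that by (intro matrix_ext) (simp add: col Vn)
  have e: "LZ *v v0 = v0" "LZ *v v1 = - v1" "LX *v v0 = v1" using b by simp_all
  show "LZ ** V = V ** pauli_Z"
  proof (rule matrix_ext)
    fix x j
    show "(LZ ** V) $ x $ j = (V ** pauli_Z) $ x $ j"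
      by (cases j) (simp_all add: col bool_mult_nth Vn pauli_Z_def e)
  qed
  show "LX ** V = V ** pauli_X"
  proof (rule matrix_ext)
    fix x j
    show "(LX ** V) $ x $ j = (V ** pauli_X) $ x $ j"
      by (cases j) (simp_all add: col bool_mult_nth Vn pauli_X_def e X1)
  qed
qed

subsection \<open>Decoders\<close>

text \<open>
  The Kraus operators of a decoder for mutually orthogonal copies \<open>J t\<close> of the code: the
  inverses of the \<open>J t\<close>, and a measurement on the orthogonal complement of all copies.
\<close>

lemma decoder_exists:
  fixes J :: "'t::finite \<Rightarrow> complex ^ bool ^ 'b::finite"
  assumes orth: "\<And>t u. t \<in> T \<Longrightarrow> u \<in> T \<Longrightarrow> adj (J t) ** J u = (if t = u then mat 1 else 0)"
  shows "\<exists>D :: 't + 'b \<Rightarrow> complex ^ 'b ^ bool.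
    (\<Sum>s\<in>UNIV. adj (D s) ** D s) = mat 1 \<and> (\<forall>s. \<forall>t\<in>T. \<exists>e. D s ** J t = mat e)"
proof -
  define P where "P = (\<Sum>t\<in>T. J t ** adj (J t))"
  define R where "R = mat 1 - P"
  \<comment> \<open>The operator \<open>Inr x\<close> sends row \<open>x\<close> of the projector
    \<open>R\<close> to the output state 0. These operators contribute \<open>adj R ** R\<close> to
    the sum and vanish on all copies.\<close>
  define D :: "'t + 'b \<Rightarrow> complex ^ 'b ^ bool" where
    "D = (\<lambda>s. case s of Inl t \<Rightarrow> if t \<in> T then adj (J t) else 0 | Inr x \<Rightarrow> (\<chi> b y. if b then 0 else R $ x $ y))"
  have PJ: "P ** J u = J u" if "u \<in> T" for u
  proof -
    have "P ** J u = (\<Sum>t\<in>T. J t ** (adj (J t) ** J u))"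
      by (simp add: P_def matrix_sum_left matrix_mul_assoc)
    also have "\<dots> = (\<Sum>t\<in>T. if t = u then J u else 0)"
      using that by (intro sum.cong refl) (auto simp: orth)
    finally show ?thesis using that by simp
  qed
  have diff: "(A - B) ** C = A ** C - B ** C" "C' ** (A - B) = C' ** A - C' ** B"
    for A B :: "'b op" and C :: "complex ^ 'c::finite ^ 'b" and C' :: "'b op"
    by (rule matrix_ext, simp add: mult_nth algebra_simps sum_subtractf)+
  have RJ: "R ** J t = 0" if "t \<in> T" for t
    using that by (simp add: R_def diff PJ)
  have "P ** P = P"
  proof -
    have "P ** P = (\<Sum>t\<in>T. P ** J t ** adj (J t))"
      by (subst (2) P_def) (simp add: matrix_sum_right matrix_mul_assoc)
    also have "\<dots> = (\<Sum>t\<in>T. J t ** adj (J t))" by (intro sum.cong refl) (simp add: PJ)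
    finally show ?thesis unfolding P_def .
  qed
  then have RR: "R ** R = R" by (simp add: R_def diff)
  have "adj P = P" by (simp add: P_def adj_sum adj_mult)
  then have "adj R = R" unfolding R_def by (simp add: vec_eq_iff mat_nth)
  have "(\<Sum>s\<in>UNIV. adj (D s) ** D s) =
      (\<Sum>t\<in>UNIV. adj (D (Inl t)) ** D (Inl t)) + (\<Sum>x\<in>UNIV. adj (D (Inr x)) ** D (Inr x))"
    unfolding UNIV_Plus_UNIV[symmetric] by (subst sum.Plus) simp_all
  also have "(\<Sum>t\<in>UNIV. adj (D (Inl t)) ** D (Inl t)) = (\<Sum>t\<in>UNIV. if t \<in> T then J t ** adj (J t) else 0)"
    by (intro sum.cong refl) (auto simp: D_def vec_eq_iff mult_nth)
  also have "\<dots> = P"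
    unfolding P_def by (simp add: sum.If_cases)
  also have "(\<Sum>x\<in>UNIV. adj (D (Inr x)) ** D (Inr x)) = adj R ** R"
    by (rule matrix_ext) (simp add: mult_nth D_def UNIV_bool)
  also have "P + adj R ** R = mat 1"
    unfolding \<open>adj R = R\<close> RR by (simp add: R_def)
  finally have "(\<Sum>s\<in>UNIV. adj (D s) ** D s) = mat 1" .
  moreover have "\<exists>e. D s ** J t = mat e" if t: "t \<in> T" for s t
  proof (cases s)
    case (Inl u)
    have "D s ** J t = mat (if u \<in> T \<and> u = t then 1 else 0)"
      using t by (auto simp: Inl D_def orth)
    then show ?thesis by blast
  next
    case (Inr x)
    have "D s ** J t = mat 0"
    proof (rule matrix_ext)
      fix b c
      have "(D s ** J t) $ b $ c = (if b then 0 else (R ** J t) $ x $ c)"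
        by (simp add: Inr D_def mult_nth)
      then show "(D s ** J t) $ b $ c = mat 0 $ b $ c" by (simp add: RJ[OF t] mat_nth)
    qed
    then show ?thesis by blast
  qed
  ultimately show ?thesis by blast
qed

text \<open>
  A Pauli operator that anticommutes with a stabilizer moves the code to an orthogonal space.
  Hence the hypothesis \<open>detect\<close> (distance three) makes the images of the code under different
  single-qubit Pauli operators orthogonal.
\<close>

lemma distance_three_decoder:
  fixes V :: "complex ^ bool ^ ('q::finite \<Rightarrow> bool)" and S :: "(('q \<Rightarrow> bool) \<times> ('q \<Rightarrow> bool)) set"
  assumes V: "adj V ** V = mat 1"
    and stab: "\<And>c d. (c, d) \<in> S \<Longrightarrow> pauli_string c d ** V = V"
    and detect: "\<And>a b p q r. \<lbrakk>\<And>r. r \<noteq> p \<Longrightarrow> r \<noteq> q \<Longrightarrow> \<not> a r \<and> \<not> b r;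
        \<And>c d. (c, d) \<in> S \<Longrightarrow> parity_sign b c = parity_sign d a\<rbrakk> \<Longrightarrow> \<not> a r \<and> \<not> b r"
    and u: "\<And>i. unitary (u i)"
  shows "\<exists>D :: ('q \<Rightarrow> bool) \<times> ('q \<Rightarrow> bool) + ('q \<Rightarrow> bool) \<Rightarrow> complex ^ ('q \<Rightarrow> bool) ^ bool.
    (\<Sum>s\<in>UNIV. adj (D s) ** D s) = mat 1 \<and>
    (\<forall>s q E. \<exists>e. D s ** (local_op q E ** (tensor u ** V)) = mat e)"
proof -
  \<comment> \<open>Labels of the Pauli operators that act on at most one qubit, the identity among
    them.\<close>
  define T where "T = {(a, b). \<exists>q :: 'q. \<forall>p. p \<noteq> q \<longrightarrow> \<not> a p \<and> \<not> b p}"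
  define J where "J = (\<lambda>(a, b). tensor u ** (pauli_string a b ** V))"
  have zero: "adj V ** (pauli_string a b ** V) = 0" if g: "(c, d) \<in> S" and anti: "parity_sign b c \<noteq> parity_sign d a" for a b c d
  proof -
    let ?g = "pauli_string c d" and ?Q = "pauli_string a b"
    note pauli_string_commute[of a b c d]
    moreover have "parity_sign b c * parity_sign d a = - 1"
      using anti parity_sign_cases[of b c] parity_sign_cases[of d a] by auto
    ultimately have comm: "?Q ** ?g = mat (- 1) ** (?g ** ?Q)" by simp
    have gV: "adj V ** ?g = adj V"
    proof -
      have "adj ?g ** V = V"
        using unitary_cancel(1)[OF unitary_pauli_string, of c d V] stab[OF g] by simp
      then have "adj (adj ?g ** V) = adj V" by simp
      then show ?thesis by (simp add: adj_mult)
    qed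
    have "adj V ** (?Q ** V) = adj V ** (?Q ** ?g) ** V"
      using stab[OF g] by (simp flip: matrix_mul_assoc)
    also have "\<dots> = mat (- 1) ** (adj V ** ?g ** (?Q ** V))"
      unfolding comm by (simp add: mult_mat_left matrix_mul_assoc[symmetric])
    finally have "adj V ** (?Q ** V) = mat (- 1) ** (adj V ** (?Q ** V))"
      unfolding gV .
    then show ?thesis by (auto simp: vec_eq_iff)
  qed
  have orth: "adj (J t) ** J t' = (if t = t' then mat 1 else 0)" if "t \<in> T" "t' \<in> T" for t t'
  proof -
    obtain a b a' b' where t: "t = (a, b)" "t' = (a', b')" by (cases t; cases t') auto
    have J: "adj (J t) ** J t' = adj V ** (adj (pauli_string a b) ** (pauli_string a' b' ** V))"
      unfolding t J_def by (simp add: adj_mult matrix_mul_assoc[symmetric] unitary_cancel[OF unitary_tensor[OF u]])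
    show ?thesis
    proof (cases "t = t'")
      case True
      then show ?thesis unfolding J using V t by (simp add: unitary_cancel[OF unitary_pauli_string])
    next
      case False
      let ?a = "\<lambda>q. a q \<noteq> a' q" and ?b = "\<lambda>q. b q \<noteq> b' q"
      obtain p q where "\<forall>r. r \<noteq> p \<longrightarrow> \<not> a r \<and> \<not> b r" "\<forall>r. r \<noteq> q \<longrightarrow> \<not> a' r \<and> \<not> b' r"
        using \<open>t \<in> T\<close> \<open>t' \<in> T\<close> t by (auto simp: T_def)
      then have supp: "\<And>r. r \<noteq> p \<Longrightarrow> r \<noteq> q \<Longrightarrow> \<not> ?a r \<and> \<not> ?b r" by blast
      obtain r where "?a r \<or> ?b r" using False t by (auto simp: fun_eq_iff)
      then obtain c d where "(c, d) \<in> S" "parity_sign ?b c \<noteq> parity_sign d ?a"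
        using detect[where a = ?a and b = ?b, OF supp] by blast
      then have "adj V ** (pauli_string ?a ?b ** V) = 0" by (rule zero)
      moreover have "adj V ** (adj (pauli_string a b) ** (pauli_string a' b' ** V)) =
          mat (parity_sign a b * parity_sign b a') ** (adj V ** (pauli_string ?a ?b ** V))"
        by (simp only: adj_pauli_string matrix_mul_assoc[symmetric] mult_mat_left[of "adj V"] mat_mult_mat_left)
           (simp add: matrix_mul_assoc pauli_string_mult mat_commute[of "adj V"])
      ultimately show ?thesis unfolding J using False by (simp add: vec_eq_iff)
    qed
  qed
  obtain D :: "('q \<Rightarrow> bool) \<times> ('q \<Rightarrow> bool) + ('q \<Rightarrow> bool) \<Rightarrow> complex ^ ('q \<Rightarrow> bool) ^ bool"
    where D: "(\<Sum>s\<in>UNIV. adj (D s) ** D s) = mat 1" "\<And>s t. t \<in> T \<Longrightarrow> \<exists>e. D s ** J t = mat e"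
    using decoder_exists[of T J, OF orth] by blast
  have "\<exists>e. D s ** (local_op q E ** (tensor u ** V)) = mat e" for s q E
  proof -
    \<comment> \<open>A product of one-qubit unitaries conjugates a one-qubit error to one on the
      same qubit, so the labels of the unrotated code suffice.\<close>
    have lo: "local_op q E ** tensor u = tensor u ** local_op q (adj (u q) ** E ** u q)"
      unfolding local_op_def tensor_mult
      by (rule arg_cong[of _ _ tensor]) (auto simp: unitary_cancel[OF u] simp flip: matrix_mul_assoc)
    obtain c where c: "adj (u q) ** E ** u q = (\<Sum>a\<in>UNIV. \<Sum>b\<in>UNIV. mat (c a b) ** pauli_xz a b)"
      using pauli_xz_decomposition by blast
    have "D s ** (local_op q E ** (tensor u ** V)) = D s ** ((local_op q E ** tensor u) ** V)"
      by (simp only: matrix_mul_assoc)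
    also have "\<dots> =
        D s ** (tensor u ** (local_op q (\<Sum>a\<in>UNIV. \<Sum>b\<in>UNIV. mat (c a b) ** pauli_xz a b) ** V))"
      unfolding lo c by (simp only: matrix_mul_assoc)
    also have "\<dots> = (\<Sum>a\<in>UNIV. \<Sum>b\<in>UNIV. mat (c a b) ** (D s ** J (\<lambda>p. p = q \<and> a, \<lambda>p. p = q \<and> b)))"
      by (simp add: local_op_sum local_op_smult local_op_pauli_xz matrix_sum_left matrix_sum_right J_def
          matrix_mul_assoc[symmetric] mult_mat_left)
    finally have eq: "D s ** (local_op q E ** (tensor u ** V)) =
        (\<Sum>a\<in>UNIV. \<Sum>b\<in>UNIV. mat (c a b) ** (D s ** J (\<lambda>p. p = q \<and> a, \<lambda>p. p = q \<and> b)))" .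
    have "\<exists>e. D s ** J (\<lambda>p. p = q \<and> a, \<lambda>p. p = q \<and> b) = mat e" for a b
      by (rule D(2)) (auto simp: T_def)
    then obtain e where "\<And>a b. D s ** J (\<lambda>p. p = q \<and> a, \<lambda>p. p = q \<and> b) = mat (e a b)" by metis
    then have "D s ** (local_op q E ** (tensor u ** V)) = mat (\<Sum>a\<in>UNIV. \<Sum>b\<in>UNIV. c a b * e a b)"
      unfolding eq by (simp add: mat_sum)
    then show ?thesis by blast
  qed
  with D(1) show ?thesis by blast
qed

section \<open>The 5'-qubit code\<close>

lemma prod_qubit5: "(\<Prod>q\<in>UNIV. f q) = f Q1 * f Q2 * f Q3 * f Q4 * (f Q5 :: complex)"
  by (simp add: UNIV_qubit5)

definition bits5 :: "bool \<Rightarrow> bool \<Rightarrow> bool \<Rightarrow> bool \<Rightarrow> bool \<Rightarrow> qubit5 \<Rightarrow> bool" where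
  "bits5 x1 x2 x3 x4 x5 = (\<lambda>q. case q of Q1 \<Rightarrow> x1 | Q2 \<Rightarrow> x2 | Q3 \<Rightarrow> x3 | Q4 \<Rightarrow> x4 | Q5 \<Rightarrow> x5)"

lemma bits5_simps [simp]:
  "bits5 x1 x2 x3 x4 x5 Q1 = x1" "bits5 x1 x2 x3 x4 x5 Q2 = x2" "bits5 x1 x2 x3 x4 x5 Q3 = x3"
  "bits5 x1 x2 x3 x4 x5 Q4 = x4" "bits5 x1 x2 x3 x4 x5 Q5 = x5"
  by (simp_all add: bits5_def)

lemma bits5_eta: "bits5 (x Q1) (x Q2) (x Q3) (x Q4) (x Q5) = x"
proof
  fix q show "bits5 (x Q1) (x Q2) (x Q3) (x Q4) (x Q5) q = x q" by (cases q) simp_all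
qed

lemma bits5_xor [simp]:
  "(\<lambda>q. bits5 x1 x2 x3 x4 x5 q = (\<not> bits5 y1 y2 y3 y4 y5 q)) =
     bits5 (x1 = (\<not> y1)) (x2 = (\<not> y2)) (x3 = (\<not> y3)) (x4 = (\<not> y4)) (x5 = (\<not> y5))"
proof
  fix q
  show "(bits5 x1 x2 x3 x4 x5 q = (\<not> bits5 y1 y2 y3 y4 y5 q)) =
     bits5 (x1 = (\<not> y1)) (x2 = (\<not> y2)) (x3 = (\<not> y3)) (x4 = (\<not> y4)) (x5 = (\<not> y5)) q"
    by (cases q) simp_all
qed

lemma bits5_xor3:
  "(\<lambda>q. bits5 z1 z2 z3 z4 z5 q = (bits5 x1 x2 x3 x4 x5 q = bits5 y1 y2 y3 y4 y5 q)) =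
     bits5 (z1 = (x1 = y1)) (z2 = (x2 = y2)) (z3 = (x3 = y3)) (z4 = (x4 = y4)) (z5 = (x5 = y5))"
proof
  fix q
  show "(bits5 z1 z2 z3 z4 z5 q = (bits5 x1 x2 x3 x4 x5 q = bits5 y1 y2 y3 y4 y5 q)) =
     bits5 (z1 = (x1 = y1)) (z2 = (x2 = y2)) (z3 = (x3 = y3)) (z4 = (x4 = y4)) (z5 = (x5 = y5)) q"
    by (cases q) simp_all
qed

lemma parity_sign_bits5:
  "parity_sign a b = (if a Q1 \<and> b Q1 then - 1 else 1) * (if a Q2 \<and> b Q2 then - 1 else 1) *
     (if a Q3 \<and> b Q3 then - 1 else 1) * (if a Q4 \<and> b Q4 then - 1 else 1) * (if a Q5 \<and> b Q5 then - 1 else 1)"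
  by (simp add: parity_sign_def prod_qubit5)

text \<open>X and Z parts of the four generators. No generator contains Y, so each equals its
  \<open>pauli_string\<close> without a phase.\<close>

definition five_labels :: "((qubit5 \<Rightarrow> bool) \<times> (qubit5 \<Rightarrow> bool)) set" where
  "five_labels =
    {(bits5 True False False True False, bits5 False True True False False),
     (bits5 False True False False True, bits5 False False True True False),
     (bits5 True False True False False, bits5 False False False True True),
     (bits5 False True False True False, bits5 True False False False True)}"

lemma tensor5_pauli_string:
  "tensor5 (pauli_xz a1 b1) (pauli_xz a2 b2) (pauli_xz a3 b3) (pauli_xz a4 b4) (pauli_xz a5 b5) =
     pauli_string (bits5 a1 a2 a3 a4 a5) (bits5 b1 b2 b3 b4 b5)"
  unfolding tensor5_def pauli_string_def
proof (rule arg_cong[of _ _ tensor], rule ext)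
  fix q
  show "(case q of Q1 \<Rightarrow> pauli_xz a1 b1 | Q2 \<Rightarrow> pauli_xz a2 b2 | Q3 \<Rightarrow> pauli_xz a3 b3 | Q4 \<Rightarrow> pauli_xz a4 b4 | Q5 \<Rightarrow> pauli_xz a5 b5) =
      pauli_xz (bits5 a1 a2 a3 a4 a5 q) (bits5 b1 b2 b3 b4 b5 q)"
    by (cases q) simp_all
qed

lemma five_generators_labels: "five_generators = (\<lambda>(a, b). pauli_string a b) ` five_labels"
  unfolding five_generators_def five_labels_def image_insert image_empty prod.case
    tensor5_pauli_string[symmetric] pauli_xz_simps ..

abbreviation all5 :: "qubit5 \<Rightarrow> bool" where "all5 \<equiv> bits5 True True True True True"
abbreviation none5 :: "qubit5 \<Rightarrow> bool" where "none5 \<equiv> bits5 False False False False False"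

lemma none5_eq: "none5 q = False" and all5_eq: "all5 q = True"
  by (cases q; simp)+

lemma none5_fun: "none5 = (\<lambda>_. False)"
  by (rule ext) (rule none5_eq)

lemma pauli_string_none5: "pauli_string none5 none5 = mat 1"
  by (simp add: pauli_string_def none5_eq pauli_xz_simps tensor_mat_1)

lemma pauli_bits5_mult:
  "pauli_string (bits5 a1 a2 a3 a4 a5) (bits5 b1 b2 b3 b4 b5) ** pauli_string (bits5 c1 c2 c3 c4 c5) (bits5 d1 d2 d3 d4 d5) =
     mat (parity_sign (bits5 b1 b2 b3 b4 b5) (bits5 c1 c2 c3 c4 c5)) **
     pauli_string (bits5 (a1 \<noteq> c1) (a2 \<noteq> c2) (a3 \<noteq> c3) (a4 \<noteq> c4) (a5 \<noteq> c5))
       (bits5 (b1 \<noteq> d1) (b2 \<noteq> d2) (b3 \<noteq> d3) (b4 \<noteq> d4) (b5 \<noteq> d5))"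
  by (simp add: pauli_string_mult)

lemma pauli_string_smult:
  "pauli_string a b ** (mat c ** M) = mat c ** (pauli_string a b ** (M :: complex ^ 'm::finite ^ ('q::finite \<Rightarrow> bool)))"
  by (rule mult_mat_left)

lemma logical_five:
  "tensor (\<lambda>_. pauli_X) = pauli_string all5 none5" "tensor (\<lambda>_. pauli_Z) = pauli_string none5 all5"
  by (simp_all add: pauli_string_def pauli_xz_simps none5_eq all5_eq)

definition five_u :: "qubit5 \<Rightarrow> bool op" where
  "five_u q = (case q of Q1 \<Rightarrow> gate_K | Q2 \<Rightarrow> mat 1 | Q3 \<Rightarrow> pauli_Y | Q4 \<Rightarrow> mat 1 | Q5 \<Rightarrow> gate_K)"

lemma five_U_tensor: "five_U = tensor five_u"
  unfolding five_U_def tensor5_def five_u_def ..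

lemma unitary_five_u: "unitary (five_u q)"
proof -
  have "unitary pauli_Y" by (simp add: unitary_def pauli_Y_def adj_mat2 mat2_mult mat_mat2)
  then show ?thesis by (cases q) (simp_all add: five_u_def unitary_gate_K unitary_mat_1)
qed

lemma unitary_five_U: "unitary five_U"
  unfolding five_U_tensor by (intro unitary_tensor unitary_five_u)

subsection \<open>Existence of a logical basis\<close>

text \<open>Either \<open>w + A w\<close> is nonzero, and it is fixed by the involution A, or
  \<open>w\<close> lies in the -1 eigenspace of A. In the second case the Pauli operator with label
  \<open>(h, k)\<close>, which commutes with \<open>S\<close> and anticommutes with A, moves
  \<open>w\<close> to the +1 eigenspace.\<close>

lemma stabilized_vector_extend:
  assumes ex: "\<exists>w. w \<noteq> 0 \<and> (\<forall>(c, d)\<in>S. pauli_string c d *v w = w)"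
    and sq: "parity_sign b a = 1"
    and c: "\<forall>(c, d)\<in>S. parity_sign b c = parity_sign d a"
    and c': "\<forall>(c, d)\<in>S. parity_sign k c = parity_sign d h"
    and anti: "parity_sign k a \<noteq> parity_sign b h"
  shows "\<exists>w. w \<noteq> 0 \<and> (\<forall>(c, d)\<in>insert (a, b) S. pauli_string c d *v w = w)"
proof -
  let ?A = "pauli_string a b" and ?H = "pauli_string h k"
  have comm: "parity_sign b c = parity_sign d a" and comm': "parity_sign k c = parity_sign d h"
    if "(c, d) \<in> S" for c d using that c c' by auto
  obtain w where w: "w \<noteq> 0" "\<And>c d. (c, d) \<in> S \<Longrightarrow> pauli_string c d *v w = w" using ex by auto
  have A2: "?A ** ?A = mat 1"
    by (simp add: pauli_string_mult sq pauli_string_0)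
  have swap: "pauli_string c d *v (pauli_string c' d' *v w) =
      (parity_sign d c' * parity_sign d' c) *s (pauli_string c' d' *v (pauli_string c d *v w))" for c d c' d'
    unfolding matrix_vector_mul_assoc by (subst pauli_string_commute) (simp flip: matrix_vector_mul_assoc)
  have sgn: "parity_sign x y * parity_sign x y = 1" for x y :: "'a \<Rightarrow> bool"
    using parity_sign_cases[of x y] by auto
  show ?thesis
  proof (cases "w + ?A *v w = 0")
    case False
    have "?A *v (w + ?A *v w) = w + ?A *v w"
      by (simp add: matrix_vector_right_distrib matrix_vector_mul_assoc A2 add.commute)
    moreover have "pauli_string c d *v (w + ?A *v w) = w + ?A *v w" if "(c, d) \<in> S" for c d
      using that comm[OF that] by (simp add: matrix_vector_right_distrib swap[of c d a b] w(2) sgn)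
    ultimately show ?thesis using False by (intro exI[of _ "w + ?A *v w"]) auto
  next
    case True
    then have "?A *v w = - w" by (simp add: eq_neg_iff_add_eq_0 add.commute)
    have "parity_sign b h * parity_sign k a = - 1"
      using anti parity_sign_cases[of b h] parity_sign_cases[of k a] by auto
    then have "?A *v (?H *v w) = ?H *v w"
      unfolding swap[of a b h k] \<open>?A *v w = - w\<close> by (simp add: vec_eq_iff mult_vec_nth sum_negf)
    moreover have "pauli_string c d *v (?H *v w) = ?H *v w" if "(c, d) \<in> S" for c d
      using that comm'[OF that] by (simp add: swap[of c d h k] w(2) sgn)
    moreover have "?H *v w \<noteq> 0"
    proof
      assume "?H *v w = 0"
      then have "adj ?H *v (?H *v w) = 0" by simp
      then show False using w(1) by (simp add: matrix_vector_mul_assoc unitaryD[OF unitary_pauli_string])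
    qed
    ultimately show ?thesis by (intro exI[of _ "?H *v w"]) auto
  qed
qed

text \<open>The generators and finally the logical Z are added one by one to an arbitrary nonzero
  vector. The helpers, which anticommute with the newcomer and commute with its predecessors, are X
  on qubit 2, Z on qubit 5, Z on qubit 3, X on qubit 1, and the logical X.\<close>

lemma five_stabilized_vector:
  "\<exists>w. w \<noteq> 0 \<and> (\<forall>(c, d)\<in>insert (none5, all5) five_labels. pauli_string c d *v w = w)"
proof -
  have "\<exists>w :: (qubit5 \<Rightarrow> bool) state. w \<noteq> 0 \<and> (\<forall>(c, d)\<in>{}. pauli_string c d *v w = w)"
    by (intro exI[of _ 1]) simp
  note 1 = stabilized_vector_extend[OF this, of "bits5 False True True False False" "bits5 True False False True False"
      none5 "bits5 False True False False False"]
  then have "\<exists>w. w \<noteq> 0 \<and> (\<forall>(c, d)\<in>{(bits5 True False False True False, bits5 False True True False False)}.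
      pauli_string c d *v w = w)"
    by (simp add: parity_sign_bits5)
  note 2 = stabilized_vector_extend[OF this, of "bits5 False False True True False" "bits5 False True False False True"
      "bits5 False False False False True" none5]
  then have "\<exists>w. w \<noteq> 0 \<and> (\<forall>(c, d)\<in>{(bits5 False True False False True, bits5 False False True True False),
      (bits5 True False False True False, bits5 False True True False False)}. pauli_string c d *v w = w)"
    by (simp add: parity_sign_bits5)
  note 3 = stabilized_vector_extend[OF this, of "bits5 False False False True True" "bits5 True False True False False"
      "bits5 False False True False False" none5]
  then have "\<exists>w. w \<noteq> 0 \<and> (\<forall>(c, d)\<in>{(bits5 True False True False False, bits5 False False False True True),
      (bits5 False True False False True, bits5 False False True True False),
      (bits5 True False False True False, bits5 False True True False False)}. pauli_string c d *v w = w)"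
    by (simp add: parity_sign_bits5)
  note 4 = stabilized_vector_extend[OF this, of "bits5 True False False False True" "bits5 False True False True False"
      none5 "bits5 True False False False False"]
  then have "\<exists>w. w \<noteq> 0 \<and> (\<forall>(c, d)\<in>{(bits5 False True False True False, bits5 True False False False True),
      (bits5 True False True False False, bits5 False False False True True),
      (bits5 False True False False True, bits5 False False True True False),
      (bits5 True False False True False, bits5 False True True False False)}. pauli_string c d *v w = w)"
    by (simp add: parity_sign_bits5)
  note 5 = stabilized_vector_extend[OF this, of all5 none5 none5 all5]
  show ?thesis
    unfolding five_labels_def using 5 by (simp add: parity_sign_bits5 insert_commute)
qed

lemma norm_unitary: "unitary U \<Longrightarrow> norm (U *v v) = norm v"
proof -
  assume "unitary U"
  then have "braket (U *v v) (U *v v) = braket v v"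
    using braket_mult_right[of v "adj U" "U *v v"] by (simp add: matrix_vector_mul_assoc unitaryD)
  then have "(norm (U *v v))\<^sup>2 = (norm v)\<^sup>2"
    unfolding braket_self of_real_eq_iff .
  then show ?thesis by simp
qed

lemma norm_vector_smult: "norm (c *s v) = cmod c * norm (v :: complex ^ 'n::finite)"
proof -
  have "braket (c *s v) (c *s v) = (cnj c * c) * braket v v"
    by (simp add: braket_scale_left braket_scale_right)
  also have "cnj c * c = of_real ((cmod c)\<^sup>2)" by (simp only: complex_norm_square mult.commute)
  finally have "(norm (c *s v))\<^sup>2 = (cmod c * norm v)\<^sup>2"
    unfolding braket_self of_real_mult[symmetric] of_real_eq_iff power_mult_distrib .
  then show ?thesis by (simp add: power2_eq_iff_nonneg)
qed

lemma five_logical_basis: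
  "\<exists>v0 v1. logical_basis five_generators (tensor (\<lambda>_. pauli_X)) (tensor (\<lambda>_. pauli_Z)) v0 v1"
proof -
  obtain w where w: "w \<noteq> 0" "\<And>c d. (c, d) \<in> insert (none5, all5) five_labels \<Longrightarrow> pauli_string c d *v w = w"
    using five_stabilized_vector by auto
  define v0 where "v0 = of_real (1 / norm w) *s w"
  define v1 where "v1 = pauli_string all5 none5 *v v0"
  have st: "pauli_string c d *v v0 = v0" if "(c, d) \<in> insert (none5, all5) five_labels" for c d
    unfolding v0_def by (simp add: vector_scalar_commute w(2)[OF that])
  have n: "norm v0 = 1" "norm v1 = 1"
    using w(1) by (simp_all add: v1_def norm_unitary unitary_pauli_string v0_def norm_vector_smult norm_divide)
  have swap: "pauli_string c d *v v1 = (parity_sign d all5 * parity_sign none5 c) *s (pauli_string all5 none5 *v (pauli_string c d *v v0))" for c d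
    unfolding v1_def matrix_vector_mul_assoc by (subst pauli_string_commute) (simp flip: matrix_vector_mul_assoc)
  have "pauli_string c d *v v1 = v1" if "(c, d) \<in> five_labels" for c d
    unfolding swap using st[of c d] that v1_def by (auto simp: five_labels_def parity_sign_bits5)
  moreover have "pauli_string none5 all5 *v v1 = - v1"
    unfolding swap using st[of none5 all5] by (simp add: parity_sign_bits5 v1_def[symmetric])
  ultimately have "logical_basis five_generators (pauli_string all5 none5) (pauli_string none5 all5) v0 v1"
    unfolding logical_basis_def stabilized_space_def five_generators_labels using n st v1_def by auto
  then show ?thesis unfolding logical_five by blast
qed

lemma logical_basis_conj:
  assumes "logical_basis G LX LZ v0 v1" "unitary U"
  shows "logical_basis ((\<lambda>P. U ** P ** adj U) ` G) (U ** LX ** adj U) (U ** LZ ** adj U) (U *v v0) (U *v v1)"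
proof -
  have c: "(U ** P ** adj U) *v (U *v v) = U *v (P *v v)" for P v
    using assms(2) by (simp add: matrix_vector_mul_assoc unitaryD flip: matrix_mul_assoc)
  have m: "U *v (- v) = - (U *v v)" for v
    by (simp add: vec_eq_iff mult_vec_nth sum_negf)
  show ?thesis
    using assms unfolding logical_basis_def stabilized_space_def by (auto simp: c m norm_unitary)
qed

text \<open>The encoder of the unrotated code, derived from \<open>enc5'\<close> instead of a second
  use of the choice operator, so that the two are related exactly and not only up to a
  phase.\<close>

definition five_V :: "complex ^ bool ^ (qubit5 \<Rightarrow> bool)" where
  "five_V = adj five_U ** enc5'"

lemma enc5'_eq: "enc5' = five_U ** five_V"
  by (simp add: five_V_def unitary_cancel[OF unitary_five_U])

lemma five_V_properties:
  "adj five_V ** five_V = mat 1" "(c, d) \<in> five_labels \<Longrightarrow> pauli_string c d ** five_V = five_V"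
  "pauli_string none5 all5 ** five_V = five_V ** pauli_Z" "pauli_string all5 none5 ** five_V = five_V ** pauli_X"
  and enc5'_isometry: "adj enc5' ** enc5' = mat 1"
proof -
  obtain v0 v1 where "logical_basis five_generators (tensor (\<lambda>_. pauli_X)) (tensor (\<lambda>_. pauli_Z)) v0 v1"
    using five_logical_basis by blast
  from logical_basis_conj[OF this unitary_five_U]
  have b: "logical_basis (five_conj ` five_generators) (five_conj (tensor (\<lambda>_. pauli_X))) (five_conj (tensor (\<lambda>_. pauli_Z)))
      (five_U *v v0) (five_U *v v1)"
    unfolding five_conj_def .
  have X2: "five_conj (tensor (\<lambda>_. pauli_X)) ** five_conj (tensor (\<lambda>_. pauli_X)) = mat 1"
    unfolding five_conj_def logical_five
    by (simp add: unitary_cancel[OF unitary_five_U] unitaryD[OF unitary_five_U] pauli_bits5_mult pauli_string_none5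
        parity_sign_bits5 matrix_mul_assoc[of "pauli_string _ _" "pauli_string _ _"] flip: matrix_mul_assoc)
  have uZ: "unitary (five_conj (tensor (\<lambda>_. pauli_Z)))"
    unfolding five_conj_def logical_five
    by (intro unitary_mult unitary_adj unitary_five_U unitary_pauli_string)
  note p = encoder_properties[OF b X2 uZ, folded enc5'_def]
  show "adj enc5' ** enc5' = mat 1" by (rule p(1))
  have c: "P ** five_V = adj five_U ** (five_conj P ** enc5')" for P
    by (simp add: five_V_def five_conj_def unitary_cancel[OF unitary_five_U] flip: matrix_mul_assoc)
  show "adj five_V ** five_V = mat 1"
    using p(1) by (simp add: five_V_def adj_mult unitary_cancel[OF unitary_five_U] flip: matrix_mul_assoc)
  show "pauli_string c d ** five_V = five_V" if "(c, d) \<in> five_labels"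
    using p(2) that unfolding c five_generators_labels by (force simp: five_V_def)
  show "pauli_string none5 all5 ** five_V = five_V ** pauli_Z" "pauli_string all5 none5 ** five_V = five_V ** pauli_X"
    using p(3,4) unfolding c logical_five by (simp_all add: five_V_def matrix_mul_assoc)
qed

subsection \<open>Distance\<close>

text \<open>Commutation with the generators gives the four equations \<open>e\<close> over F_2. For
  each pair of positions their only solution supported there is zero.\<close>

lemma five_detect:
  assumes supp: "\<And>r. r \<noteq> p \<Longrightarrow> r \<noteq> q \<Longrightarrow> \<not> a r \<and> \<not> b r"
    and comm: "\<And>c d. (c, d) \<in> five_labels \<Longrightarrow> parity_sign b c = parity_sign d a"
  shows "\<not> a r \<and> \<not> b r"
proof -
  have x: "((if P then - 1 else 1) * (if Q then - 1 else 1) = (if P' then - 1 else 1) * (if Q' then - 1 else (1 :: complex)))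
      \<longleftrightarrow> ((P \<noteq> Q) = (P' \<noteq> Q'))" for P Q P' Q'
    by auto
  have e: "(b Q1 \<noteq> b Q4) = (a Q2 \<noteq> a Q3)" "(b Q2 \<noteq> b Q5) = (a Q3 \<noteq> a Q4)"
    "(b Q1 \<noteq> b Q3) = (a Q4 \<noteq> a Q5)" "(b Q2 \<noteq> b Q4) = (a Q1 \<noteq> a Q5)"
    using comm[of "bits5 True False False True False" "bits5 False True True False False"]
      comm[of "bits5 False True False False True" "bits5 False False True True False"]
      comm[of "bits5 True False True False False" "bits5 False False False True True"]
      comm[of "bits5 False True False True False" "bits5 True False False False True"]
    by (simp_all only: five_labels_def insert_iff simp_thms parity_sign_bits5 bits5_simps if_False if_True mult_1_left mult_1_right x)
  have s: "r = p \<or> r = q \<or> \<not> a r \<and> \<not> b r" for r using supp by blast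
  have "\<not> a Q1 \<and> \<not> b Q1 \<and> \<not> a Q2 \<and> \<not> b Q2 \<and> \<not> a Q3 \<and> \<not> b Q3 \<and> \<not> a Q4 \<and> \<not> b Q4 \<and> \<not> a Q5 \<and> \<not> b Q5"
    using s[of Q1] s[of Q2] s[of Q3] s[of Q4] s[of Q5] e
    by (cases p; cases q; simp; blast)
  then show ?thesis by (cases r) simp_all
qed

lemma five_decoder:
  "\<exists>D :: (qubit5 \<Rightarrow> bool) \<times> (qubit5 \<Rightarrow> bool) + (qubit5 \<Rightarrow> bool) \<Rightarrow> complex ^ (qubit5 \<Rightarrow> bool) ^ bool.
    (\<Sum>s\<in>UNIV. adj (D s) ** D s) = mat 1 \<and> (\<forall>s q E. \<exists>e. D s ** (local_op q E ** enc5') = mat e)"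
  unfolding enc5'_eq five_U_tensor
  using five_detect by (intro distance_three_decoder[where S = five_labels] five_V_properties unitary_five_u) blast+

subsection \<open>Dimension\<close>

text \<open>A stabilizer relates the amplitudes at \<open>x\<close> and at \<open>x\<close> shifted
  by its X part, up to sign. The four X parts span the even-weight vectors, so vanishing spreads
  from \<open>none5\<close> to all even states; the logical Z removes the odd ones.\<close>

lemma five_unique:
  assumes st: "\<And>c d. (c, d) \<in> insert (none5, all5) five_labels \<Longrightarrow> pauli_string c d *v w = w"
    and zero: "w $ none5 = 0"
  shows "w = 0"
proof -
  define Z where "Z x1 x2 x3 x4 x5 \<longleftrightarrow> w $ bits5 x1 x2 x3 x4 x5 = 0" for x1 x2 x3 x4 x5
  have ps: "parity_sign x y \<noteq> 0" for x y :: "qubit5 \<Rightarrow> bool" using parity_sign_cases[of x y] by auto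
  have step: "w $ x = 0 \<longleftrightarrow> w $ (\<lambda>q. x q \<noteq> c q) = 0" if "(c, d) \<in> insert (none5, all5) five_labels" for c d x
    using pauli_string_apply[of c d w x] st[OF that] ps by simp
  have "Z x1 x2 x3 x4 True \<longleftrightarrow> Z x1 (\<not> x2) x3 x4 False" for x1 x2 x3 x4
    using step[of "bits5 False True False False True" "bits5 False False True True False" "bits5 x1 x2 x3 x4 True"]
    by (simp add: Z_def five_labels_def)
  moreover have "Z x1 x2 True x4 False \<longleftrightarrow> Z (\<not> x1) x2 False x4 False" for x1 x2 x4
    using step[of "bits5 True False True False False" "bits5 False False False True True" "bits5 x1 x2 True x4 False"]
    by (simp add: Z_def five_labels_def)
  moreover have "Z x1 x2 False True False \<longleftrightarrow> Z (\<not> x1) x2 False False False" for x1 x2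
    using step[of "bits5 True False False True False" "bits5 False True True False False" "bits5 x1 x2 False True False"]
    by (simp add: Z_def five_labels_def)
  moreover have "Z True True False False False \<longleftrightarrow> Z False False False False False"
    using step[of "bits5 False True False True False" "bits5 True False False False True" "bits5 True True False False False"]
      step[of "bits5 True False False True False" "bits5 False True True False False" "bits5 True False False True False"]
    by (simp add: Z_def five_labels_def none5_fun)
  moreover have "Z False False False False False"
    using zero by (simp add: Z_def)
  moreover have "Z True False False False False" "Z False True False False False"
    using st[of none5 all5] pauli_string_apply[of none5 all5 w "bits5 True False False False False"]
      pauli_string_apply[of none5 all5 w "bits5 False True False False False"]
    by (simp_all add: Z_def parity_sign_bits5)
  ultimately have "Z x1 x2 x3 x4 x5" for x1 x2 x3 x4 x5
    by (cases x1; cases x2; cases x3; cases x4; cases x5) simp_all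
  then have "w $ x = 0" for x
    using bits5_eta[of x] unfolding Z_def by metis
  then show ?thesis by (simp add: vec_eq_iff)
qed

text \<open>The code space has dimension two. A vector in it splits into its halves under the
  logical Z; the logical X moves the -1 half to the +1 eigenspace, where \<open>five_unique\<close>
  makes both halves multiples of \<open>v False\<close>.\<close>

lemma five_range:
  fixes W :: "complex ^ bool ^ (qubit5 \<Rightarrow> bool)"
  assumes st: "\<And>c d. (c, d) \<in> five_labels \<Longrightarrow> pauli_string c d ** W = W"
  shows "\<exists>B. W = five_V ** B"
proof -
  define v where "v b = five_V *v axis b 1" for b
  let ?X = "pauli_string all5 none5" and ?Z = "pauli_string none5 all5"
  have vst: "pauli_string c d *v v False = v False" if "(c, d) \<in> insert (none5, all5) five_labels" for c d
  proof (cases "(c, d) \<in> five_labels")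
    case True
    then show ?thesis by (simp add: v_def matrix_vector_mul_assoc five_V_properties(2))
  next
    case False
    then have "pauli_string c d *v v False = five_V *v (pauli_Z *v axis False 1)"
      using that five_V_properties(3) by (simp add: v_def matrix_vector_mul_assoc)
    also have "pauli_Z *v axis False 1 = axis False 1"
      by (simp add: vec_eq_iff mult_vec_nth UNIV_bool pauli_Z_def axis_def all_bool_eq)
    finally show ?thesis by (simp add: v_def)
  qed
  have vX: "?X *v v False = v True"
  proof -
    have "?X *v v False = five_V *v (pauli_X *v axis False 1)"
      using five_V_properties(4) by (simp add: v_def matrix_vector_mul_assoc)
    also have "pauli_X *v axis False 1 = axis True 1"
      by (simp add: vec_eq_iff mult_vec_nth UNIV_bool pauli_X_def axis_def all_bool_eq)
    finally show ?thesis by (simp add: v_def)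
  qed
  have v0: "v False $ none5 \<noteq> 0"
  proof
    assume "v False $ none5 = 0"
    then have "v False = 0" by (intro five_unique vst)
    then have "adj five_V *v v False = 0" by simp
    then have "axis False (1 :: complex) = 0"
      by (simp add: v_def matrix_vector_mul_assoc five_V_properties(1))
    then show False by (metis axis_nth zero_index zero_neq_one)
  qed
  have unique: "u = (u $ none5 / v False $ none5) *s v False"
    if "\<And>c d. (c, d) \<in> insert (none5, all5) five_labels \<Longrightarrow> pauli_string c d *v u = u" for u
  proof -
    let ?c = "u $ none5 / v False $ none5"
    have "u - ?c *s v False = 0"
      using v0 by (intro five_unique)
        (simp_all only: matrix_vector_mult_diff_distrib vector_scalar_commute that vst, simp)
    then show ?thesis by simp
  qed
  have col: "\<exists>\<alpha> \<beta>. w = \<alpha> *s v False + \<beta> *s v True"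
    if w: "\<And>c d. (c, d) \<in> five_labels \<Longrightarrow> pauli_string c d *v w = w" for w
  proof -
    have XX: "?X *v (?X *v u) = u" "?Z *v (?Z *v u) = u" for u
      by (simp_all add: matrix_vector_mul_assoc pauli_string_mult pauli_string_0 parity_sign_bits5)
    have ZX: "?Z *v (?X *v u) = - (?X *v (?Z *v u))" for u
      unfolding matrix_vector_mul_assoc
      by (subst pauli_string_commute) (simp add: parity_sign_bits5 vec_eq_iff flip: matrix_vector_mul_assoc)
    have gX: "pauli_string c d *v (?X *v u) = ?X *v (pauli_string c d *v u)"
      and gZ: "pauli_string c d *v (?Z *v u) = ?Z *v (pauli_string c d *v u)" if "(c, d) \<in> five_labels" for c d u
    proof -
      have "parity_sign d all5 * parity_sign none5 c = 1" "parity_sign d none5 * parity_sign all5 c = 1"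
        using that by (auto simp: five_labels_def parity_sign_bits5)
      then show "pauli_string c d *v (?X *v u) = ?X *v (pauli_string c d *v u)"
        "pauli_string c d *v (?Z *v u) = ?Z *v (pauli_string c d *v u)"
        unfolding matrix_vector_mul_assoc pauli_string_commute[of c d] by simp_all
    qed
    define p where "p = w + ?Z *v w"
    define m where "m = ?X *v (w - ?Z *v w)"
    have pm: "pauli_string c d *v p = p" "pauli_string c d *v m = m" if "(c, d) \<in> five_labels" for c d
      using w[OF that] gX[OF that] gZ[OF that]
      by (simp_all add: p_def m_def matrix_vector_right_distrib matrix_vector_mult_diff_distrib)
    have Zpm: "?Z *v p = p" "?Z *v m = m"
      by (simp_all add: p_def m_def matrix_vector_right_distrib matrix_vector_mult_diff_distrib XX ZX add.commute)
    have "p = (p $ none5 / v False $ none5) *s v False" "m = (m $ none5 / v False $ none5) *s v False"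
      using pm Zpm by (intro unique; blast)+
    then obtain \<alpha> \<beta> where "p = \<alpha> *s v False" "m = \<beta> *s v False" by blast
    then have h: "w + ?Z *v w = \<alpha> *s v False" "w - ?Z *v w = \<beta> *s v True"
      using XX(1)[of "w - ?Z *v w"] by (simp_all add: p_def m_def vector_scalar_commute vX)
    have "w = (\<alpha> / 2) *s v False + (\<beta> / 2) *s v True"
      unfolding vec_eq_iff
    proof
      fix x
      have "w $ x + w $ x = (w + ?Z *v w) $ x + (w - ?Z *v w) $ x" by simp
      then show "w $ x = ((\<alpha> / 2) *s v False + (\<beta> / 2) *s v True) $ x"
        unfolding h by (simp add: field_simps)
    qed
    then show ?thesis by blast
  qed
  have "\<exists>\<alpha> \<beta>. W *v axis j 1 = \<alpha> *s v False + \<beta> *s v True" for j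
    by (intro col) (simp add: matrix_vector_mul_assoc st)
  then obtain \<alpha> \<beta> where ab: "\<And>j. W *v axis j 1 = \<alpha> j *s v False + \<beta> j *s v True" by metis
  have nth: "(A *v axis j 1) $ x = A $ x $ j" for A :: "complex ^ bool ^ (qubit5 \<Rightarrow> bool)" and j x
    by (simp add: mult_vec_nth axis_def if_mult_sum)
  have "W = five_V ** (\<chi> i j. if i then \<beta> j else \<alpha> j)"
  proof (rule matrix_ext)
    fix x j
    have "W $ x $ j = (W *v axis j 1) $ x" by (simp add: nth)
    then show "W $ x $ j = (five_V ** (\<chi> i j. if i then \<beta> j else \<alpha> j)) $ x $ j"
      unfolding ab v_def by (simp add: nth bool_mult_nth mult.commute)
  qed
  then show ?thesis by blast
qed

subsection \<open>The transversal gate\<close>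

text \<open>Up to phases, moving a Pauli operator past \<open>K\<close> permutes the axes
  cyclically: X to Y, Y to Z, Z to X.\<close>

lemma pauli_xz_gate_K:
  "pauli_xz a b ** gate_K = mat (if a then (if b then - \<i> else \<i>) else 1) ** (gate_K ** pauli_xz (a \<noteq> b) a)"
  by (cases a; cases b) (simp_all add: bool_op_eq_iff bool_mult_nth pauli_xz_def gate_K_mat2 mat_nth)

lemma pauli_string_gate_K:
  "pauli_string a b ** tensor (\<lambda>_. gate_K) =
     mat (\<Prod>q\<in>UNIV. if a q then (if b q then - \<i> else \<i>) else 1) **
       (tensor (\<lambda>_. gate_K) ** pauli_string (\<lambda>q. a q \<noteq> b q) a)"
  unfolding pauli_string_def tensor_mult pauli_xz_gate_K tensor_smult ..

text \<open>The cyclic relabelling of the axes maps the stabilizer group to itself, so the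
  transversal gate preserves the code space and induces some logical \<open>B\<close>. The way
  \<open>B\<close> intertwines the logical X and Z determines it up to a scalar, and isometry makes
  this scalar a phase.\<close>

lemma five_V_gate_K: "\<exists>c. cmod c = 1 \<and> tensor (\<lambda>_. gate_K) ** five_V = mat c ** (five_V ** gate_K)"
proof -
  let ?K = "tensor (\<lambda>_. gate_K) :: (qubit5 \<Rightarrow> bool) op"
  let ?X = "pauli_string all5 none5" and ?Z = "pauli_string none5 all5"
  note V = five_V_properties
  have g: "(bits5 True False False True False, bits5 False True True False False) \<in> five_labels"
    "(bits5 False True False False True, bits5 False False True True False) \<in> five_labels"
    "(bits5 True False True False False, bits5 False False False True True) \<in> five_labels"
    "(bits5 False True False True False, bits5 True False False False True) \<in> five_labels"
    by (simp_all add: five_labels_def)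
  have "pauli_string c d ** (?K ** five_V) = ?K ** five_V" if "(c, d) \<in> five_labels" for c d
  proof -
    have st: "mat (- 1) ** (pauli_string (\<lambda>q. c q \<noteq> d q) c ** five_V) = five_V"
    proof -
      have two: "mat (parity_sign b c) ** (pauli_string (\<lambda>q. a q \<noteq> c q) (\<lambda>q. b q \<noteq> d q) ** five_V) = five_V"
        if "(a, b) \<in> five_labels" "(c, d) \<in> five_labels" for a b c d
        using V(2)[OF that(1)] V(2)[OF that(2)]
        unfolding matrix_mul_assoc pauli_string_mult[symmetric] by (simp flip: matrix_mul_assoc)
      have three: "mat (parity_sign b c * parity_sign f (\<lambda>q. a q \<noteq> c q)) **
          (pauli_string (\<lambda>q. e q \<noteq> (a q \<noteq> c q)) (\<lambda>q. f q \<noteq> (b q \<noteq> d q)) ** five_V) = five_V"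
        if "(a, b) \<in> five_labels" "(c, d) \<in> five_labels" "(e, f) \<in> five_labels" for a b c d e f
      proof -
        have "five_V = pauli_string e f ** (mat (parity_sign b c) ** (pauli_string (\<lambda>q. a q \<noteq> c q) (\<lambda>q. b q \<noteq> d q) ** five_V))"
          unfolding two[OF that(1,2)] using V(2)[OF that(3)] by simp
        also have "\<dots> = mat (parity_sign b c) ** ((pauli_string e f ** pauli_string (\<lambda>q. a q \<noteq> c q) (\<lambda>q. b q \<noteq> d q)) ** five_V)"
          unfolding pauli_string_smult by (simp only: matrix_mul_assoc)
        finally show ?thesis
          unfolding pauli_string_mult by (simp only: matrix_mul_assoc mat_mult_mat)
      qed
      \<comment> \<open>The digits name the generators that are multiplied. The relabelled
        generators 1, 2, 3, 4 are the products 34, 123, 342 and 12; the common sign cancels the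
        phase \<open>ph\<close>.\<close>
      have 34: "mat (- 1) ** (pauli_string (bits5 True True True True False) (bits5 True False False True False) ** five_V) = five_V"
        using two[OF g(3,4)] by (simp add: parity_sign_bits5)
      have 12: "mat (- 1) ** (pauli_string (bits5 True True False True True) (bits5 False True False True False) ** five_V) = five_V"
        using two[OF g(1,2)] by (simp add: parity_sign_bits5)
      have 123: "mat (- 1) ** (pauli_string (bits5 False True True True True) (bits5 False True False False True) ** five_V) = five_V"
        using three[OF g(1,2,3)] by (simp add: parity_sign_bits5 bits5_xor3)
      have 342: "mat (- 1) ** (pauli_string (bits5 True False True True True) (bits5 True False True False False) ** five_V) = five_V"
        using three[OF g(3,4,2)] by (simp add: parity_sign_bits5 bits5_xor3)
      show ?thesis
        using that 34 12 123 342 by (auto simp: five_labels_def)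
    qed
    have ph: "(\<Prod>q\<in>UNIV. if c q then (if d q then - \<i> else \<i>) else 1) = - 1"
      using that unfolding five_labels_def by (elim insertE emptyE Pair_inject) (simp_all add: prod_qubit5)
    have "pauli_string c d ** (?K ** five_V) = (pauli_string c d ** ?K) ** five_V"
      by (simp only: matrix_mul_assoc)
    also have "\<dots> = mat (- 1) ** (?K ** (pauli_string (\<lambda>q. c q \<noteq> d q) c ** five_V))"
      unfolding pauli_string_gate_K ph by (simp only: matrix_mul_assoc)
    also have "\<dots> = ?K ** (mat (- 1) ** (pauli_string (\<lambda>q. c q \<noteq> d q) c ** five_V))"
      by (rule mult_mat_left[symmetric])
    finally show ?thesis unfolding st .
  qed
  then obtain B where B: "?K ** five_V = five_V ** B" using five_range by blast
  have canc: "A = A'" if "five_V ** A = five_V ** A'" for A A' :: "bool op"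
  proof -
    have "M = adj five_V ** (five_V ** M)" for M :: "bool op" by (simp add: matrix_mul_assoc V(1))
    then show ?thesis using that by metis
  qed
  have ZX: "pauli_Z ** B = B ** pauli_X"
  proof (rule canc)
    have "five_V ** (pauli_Z ** B) = ?Z ** (?K ** five_V)" by (simp add: B V(3) matrix_mul_assoc)
    also have "\<dots> = ?K ** (?X ** five_V)"
      by (simp add: pauli_string_gate_K prod_qubit5 matrix_mul_assoc)
    also have "\<dots> = five_V ** (B ** pauli_X)" by (simp add: V(4) B matrix_mul_assoc)
    finally show "five_V ** (pauli_Z ** B) = five_V ** (B ** pauli_X)" .
  qed
  \<comment> \<open>Five factors \<open>\<i>\<close> multiply to \<open>\<i>\<close>, so the encoded
    relation carries the same phase as the relation for a single \<open>K\<close>.\<close>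
  have XB: "pauli_X ** B = mat \<i> ** (B ** (pauli_X ** pauli_Z))"
  proof (rule canc)
    have XZ: "?X ** ?Z = pauli_string all5 all5" by (simp add: pauli_bits5_mult parity_sign_bits5)
    have "five_V ** (pauli_X ** B) = ?X ** ?K ** five_V"
      by (simp add: B V(4) matrix_mul_assoc[symmetric]) (simp add: V(4) matrix_mul_assoc)
    also have "\<dots> = mat \<i> ** (?K ** (?X ** (?Z ** five_V)))"
      by (simp add: pauli_string_gate_K prod_qubit5 matrix_mul_assoc XZ[symmetric])
    also have "?Z ** five_V = five_V ** pauli_Z" by (rule V(3))
    also have "?X ** (five_V ** pauli_Z) = five_V ** (pauli_X ** pauli_Z)" by (simp add: V(4) matrix_mul_assoc)
    also have "?K ** (five_V ** (pauli_X ** pauli_Z)) = five_V ** (B ** (pauli_X ** pauli_Z))"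
      by (simp add: B matrix_mul_assoc)
    finally show "five_V ** (pauli_X ** B) = five_V ** (mat \<i> ** (B ** (pauli_X ** pauli_Z)))"
      by (simp add: mult_mat_left)
  qed
  have FT: "B $ False $ True = B $ False $ False"
    using arg_cong[OF ZX, of "\<lambda>M. M $ False $ False"] by (simp add: bool_mult_nth pauli_X_def pauli_Z_def)
  have TF: "B $ True $ False = \<i> * B $ False $ False"
    using arg_cong[OF XB, of "\<lambda>M. M $ False $ False"] FT by (simp add: bool_mult_nth pauli_X_def pauli_Z_def mat_nth)
  have TT: "B $ True $ True = - (\<i> * B $ False $ False)"
    using arg_cong[OF ZX, of "\<lambda>M. M $ True $ False"] TF by (simp add: bool_mult_nth pauli_X_def pauli_Z_def)
  have "B = mat (B $ False $ False * sqrt 2) ** gate_K"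
    by (subst bool_op_eq_iff) (simp add: gate_K_mat2 FT TF TT)
  then obtain c where c: "B = mat c ** gate_K" by blast
  have "adj (?K ** five_V) ** (?K ** five_V) = mat 1"
    using unitary_tensor[of "\<lambda>_ :: qubit5. gate_K", OF unitary_gate_K]
    by (simp add: adj_mult unitary_cancel V(1) flip: matrix_mul_assoc)
  then have "adj B ** B = mat 1"
  proof -
    have "adj (five_V ** B) ** (five_V ** B) = adj B ** (adj five_V ** five_V) ** B"
      by (simp add: adj_mult matrix_mul_assoc)
    then show ?thesis using \<open>adj (?K ** five_V) ** (?K ** five_V) = mat 1\<close> by (simp add: B V(1))
  qed
  moreover have "adj B ** B = adj gate_K ** (mat (cnj c * c) ** gate_K)"
    unfolding c by (simp add: adj_mult flip: matrix_mul_assoc)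
  ultimately have "mat (cnj c * c) = (mat 1 :: bool op)"
    unfolding mult_mat_left by (simp add: unitaryD[OF unitary_gate_K])
  then have "cnj c * c = 1" by (simp add: mat_mat2)
  then have "complex_of_real ((cmod c)\<^sup>2) = 1" unfolding complex_norm_square by (simp add: mult.commute)
  then have "(cmod c)\<^sup>2 = 1" by (simp only: of_real_eq_1_iff)
  then have "cmod c = 1" using norm_ge_zero[of c] by (auto simp: power2_eq_1_iff)
  then show ?thesis using B c by (auto simp: mult_mat_left)
qed

definition five_K :: "qubit5 \<Rightarrow> bool op" where
  "five_K q = five_u q ** gate_K ** adj (five_u q)"

lemma unitary_five_K: "unitary (five_K q)"
  unfolding five_K_def by (intro unitary_mult unitary_adj unitary_five_u unitary_gate_K)

lemma enc5'_gate_K: "\<exists>c. cmod c = 1 \<and> tensor five_K ** enc5' = mat c ** (enc5' ** gate_K)"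
proof -
  obtain c where c: "cmod c = 1" "tensor (\<lambda>_. gate_K) ** five_V = mat c ** (five_V ** gate_K)"
    using five_V_gate_K by blast
  have "tensor five_K ** five_U = five_U ** tensor (\<lambda>_. gate_K)"
    by (simp add: five_U_tensor tensor_mult five_K_def unitaryD[OF unitary_five_u] flip: matrix_mul_assoc)
  then have "tensor five_K ** enc5' = five_U ** (tensor (\<lambda>_. gate_K) ** five_V)"
    by (simp add: enc5'_eq matrix_mul_assoc)
  also have "\<dots> = mat c ** (enc5' ** gate_K)"
    unfolding c(2) mult_mat_left enc5'_eq by (simp add: matrix_mul_assoc)
  finally show ?thesis using c(1) by blast
qed

text \<open>
  Multiplied by a stabilizer, the logical \<open>Z\<close> of the five-qubit code becomes \<open>- X\<^sub>1 Z\<^sub>3 X\<^sub>5\<close>,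
  which the local unitary turns into \<open>Z\<^sub>1 Z\<^sub>3 Z\<^sub>5\<close>.
\<close>

lemma enc5'_support:
  assumes "enc5' $ x $ b \<noteq> 0"
  shows "((x Q1 \<noteq> x Q3) \<noteq> x Q5) = b"
proof -
  let ?P = "pauli_string (bits5 True False False False True) (bits5 False False True False False)"
  let ?R = "pauli_string none5 (bits5 True False True False True)"
  let ?Z = "pauli_string none5 all5"
  \<comment> \<open>The stabilizer is the product of the first, second and fourth
    generators.\<close>
  have "?Z ** (pauli_string (bits5 True False False True False) (bits5 False True True False False) **
      (pauli_string (bits5 False True False False True) (bits5 False False True True False) **
       (pauli_string (bits5 False True False True False) (bits5 True False False False True) ** five_V))) = five_V ** pauli_Z"
    by (simp add: five_V_properties five_labels_def)
  then have P: "mat (- 1) ** (?P ** five_V) = five_V ** pauli_Z"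
    by (simp add: matrix_mul_assoc[of "pauli_string _ _" "pauli_string _ _"] pauli_bits5_mult parity_sign_bits5
        pauli_string_smult flip: matrix_mul_assoc)
  have "five_U ** ?P = mat (- 1) ** (?R ** five_U)"
  proof -
    \<comment> \<open>At qubit 3 the Pauli Y anticommutes with Z; this sign cancels the one in
      \<open>P\<close>. On qubits 1 and 5 the gate \<open>K\<close> turns X into Z.\<close>
    have t: "five_u q ** pauli_xz (bits5 True False False False True q) (bits5 False False True False False q) =
        mat (if q = Q3 then - 1 else 1) ** (pauli_xz False (bits5 True False True False True q) ** five_u q)" for q
      by (cases q) (simp_all add: five_u_def pauli_xz_simps bool_op_eq_iff bool_mult_nth gate_K_mat2 pauli_X_def
          pauli_Z_def pauli_Y_def mat_nth)
    show ?thesis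
      unfolding five_U_tensor pauli_string_def tensor_mult t tensor_smult by (simp add: prod_qubit5 none5_eq)
  qed
  then have "?R ** enc5' = mat (- 1) ** (five_U ** (?P ** five_V))"
    by (simp add: enc5'_eq matrix_mul_assoc)
  also have "\<dots> = five_U ** (mat (- 1) ** (?P ** five_V))" by (simp only: mult_mat_left)
  also have "\<dots> = enc5' ** pauli_Z" unfolding P by (simp add: enc5'_eq matrix_mul_assoc)
  finally have "(?R ** enc5') $ x $ b = (enc5' ** pauli_Z) $ x $ b" by simp
  moreover have "(?R ** enc5') $ x $ b = parity_sign (bits5 True False True False True) x * enc5' $ x $ b"
    using pauli_string_apply[of none5 "bits5 True False True False True" "enc5' *v axis b 1" x]
    by (simp add: matrix_vector_mul_assoc) (simp add: mult_vec_nth axis_def if_mult_sum none5_eq)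
  ultimately show ?thesis
    using assms by (cases b) (auto simp: bool_mult_nth pauli_Z_def parity_sign_bits5 split: if_splits)
qed

section \<open>The Reed-Muller code\<close>

subsection \<open>Affine functions\<close>

definition dot4 :: "bit ^ 4 \<Rightarrow> bit ^ 4 \<Rightarrow> bit" where
  "dot4 l v = (\<Sum>i\<in>UNIV. l $ i * v $ i)"

text \<open>The affine function takes the value \<open>a\<close> at the deleted point 0, which is
  why \<open>a\<close> is the logical bit.\<close>

definition codeword :: "bit ^ 4 \<Rightarrow> bool \<Rightarrow> qubit15 \<Rightarrow> bool" where
  "codeword l a q \<longleftrightarrow> (dot4 l (vec_of q) = 1) \<noteq> a"

lemma bit_add_self [simp]: "x + x = (0 :: bit)"
  by (cases x) simp_all

lemma bit_vec_add_self: "v + v = (0 :: bit ^ 'n::finite)"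
  by (simp add: vec_eq_iff)

lemma bit_vec_add_self_left: "v + (v + w) = (w :: bit ^ 'n::finite)"
  by (simp add: bit_vec_add_self flip: add.assoc)

lemma bit_add_eq_1: "x + y = (1 :: bit) \<longleftrightarrow> (x = 1) \<noteq> (y = 1)"
  by (cases x; cases y) simp_all

lemma bit_eqI: "(x = 1) = (y = 1) \<Longrightarrow> x = (y :: bit)"
  by (cases x; cases y) simp_all

lemma dot4_add_right: "dot4 l (v + w) = dot4 l v + dot4 l w"
  unfolding dot4_def vector_add_component distrib_left sum.distrib ..

lemma dot4_add_left: "dot4 (l + m) v = dot4 l v + dot4 m v"
  unfolding dot4_def vector_add_component distrib_right sum.distrib ..

lemma dot4_0 [simp]: "dot4 0 v = 0" "dot4 l 0 = 0"
  by (simp_all add: dot4_def)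

lemma dot4_axis: "dot4 (axis i 1) v = v $ i" "dot4 l (axis i 1) = l $ i"
proof -
  have "dot4 (axis i 1) v = (\<Sum>j\<in>UNIV. if j = i then v $ j else 0)"
    unfolding dot4_def axis_def by (intro sum.cong) auto
  then show "dot4 (axis i 1) v = v $ i" by simp
  have "dot4 l (axis i 1) = (\<Sum>j\<in>UNIV. if j = i then l $ j else 0)"
    unfolding dot4_def axis_def by (intro sum.cong) auto
  then show "dot4 l (axis i 1) = l $ i" by simp
qed

lemma card_bit: "CARD(bit) = 2"
proof -
  have "(UNIV :: bit set) = {0, 1}"
    by (auto intro: bit.exhaust)
  then have "CARD(bit) = card {0 :: bit, 1}" by (rule arg_cong)
  then show ?thesis by (simp only: card_insert_if finite.intros card.empty) simp
qed

lemma card_bit_vec: "card (UNIV :: (bit ^ 4) set) = 16"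
  by (simp add: card_bit)

lemma prod_qubit15: "(\<Prod>q\<in>UNIV. f (vec_of q)) = (\<Prod>v\<in>UNIV - {0}. f v)"
  by (rule prod.reindex_bij_witness[of _ Abs_qubit15 vec_of])
     (use vec_of in \<open>auto simp: vec_of_inverse Abs_qubit15_inverse\<close>)

text \<open>
  Three linear forms on \<open>F\<^sub>2\<^sup>4\<close> have a common nonzero zero \<open>w\<close>, and the translation by \<open>w\<close>
  pairs off the points at which the product of three affine functions does not vanish.
\<close>

lemma common_zero:
  obtains w where "w \<noteq> 0" "dot4 l1 w = 0" "dot4 l2 w = 0" "dot4 l3 w = 0"
proof -
  \<comment> \<open>Pigeonhole: 16 vectors but only 8 triples of values, and the sum of two vectors
    with equal values is a common zero.\<close>
  let ?f = "\<lambda>v. (dot4 l1 v = 1, dot4 l2 v = 1, dot4 l3 v = 1)"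
  have "\<not> inj ?f"
  proof
    assume "inj ?f"
    then have "card (UNIV :: (bit ^ 4) set) \<le> card (UNIV :: (bool \<times> bool \<times> bool) set)"
      by (rule card_inj_on_le) auto
    then show False by (simp add: card_bit card_UNIV_bool flip: UNIV_Times_UNIV)
  qed
  then obtain v v' where v: "v \<noteq> v'" "?f v = ?f v'" by (auto simp: inj_def)
  show thesis
  proof (rule that[of "v + v'"])
    show "v + v' \<noteq> 0"
    proof
      assume "v + v' = 0"
      then have "v + (v + v') = v" by simp
      then show False using v(1) by (simp add: bit_vec_add_self_left)
    qed
    have "dot4 l1 v = dot4 l1 v'" "dot4 l2 v = dot4 l2 v'" "dot4 l3 v = dot4 l3 v'"
      using v(2) by (auto intro: bit_eqI)
    then show "dot4 l1 (v + v') = 0" "dot4 l2 (v + v') = 0" "dot4 l3 (v + v') = 0"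
      by (simp_all only: dot4_add_right bit_add_self)
  qed
qed

text \<open>Over all 16 points the product is 1. Over the 15 qubits it is therefore the inverse of
  the factor at the point 0, a sign that depends on the logical bits alone.\<close>

lemma prod_codewords_3:
  "(\<Prod>q\<in>UNIV. if codeword l1 a1 q \<and> codeword l2 a2 q \<and> codeword l3 a3 q then - 1 else 1 :: complex) =
     (if a1 \<and> a2 \<and> a3 then - 1 else 1)"
proof -
  define g :: "bit ^ 4 \<Rightarrow> complex" where
    "g v = (if (dot4 l1 v = 1) \<noteq> a1 \<and> (dot4 l2 v = 1) \<noteq> a2 \<and> (dot4 l3 v = 1) \<noteq> a3 then - 1 else 1)" for v
  obtain w where w: "w \<noteq> 0" "dot4 l1 w = 0" "dot4 l2 w = 0" "dot4 l3 w = 0"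
    by (rule common_zero)
  then obtain i where i: "w $ i = 1" by (auto simp: vec_eq_iff)
  have shift: "g (v + w) = g v" for v
    by (simp add: g_def dot4_add_right w)
  have "(\<Prod>v\<in>{v. v $ i = 1}. g v) = (\<Prod>v\<in>{v. v $ i \<noteq> 1}. g v)"
    by (rule prod.reindex_bij_witness[of _ "\<lambda>v. v + w" "\<lambda>v. v + w"])
       (auto simp: shift add.assoc bit_vec_add_self bit_add_eq_1 i)
  moreover have "(\<Prod>v\<in>UNIV. g v) = (\<Prod>v\<in>{v. v $ i = 1}. g v) * (\<Prod>v\<in>{v. v $ i \<noteq> 1}. g v)"
    by (subst prod.union_disjoint[symmetric]) (auto intro!: prod.cong)
  moreover have gg: "g v * g v = 1" for v by (simp add: g_def)
  ultimately have "(\<Prod>v\<in>UNIV. g v) = 1"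
    by (simp flip: prod.distrib)
  then have "g 0 * (\<Prod>v\<in>UNIV - {0}. g v) = 1"
    by (simp add: prod.remove[of UNIV 0])
  then have "g 0 * (\<Prod>q\<in>UNIV. g (vec_of q)) = 1"
    by (simp only: prod_qubit15)
  then have "(\<Prod>q\<in>UNIV. g (vec_of q)) = g 0"
    using gg[of 0] by (metis mult.assoc mult.right_neutral mult_1_left)
  moreover have "g 0 = (if a1 \<and> a2 \<and> a3 then - 1 else 1)" by (simp add: g_def)
  ultimately show ?thesis by (simp only: g_def codeword_def)
qed

text \<open>For nonzero \<open>l\<close>, translation by a unit vector at which \<open>l\<close> is
  1 exchanges the zeros and the ones of the linear form, so there are 8 ones among 16 points; the
  point 0 is not one of them.\<close>

lemma card_codeword: "card {q. dot4 l (vec_of q) = 1} = (if l = 0 then 0 else 8)"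
proof (cases "l = 0")
  case False
  then obtain i where i: "l $ i = 1" by (auto simp: vec_eq_iff)
  let ?u = "axis i 1 :: bit ^ 4"
  have u: "dot4 l ?u = 1" by (simp add: dot4_axis i)
  have "card {v. dot4 l v = 1} = card {v. dot4 l v \<noteq> 1}"
    by (rule bij_betw_same_card[of "\<lambda>v. v + ?u"], rule bij_betw_byWitness[of _ "\<lambda>v. v + ?u"])
       (auto simp: add.assoc bit_vec_add_self dot4_add_right bit_add_eq_1 u)
  moreover have "card (UNIV :: (bit ^ 4) set) = card {v. dot4 l v = 1} + card {v. dot4 l v \<noteq> 1}"
  proof -
    have "(UNIV :: (bit ^ 4) set) = {v. dot4 l v = 1} \<union> {v. dot4 l v \<noteq> 1}" by blast
    moreover have "{v. dot4 l v = 1} \<inter> {v. dot4 l v \<noteq> 1} = {}" by blast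
    ultimately show ?thesis by (metis card_Un_disjoint finite)
  qed
  ultimately have "card {v. dot4 l v = 1} = 8" using card_bit_vec by simp
  moreover have "vec_of (Abs_qubit15 v) = v" if "dot4 l v = 1" for v
    using that by (intro Abs_qubit15_inverse) auto
  then have "card {q. dot4 l (vec_of q) = 1} = card {v. dot4 l v = 1}"
    by (intro bij_betw_same_card[of vec_of] bij_betw_byWitness[of _ Abs_qubit15]) (auto simp: vec_of_inverse)
  ultimately show ?thesis using False by simp
qed simp

lemma card_qubit15: "card (UNIV :: qubit15 set) = 15"
proof -
  have "card (UNIV :: qubit15 set) = card (UNIV - {0 :: bit ^ 4})"
    by (rule bij_betw_same_card[of vec_of], rule bij_betw_byWitness[of _ Abs_qubit15])
       (use vec_of in \<open>auto simp: vec_of_inverse Abs_qubit15_inverse\<close>)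
  then show ?thesis by (simp add: card_Diff_singleton card_bit)
qed

text \<open>The weights are 0 or 8 for logical bit 0 and 7 or 15 for logical bit 1, so they are
  determined modulo 8.\<close>

lemma prod_codeword_phase:
  assumes "z ^ 8 = (1 :: complex)"
  shows "(\<Prod>q\<in>UNIV. if codeword l a q then z else 1) = (if a then z ^ 7 else 1)"
proof -
  have P: "(\<Prod>q\<in>UNIV. if codeword l a q then z else 1) = z ^ card {q. codeword l a q}"
    by (simp add: prod.If_cases)
  show ?thesis
  proof (cases a)
    case False
    then have "card {q. codeword l a q} = (if l = 0 then 0 else 8)"
      by (simp add: codeword_def card_codeword)
    then show ?thesis unfolding P using False assms by simp
  next
    case True
    have "{q. codeword l a q} = UNIV - {q. dot4 l (vec_of q) = 1}"
      using True by (auto simp: codeword_def)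
    then have "card {q. codeword l a q} = 15 - (if l = 0 then 0 else 8)"
      by (simp add: card_Diff_subset card_qubit15 card_codeword)
    moreover have "z ^ 15 = z ^ 8 * z ^ 7" by (simp flip: power_add)
    ultimately show ?thesis unfolding P using True assms by simp
  qed
qed

lemma codeword_xor: "(codeword l a q \<noteq> codeword m b q) = codeword (l + m) (a \<noteq> b) q"
  by (auto simp: codeword_def dot4_add_left bit_add_eq_1)

subsection \<open>The logical basis\<close>

lemma vec_of_axis: "vec_of (Abs_qubit15 (axis i 1)) = axis i 1"
  by (rule Abs_qubit15_inverse) (simp add: axis_eq_0_iff)

lemma codeword_inj: "codeword l a = codeword m a \<Longrightarrow> l = m"
proof -
  assume "codeword l a = codeword m a"
  then have "codeword l a (Abs_qubit15 (axis i 1)) = codeword m a (Abs_qubit15 (axis i 1))" for i by simp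
  then have "l $ i = 1 \<longleftrightarrow> m $ i = 1" for i by (auto simp: codeword_def vec_of_axis dot4_axis)
  then show ?thesis by (simp add: vec_eq_iff bit_eqI)
qed

abbreviation rm_coord :: "4 \<Rightarrow> qubit15 \<Rightarrow> bool" where
  "rm_coord i \<equiv> codeword (axis i 1) False"

lemma rm_coord_iff: "rm_coord i q \<longleftrightarrow> vec_of q $ i = 1"
  by (simp add: codeword_def dot4_axis)

lemma codeword_0: "codeword 0 a q = a"
  by (simp add: codeword_def)

lemma tensor_on_pauli:
  "tensor_on {q. P q} pauli_X = pauli_string P (\<lambda>_. False)" "tensor_on {q. P q} pauli_Z = pauli_string (\<lambda>_. False) P"
  unfolding tensor_on_def pauli_string_def
  by (rule arg_cong[of _ _ tensor], auto simp: pauli_xz_simps)+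

lemma rm_generators_eq:
  "rm_generators = range (\<lambda>i. pauli_string (rm_coord i) (\<lambda>_. False)) \<union> range (\<lambda>i. pauli_string (\<lambda>_. False) (rm_coord i)) \<union>
     {pauli_string (\<lambda>_. False) (\<lambda>q. rm_coord i q \<and> rm_coord j q) | i j. i \<noteq> j}"
  unfolding rm_generators_def rm_coord_iff[symmetric] tensor_on_pauli by auto

lemma logical_rm:
  "tensor (\<lambda>_. pauli_X) = pauli_string (\<lambda>_. True) (\<lambda>_. False)"
  "tensor (\<lambda>_. pauli_Z) = pauli_string (\<lambda>_. False) (\<lambda>_. True)"
  by (simp_all add: pauli_string_def pauli_xz_simps)

text \<open>Instances of the three-fold product; \<open>codeword 0 True\<close>, the constant 1,
  fills the spare factors.\<close>

lemma parity_sign_codewords: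
  "parity_sign (rm_coord i) (codeword l a) = 1"
  "parity_sign (\<lambda>q. rm_coord i q \<and> rm_coord j q) (codeword l a) = 1"
  "parity_sign (\<lambda>_. True) (codeword l a) = (if a then - 1 else 1)"
  using prod_codewords_3[of "axis i 1" False 0 True l a] prod_codewords_3[of "axis i 1" False "axis j 1" False l a]
    prod_codewords_3[of 0 True 0 True l a]
  by (simp_all add: parity_sign_def codeword_0 conj_assoc cong: if_cong)

text \<open>The normalized uniform superposition of the 16 codewords with logical bit
  \<open>a\<close>.\<close>

definition rm_vector :: "bool \<Rightarrow> (qubit15 \<Rightarrow> bool) state" where
  "rm_vector a = (\<chi> x. if x \<in> range (\<lambda>l. codeword l a) then 1 / 4 else 0)"

lemma rm_vector_shift: "rm_vector a $ (\<lambda>q. x q \<noteq> codeword m b q) = rm_vector (a \<noteq> b) $ x"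
proof -
  have "(\<lambda>q. x q \<noteq> codeword m b q) \<in> range (\<lambda>l. codeword l a) \<longleftrightarrow> x \<in> range (\<lambda>l. codeword l (a \<noteq> b))"
  proof
    assume "(\<lambda>q. x q \<noteq> codeword m b q) \<in> range (\<lambda>l. codeword l a)"
    then obtain l where l: "\<And>q. (x q \<noteq> codeword m b q) = codeword l a q" by (auto simp: fun_eq_iff)
    have "x q = codeword (l + m) (a \<noteq> b) q" for q
      using l[of q] codeword_xor[of l a q m b] by auto
    then show "x \<in> range (\<lambda>l. codeword l (a \<noteq> b))" by auto
  next
    assume "x \<in> range (\<lambda>l. codeword l (a \<noteq> b))"
    then obtain l where l: "\<And>q. x q = codeword l (a \<noteq> b) q" by auto
    have "(x q \<noteq> codeword m b q) = codeword (l + m) a q" for q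
      using l[of q] codeword_xor[of l "a \<noteq> b" q m b] by (cases b) auto
    then show "(\<lambda>q. x q \<noteq> codeword m b q) \<in> range (\<lambda>l. codeword l a)" by auto
  qed
  then show ?thesis by (simp add: rm_vector_def)
qed

lemma rm_vector_sign: "parity_sign P x * rm_vector a $ x = s * rm_vector a $ x"
  if "\<And>l. parity_sign P (codeword l a) = s"
  using that by (auto simp: rm_vector_def)

lemma norm_rm_vector: "norm (rm_vector a) = 1"
proof -
  have "(norm (rm_vector a))\<^sup>2 = (\<Sum>x\<in>UNIV. (cmod (rm_vector a $ x))\<^sup>2)"
    by (simp add: norm_vec_def L2_set_def sum_nonneg)
  also have "\<dots> = (\<Sum>x\<in>range (\<lambda>l. codeword l a). 1 / 16)"
    by (rule sum.mono_neutral_cong_right) (auto simp: rm_vector_def power_divide)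
  also have "\<dots> = 1"
    using codeword_inj by (subst sum.reindex) (auto simp: inj_def card_bit)
  finally show ?thesis by (simp add: power2_eq_1_iff) (use norm_ge_zero[of "rm_vector a"] in linarith)
qed

lemma rm_logical_basis:
  "logical_basis rm_generators (tensor (\<lambda>_. pauli_X)) (tensor (\<lambda>_. pauli_Z)) (rm_vector False) (rm_vector True)"
proof -
  have X: "pauli_string (codeword m b) (\<lambda>_. False) *v rm_vector a = rm_vector (a \<noteq> b)" for a b m
    by (simp add: vec_eq_iff pauli_string_apply rm_vector_shift del: not_iff) (simp add: parity_sign_def)
  have Z: "pauli_string (\<lambda>_. False) P *v rm_vector a = s *s rm_vector a"
    if "\<And>l. parity_sign P (codeword l a) = s" for P a s
    using rm_vector_sign[OF that] by (simp add: vec_eq_iff pauli_string_apply)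
  have stab: "g *v rm_vector a = rm_vector a" if "g \<in> rm_generators" for g a
    using that unfolding rm_generators_eq
    using X[of "axis _ 1" False a] Z[of "rm_coord _" a 1] Z[of "\<lambda>q. rm_coord _ q \<and> rm_coord _ q" a 1] parity_sign_codewords
    by auto
  have "pauli_string (\<lambda>_. True) (\<lambda>_. False) *v rm_vector False = rm_vector True"
    using X[of 0 True False] by (simp add: codeword_0[abs_def])
  moreover have "pauli_string (\<lambda>_. False) (\<lambda>_. True) *v rm_vector False = rm_vector False"
    "pauli_string (\<lambda>_. False) (\<lambda>_. True) *v rm_vector True = - rm_vector True"
    using Z[of "\<lambda>_. True" False 1] Z[of "\<lambda>_. True" True "- 1"] parity_sign_codewords(3) by simp_all
  ultimately show ?thesis
    unfolding logical_basis_def stabilized_space_def logical_rm using stab norm_rm_vector by blast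
qed

lemma enc15_properties:
  "adj enc15 ** enc15 = mat 1" "g \<in> rm_generators \<Longrightarrow> g ** enc15 = enc15"
  "pauli_string (\<lambda>_. False) (\<lambda>_. True) ** enc15 = enc15 ** pauli_Z"
  "pauli_string (\<lambda>_. True) (\<lambda>_. False) ** enc15 = enc15 ** pauli_X"
proof -
  have "tensor (\<lambda>_. pauli_X) ** tensor (\<lambda>_. pauli_X) = (mat 1 :: (qubit15 \<Rightarrow> bool) op)"
    unfolding logical_rm by (simp add: pauli_string_mult pauli_string_0 parity_sign_def)
  moreover have "unitary (tensor (\<lambda>_. pauli_Z) :: (qubit15 \<Rightarrow> bool) op)"
    unfolding logical_rm by (rule unitary_pauli_string)
  ultimately show "adj enc15 ** enc15 = mat 1" "g \<in> rm_generators \<Longrightarrow> g ** enc15 = enc15"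
    "pauli_string (\<lambda>_. False) (\<lambda>_. True) ** enc15 = enc15 ** pauli_Z"
    "pauli_string (\<lambda>_. True) (\<lambda>_. False) ** enc15 = enc15 ** pauli_X"
    using encoder_properties[OF rm_logical_basis, folded enc15_def] unfolding logical_rm by blast+
qed

lemma pauli_string_mult_nth:
  "(pauli_string a b ** V) $ x $ j = parity_sign b (\<lambda>q. x q \<noteq> a q) * V $ (\<lambda>q. x q \<noteq> a q) $ j"
  for V :: "complex ^ 'm::finite ^ ('q::finite \<Rightarrow> bool)"
proof -
  have c: "(A *v axis j 1) $ x = A $ x $ j" for A :: "complex ^ 'm ^ ('q \<Rightarrow> bool)" and x
    by (simp add: mult_vec_nth axis_def if_mult_sum)
  show ?thesis
    using pauli_string_apply[of a b "V *v axis j 1" x] by (simp only: matrix_vector_mul_assoc c)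
qed

subsection \<open>Uniqueness of the logical basis\<close>

definition vec4 :: "bool \<Rightarrow> bool \<Rightarrow> bool \<Rightarrow> bool \<Rightarrow> bit ^ 4" where
  "vec4 a b c d = (\<chi> i. if i = 1 then of_bool a else if i = 2 then of_bool b else if i = 3 then of_bool c else of_bool d)"

lemma vec4_nth [simp]:
  "vec4 a b c d $ 1 = of_bool a" "vec4 a b c d $ 2 = of_bool b" "vec4 a b c d $ 3 = of_bool c" "vec4 a b c d $ 4 = of_bool d"
  by (simp_all add: vec4_def)

lemma vec4_eta: "vec4 (v $ 1 = 1) (v $ 2 = 1) (v $ 3 = 1) (v $ 4 = 1) = v"
proof -
  have o: "of_bool (x = 1) = (x :: bit)" for x by (cases x) simp_all
  show ?thesis by (simp add: vec_eq_iff forall_4 o)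
qed

lemma prod_bit_vec: "(\<Prod>v\<in>UNIV. f v) = (\<Prod>a\<in>UNIV. \<Prod>b\<in>UNIV. \<Prod>c\<in>UNIV. \<Prod>d\<in>UNIV. f (vec4 a b c d) :: complex)"
proof -
  have "(\<Prod>v\<in>UNIV. f v) = (\<Prod>(a, b, c, d)\<in>UNIV. f (vec4 a b c d))"
    by (rule prod.reindex_bij_witness[of _ "\<lambda>(a, b, c, d). vec4 a b c d" "\<lambda>v. (v $ 1 = 1, v $ 2 = 1, v $ 3 = 1, v $ 4 = 1)"])
       (auto simp: vec4_eta)
  then show ?thesis
    by (simp add: prod.cartesian_product split_def flip: UNIV_Times_UNIV)
qed

lemma prod_bool: "(\<Prod>a\<in>UNIV. f a) = f False * (f True :: complex)"
  by (simp add: UNIV_bool mult.commute)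

lemma sign_mult: "(if P then - 1 else 1) * (if Q then - 1 else 1) = (if P \<noteq> Q then - 1 else (1 :: complex))"
  by simp

lemma sign_eq_1: "(if P then - 1 else 1) = (1 :: complex) \<longleftrightarrow> \<not> P"
  by simp

text \<open>Extended by 0 to the origin, \<open>y\<close> is orthogonal to all polynomials of degree
  at most two, so it is affine by Reed-Muller duality, and it vanishes at 0 and at the unit vectors.
  The proof solves the system directly: 11 equations for the 11 remaining points.\<close>

lemma orthogonal_quadratic_forms:
  assumes lin: "\<And>i. parity_sign (rm_coord i) y = 1"
    and quad: "\<And>i j. i \<noteq> j \<Longrightarrow> parity_sign (\<lambda>q. rm_coord i q \<and> rm_coord j q) y = 1"
    and tot: "parity_sign (\<lambda>_. True) y = 1"
    and axis: "\<And>i. \<not> y (Abs_qubit15 (axis i 1))"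
  shows "\<not> y q"
proof -
  define Y where "Y v \<longleftrightarrow> v \<noteq> 0 \<and> y (Abs_qubit15 v)" for v
  have yY: "y q = Y (vec_of q)" for q
    using vec_of[of q] by (simp add: Y_def vec_of_inverse)
  have Y0: "\<not> Y (vec4 False False False False)"
    by (simp add: Y_def vec_eq_iff forall_4)
  have ax: "axis 1 1 = vec4 True False False False" "axis 2 1 = vec4 False True False False"
    "axis 3 1 = vec4 False False True False" "axis 4 1 = vec4 False False False True"
    by (simp_all add: vec_eq_iff forall_4 axis_def)
  have Y1: "\<not> Y (vec4 True False False False)" "\<not> Y (vec4 False True False False)"
    "\<not> Y (vec4 False False True False)" "\<not> Y (vec4 False False False True)"
    using axis unfolding Y_def ax[symmetric] by blast+
  have P: "(\<Prod>v\<in>UNIV. if Q v \<and> Y v then - 1 else 1 :: complex) = 1"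
    if "parity_sign (\<lambda>q. Q (vec_of q)) y = 1" for Q
  proof -
    have "(\<Prod>v\<in>UNIV. if Q v \<and> Y v then - 1 else 1 :: complex) = (\<Prod>v\<in>UNIV-{0}. if Q v \<and> Y v then - 1 else 1)"
      by (subst prod.remove[of UNIV 0]) (simp_all add: Y_def)
    also have "\<dots> = 1"
      using that unfolding parity_sign_def yY prod_qubit15[of "\<lambda>v. if Q v \<and> Y v then - 1 else 1"] .
    finally show ?thesis .
  qed
  have coord: "rm_coord i = (\<lambda>q. vec_of q $ i = 1)" for i
    by (rule ext) (rule rm_coord_iff)
  have L: "(\<Prod>v\<in>UNIV. if v $ i = 1 \<and> Y v then - 1 else 1 :: complex) = 1" for i
    using P[of "\<lambda>v. v $ i = 1"] lin[of i] unfolding coord .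
  have K: "(\<Prod>v\<in>UNIV. if (v $ i = 1 \<and> v $ j = 1) \<and> Y v then - 1 else 1 :: complex) = 1" if "i \<noteq> j" for i j
    using P[of "\<lambda>v. v $ i = 1 \<and> v $ j = 1"] quad[OF that] unfolding coord .
  have T: "(\<Prod>v\<in>UNIV. if True \<and> Y v then - 1 else 1 :: complex) = 1"
    using P[of "\<lambda>v. True"] tot .
  note S = prod_bit_vec prod_bool vec4_nth of_bool_eq zero_neq_one simp_thms if_False if_True
    mult_1_left mult_1_right sign_mult sign_eq_1
  have K': "(\<Prod>v\<in>UNIV. if (v $ 1 = 1 \<and> v $ 2 = 1) \<and> Y v then - 1 else 1 :: complex) = 1"
    "(\<Prod>v\<in>UNIV. if (v $ 1 = 1 \<and> v $ 3 = 1) \<and> Y v then - 1 else 1 :: complex) = 1"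
    "(\<Prod>v\<in>UNIV. if (v $ 1 = 1 \<and> v $ 4 = 1) \<and> Y v then - 1 else 1 :: complex) = 1"
    "(\<Prod>v\<in>UNIV. if (v $ 2 = 1 \<and> v $ 3 = 1) \<and> Y v then - 1 else 1 :: complex) = 1"
    "(\<Prod>v\<in>UNIV. if (v $ 2 = 1 \<and> v $ 4 = 1) \<and> Y v then - 1 else 1 :: complex) = 1"
    "(\<Prod>v\<in>UNIV. if (v $ 3 = 1 \<and> v $ 4 = 1) \<and> Y v then - 1 else 1 :: complex) = 1"
    by (rule K, simp)+
  \<comment> \<open>The quadratic equations express the points of weight two through those of weight
    three and four. Substitution leaves five equations for five unknowns.\<close>
  have k: "Y (vec4 True True False False) = ((Y (vec4 True True True False) \<noteq> Y (vec4 True True False True)) \<noteq> Y (vec4 True True True True))"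
    "Y (vec4 True False True False) = ((Y (vec4 True True True False) \<noteq> Y (vec4 True False True True)) \<noteq> Y (vec4 True True True True))"
    "Y (vec4 True False False True) = ((Y (vec4 True True False True) \<noteq> Y (vec4 True False True True)) \<noteq> Y (vec4 True True True True))"
    "Y (vec4 False True True False) = ((Y (vec4 True True True False) \<noteq> Y (vec4 False True True True)) \<noteq> Y (vec4 True True True True))"
    "Y (vec4 False True False True) = ((Y (vec4 True True False True) \<noteq> Y (vec4 False True True True)) \<noteq> Y (vec4 True True True True))"
    "Y (vec4 False False True True) = ((Y (vec4 True False True True) \<noteq> Y (vec4 False True True True)) \<noteq> Y (vec4 True True True True))"
    using K'[unfolded S] by auto
  have l: "\<not> Y (vec4 True True True True) \<and> \<not> Y (vec4 True True True False) \<and> \<not> Y (vec4 True True False True) \<and>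
    \<not> Y (vec4 True False True True) \<and> \<not> Y (vec4 False True True True)"
    using L[of 1, unfolded S] L[of 2, unfolded S] L[of 3, unfolded S] L[of 4, unfolded S] T[unfolded S] Y0 Y1
    unfolding k
    by (cases "Y (vec4 True True True True)"; cases "Y (vec4 True True True False)"; cases "Y (vec4 True True False True)";
        cases "Y (vec4 True False True True)"; cases "Y (vec4 False True True True)"; simp)
  have "\<not> Y (vec4 a b c d)" for a b c d
    using Y0 Y1 k l by (cases a; cases b; cases c; cases d) simp_all
  then show ?thesis unfolding yY by (metis vec4_eta)
qed

text \<open>The Z stabilizers and the logical Z impose parity conditions on every basis state with
  nonzero amplitude. Adding a codeword that agrees with \<open>x\<close> at the unit vectors reduces
  them to \<open>orthogonal_quadratic_forms\<close>.\<close>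

lemma enc15_support:
  assumes "enc15 $ x $ a \<noteq> 0"
  shows "x \<in> range (\<lambda>l. codeword l a)"
proof -
  have Z: "parity_sign P x = 1" if "pauli_string (\<lambda>_. False) P \<in> rm_generators" for P
    using pauli_string_mult_nth[of "\<lambda>_. False" P enc15 x a] enc15_properties(2)[OF that] assms by simp
  have Z_all: "parity_sign (\<lambda>_. True) x = (if a then - 1 else 1)"
    using pauli_string_mult_nth[of "\<lambda>_. False" "\<lambda>_. True" enc15 x a] assms
      parity_sign_cases[of "\<lambda>_. True" x]
    unfolding enc15_properties(3) by (cases a) (auto simp: bool_mult_nth pauli_Z_def)
  \<comment> \<open>Interpolation: with logical bit \<open>a\<close> fixed, the values at the unit
    vectors determine the linear part.\<close>
  define l where "l = ((\<chi> i. of_bool (x (Abs_qubit15 (axis i 1)) \<noteq> a)) :: bit ^ 4)"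
  define y where "y = (\<lambda>q. x q \<noteq> codeword l a q)"
  have sign_xor: "parity_sign P y = parity_sign P x * parity_sign P (codeword l a)" for P
    unfolding parity_sign_def y_def by (subst prod.distrib[symmetric]) (intro prod.cong, auto)
  have "\<not> y q" for q
  proof (rule orthogonal_quadratic_forms)
    show "parity_sign (rm_coord i) y = 1" for i
      unfolding sign_xor parity_sign_codewords using Z[of "rm_coord i"] by (simp add: rm_generators_eq)
    show "parity_sign (\<lambda>q. rm_coord i q \<and> rm_coord j q) y = 1" if "i \<noteq> j" for i j
      unfolding sign_xor parity_sign_codewords using Z[of "\<lambda>q. rm_coord i q \<and> rm_coord j q"] that
      by (auto simp: rm_generators_eq)
    show "parity_sign (\<lambda>_. True) y = 1"
      unfolding sign_xor parity_sign_codewords Z_all by simp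
    show "\<not> y (Abs_qubit15 (axis i 1))" for i
      by (auto simp: y_def codeword_def vec_of_axis dot4_axis l_def)
  qed
  then have "x = codeword l a" by (auto simp: y_def)
  then show ?thesis by blast
qed

text \<open>The X stabilizers make the amplitude constant on the codewords with one logical bit,
  since the shifts in \<open>S\<close> are closed under addition and contain the unit vectors. The
  logical X equates the two constants.\<close>

lemma enc15_eq: "\<exists>c. \<forall>x a. enc15 $ x $ a = (if x \<in> range (\<lambda>l. codeword l a) then c else 0)"
proof -
  define S where "S = {m. \<forall>x a. enc15 $ (\<lambda>q. x q \<noteq> codeword m False q) $ a = enc15 $ x $ a}"
  have axis: "axis i 1 \<in> S" for i
  proof -
    have "pauli_string (rm_coord i) (\<lambda>_. False) ** enc15 = enc15"
      by (intro enc15_properties(2)) (simp add: rm_generators_eq)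
    then show ?thesis
      using pauli_string_mult_nth[of "rm_coord i" "\<lambda>_. False" enc15] by (simp add: parity_sign_def S_def)
  qed
  have add: "l + m \<in> S" if "l \<in> S" "m \<in> S" for l m
  proof -
    have "(\<lambda>q. x q \<noteq> codeword (l + m) False q) = (\<lambda>q. (x q \<noteq> codeword l False q) \<noteq> codeword m False q)" for x
      using codeword_xor[of l False _ m False] by auto
    then show ?thesis using that by (simp add: S_def)
  qed
  have zero: "0 \<in> S" by (simp add: codeword_0 S_def)
  have "l \<in> S" for l
  proof -
    have "l $ i *s axis i 1 \<in> S" for i
      using axis[of i] zero by (cases "l $ i") simp_all
    then have "(\<Sum>i\<in>A. l $ i *s axis i 1) \<in> S" for A
      by (induction A rule: infinite_finite_induct) (simp_all add: zero add)
    then show ?thesis using basis_expansion[of l] by metis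
  qed
  then have shift: "enc15 $ (\<lambda>q. x q \<noteq> codeword l False q) $ a = enc15 $ x $ a" for l x a unfolding S_def by blast
  have "enc15 $ codeword l a $ a = enc15 $ (\<lambda>_. False) $ False" for l a
  proof -
    have "enc15 $ codeword l a $ a = enc15 $ (\<lambda>_. a) $ a"
      using shift[of "\<lambda>_. a" l a] codeword_xor[of 0 a _ l False] by (simp add: codeword_0)
    also have "\<dots> = enc15 $ (\<lambda>_. False) $ False"
    proof (cases a)
      case True
      have "(enc15 ** pauli_X) $ (\<lambda>_. False) $ True = enc15 $ (\<lambda>_. True) $ True"
        unfolding enc15_properties(4)[symmetric] pauli_string_mult_nth by (simp add: parity_sign_def)
      then show ?thesis using True by (simp add: bool_mult_nth pauli_X_def)
    qed simp
    finally show ?thesis .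
  qed
  then show ?thesis using enc15_support by (intro exI[of _ "enc15 $ (\<lambda>_. False) $ False"]) auto
qed

subsection \<open>Distance\<close>

text \<open>The points of the qubits are nonzero and pairwise distinct; as columns of a parity-check
  matrix they define the Hamming code, of distance three.\<close>

lemma rm_detect:
  assumes supp: "\<And>r. r \<noteq> p \<Longrightarrow> r \<noteq> q \<Longrightarrow> \<not> b r" and par: "\<And>i. parity_sign b (rm_coord i) = 1"
  shows "\<not> b r"
proof -
  have nz: "\<exists>i. rm_coord i s" for s
    using vec_of[of s] by (auto simp: rm_coord_iff vec_eq_iff)
  have par': "(\<Prod>s\<in>{p, q}. if b s \<and> rm_coord i s then - 1 else 1 :: complex) = 1" for i
  proof -
    have "(\<Prod>s\<in>{p, q}. if b s \<and> rm_coord i s then - 1 else 1 :: complex) = parity_sign b (rm_coord i)"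
      unfolding parity_sign_def using supp by (intro prod.mono_neutral_left) auto
    then show ?thesis using par by simp
  qed
  show ?thesis
  proof (cases "p = q")
    case True
    obtain i where "rm_coord i p" using nz by blast
    then have "\<not> b p" using True par'[of i] by (auto split: if_splits)
    then show ?thesis using True supp[of r] by (cases "r = p") auto
  next
    case False
    then have "vec_of p \<noteq> vec_of q" by (simp add: vec_of_inject)
    then obtain i where "vec_of p $ i \<noteq> vec_of q $ i" by (auto simp: vec_eq_iff)
    then have i: "rm_coord i p \<noteq> rm_coord i q"
      unfolding rm_coord_iff using bit_eqI[of "vec_of p $ i" "vec_of q $ i"] by blast
    have x: "(b p \<and> rm_coord i p) = (b q \<and> rm_coord i q)" for i
      using par'[of i] False by (auto split: if_splits)
    have "\<not> b p \<and> \<not> b q" using x i nz by blast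
    then show ?thesis using supp[of r] by (cases "r = p"; cases "r = q") auto
  qed
qed

lemma enc15_decoder:
  "\<exists>D :: (qubit15 \<Rightarrow> bool) \<times> (qubit15 \<Rightarrow> bool) + (qubit15 \<Rightarrow> bool) \<Rightarrow> complex ^ (qubit15 \<Rightarrow> bool) ^ bool.
    (\<Sum>s\<in>UNIV. adj (D s) ** D s) = mat 1 \<and> (\<forall>s q E. \<exists>e. D s ** (local_op q E ** enc15) = mat e)"
proof -
  \<comment> \<open>The X and Z parts of an error are detected separately, each by the coordinate
    generators of the other type.\<close>
  let ?S = "range (\<lambda>i. (rm_coord i, \<lambda>_. False)) \<union> range (\<lambda>i. (\<lambda>_. False, rm_coord i))"
  have "\<exists>D :: (qubit15 \<Rightarrow> bool) \<times> (qubit15 \<Rightarrow> bool) + (qubit15 \<Rightarrow> bool) \<Rightarrow> complex ^ (qubit15 \<Rightarrow> bool) ^ bool.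
    (\<Sum>s\<in>UNIV. adj (D s) ** D s) = mat 1 \<and>
    (\<forall>s q E. \<exists>e. D s ** (local_op q E ** (tensor (\<lambda>_. mat 1) ** enc15)) = mat e)"
  proof (rule distance_three_decoder[where S = ?S])
    show "adj enc15 ** enc15 = mat 1" by (rule enc15_properties)
    show "pauli_string c d ** enc15 = enc15" if "(c, d) \<in> ?S" for c d
      using that by (intro enc15_properties(2)) (auto simp: rm_generators_eq)
    show "unitary (mat 1 :: bool op)" by (rule unitary_mat_1)
    fix a b :: "qubit15 \<Rightarrow> bool" and p q r
    assume supp: "\<And>r. r \<noteq> p \<Longrightarrow> r \<noteq> q \<Longrightarrow> \<not> a r \<and> \<not> b r"
      and par: "\<And>c d. (c, d) \<in> ?S \<Longrightarrow> parity_sign b c = parity_sign d a"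
    have sym: "parity_sign x y = parity_sign y x" for x y :: "qubit15 \<Rightarrow> bool"
      by (simp add: parity_sign_def conj_commute)
    have "parity_sign b (rm_coord i) = 1" for i
      using par[of "rm_coord i" "\<lambda>_. False"] by (auto simp: parity_sign_def)
    moreover have "parity_sign a (rm_coord i) = 1" for i
    proof -
      have "parity_sign b (\<lambda>_. False) = parity_sign (rm_coord i) a" by (rule par) auto
      then show ?thesis by (simp add: sym[of a "rm_coord i"]) (simp add: parity_sign_def)
    qed
    ultimately show "\<not> a r \<and> \<not> b r" using supp rm_detect[of p q] by metis
  qed
  then show ?thesis by (simp add: tensor_mat_1)
qed

subsection \<open>Logical one-qubit gates\<close>

definition permutation_op :: "('b \<Rightarrow> 'b) \<Rightarrow> 'b::finite op" where
  "permutation_op f = (\<chi> x y. if x = f y then 1 else 0)"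

text \<open>The counterpart of \<open>acts_on\<close> for a register without a block index.\<close>

definition acts_within :: "'q::finite set \<Rightarrow> ('q \<Rightarrow> bool) op \<Rightarrow> bool" where
  "acts_within A W \<longleftrightarrow> (\<forall>x y. W $ x $ y =
     (if \<forall>p. p \<notin> A \<longrightarrow> x p = y p then W $ (\<lambda>p. p \<in> A \<and> x p) $ (\<lambda>p. p \<in> A \<and> y p) else 0))"

lemma permutation_op_involution_mult:
  assumes "\<And>x. f (f x) = x"
  shows "(permutation_op f ** V) $ x $ j = V $ f x $ (j :: 'm::finite)"
proof -
  have "x = f k \<longleftrightarrow> f x = k" for k using assms by metis
  then show ?thesis
    by (simp add: permutation_op_def mult_nth if_mult_sum(1)[of "f x" "\<lambda>_. 1", simplified])
qed

lemma unitary_permutation_op: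
  assumes "\<And>x. f (f x) = x"
  shows "unitary (permutation_op f)"
proof -
  have "x = f y \<longleftrightarrow> y = f x" for x y using assms by metis
  then have "adj (permutation_op f) = permutation_op f"
    by (intro matrix_ext) (simp add: permutation_op_def)
  moreover have "permutation_op f ** permutation_op f = mat 1"
  proof (rule matrix_ext)
    fix x y
    have "f x = f y \<longleftrightarrow> x = y" using assms by metis
    then show "(permutation_op f ** permutation_op f) $ x $ y = mat 1 $ x $ y"
      unfolding permutation_op_involution_mult[OF assms] by (simp add: permutation_op_def mat_nth)
  qed
  ultimately show ?thesis by (simp add: unitary_def)
qed

lemma acts_within_permutation_op:
  assumes "\<And>y p. p \<notin> A \<Longrightarrow> f y p = y p" "\<And>y p. p \<in> A \<Longrightarrow> f (\<lambda>p. p \<in> A \<and> y p) p = f y p"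
  shows "acts_within A (permutation_op f)"
proof -
  have e: "x = f y \<longleftrightarrow> (\<forall>p. p \<notin> A \<longrightarrow> x p = y p) \<and> (\<lambda>p. p \<in> A \<and> x p) = f (\<lambda>p. p \<in> A \<and> y p)" for x y
    using assms unfolding fun_eq_iff by metis
  have i: "(if P \<and> Q then 1 else 0) = (if P then if Q then 1 else 0 else (0 :: complex))" for P Q
    by simp
  show ?thesis
    unfolding acts_within_def permutation_op_def vec_lambda_beta
  proof (intro allI)
    fix x y
    show "(if x = f y then 1 else 0) =
        (if \<forall>p. p \<notin> A \<longrightarrow> x p = y p then if (\<lambda>p. p \<in> A \<and> x p) = f (\<lambda>p. p \<in> A \<and> y p) then 1 else 0 else (0 :: complex))"
      unfolding e[of x y] i ..
  qed
qed

lemma acts_within_local_op: "acts_within {q} (local_op q M)"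
  unfolding acts_within_def local_op_nth by auto

lemma local_op_mult_nth:
  "(local_op q M ** N) $ x $ j =
     M $ x q $ False * N $ (x(q := False)) $ j + M $ x q $ True * N $ (x(q := True)) $ j"
  for N :: "complex ^ 'm::finite ^ ('q::finite \<Rightarrow> bool)"
proof -
  have "(local_op q M ** N) $ x $ j =
      (\<Sum>k\<in>UNIV. if \<forall>p. p \<noteq> q \<longrightarrow> x p = k p then M $ x q $ k q * N $ k $ j else 0)"
    unfolding mult_nth local_op_nth by (intro sum.cong) auto
  then show ?thesis by (simp add: sum_agree_off)
qed

definition cnot_fun :: "'q \<Rightarrow> 'q \<Rightarrow> ('q \<Rightarrow> bool) \<Rightarrow> 'q \<Rightarrow> bool" where
  "cnot_fun u p x = x(p := (x p \<noteq> x u))"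

definition fanout_fun :: "'q \<Rightarrow> 'q set \<Rightarrow> ('q \<Rightarrow> bool) \<Rightarrow> 'q \<Rightarrow> bool" where
  "fanout_fun u S x = (\<lambda>p. if p \<in> S then x p \<noteq> x u else x p)"

lemma fanout_circuit:
  assumes "u \<notin> set ps" "distinct ps"
  shows "(circuit_op (map (\<lambda>p. permutation_op (cnot_fun u p)) ps) ** V) $ x $ j = V $ fanout_fun u (set ps) x $ (j :: 'm::finite)"
  using assms
proof (induction ps arbitrary: V)
  case Nil
  then show ?case by (simp add: fanout_fun_def)
next
  case (Cons p ps)
  have inv: "cnot_fun u p (cnot_fun u p x) = x" for x
    using Cons.prems by (auto simp: cnot_fun_def fun_eq_iff)
  have "cnot_fun u p (fanout_fun u (set ps) x) = fanout_fun u (set (p # ps)) x"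
    using Cons.prems by (auto simp: cnot_fun_def fanout_fun_def fun_eq_iff)
  then show ?case
    using Cons by (simp add: permutation_op_involution_mult[OF inv] flip: matrix_mul_assoc)
qed

text \<open>
  Adding the qubits \<open>v\<close> and \<open>w = u + v\<close> to the qubit \<open>u\<close> stores the logical bit there, and
  adding \<open>u\<close> to all other qubits then decouples it. The logical gate acts on \<open>u\<close> alone, and the
  two steps are undone.
\<close>

lemma enc15_logical_gate:
  assumes M: "unitary M"
  shows "\<exists>L. (\<forall>W\<in>set L. unitary W \<and> (\<exists>A. card A \<le> 3 \<and> acts_within A W)) \<and>
    circuit_op L ** enc15 = enc15 ** M"
proof -
  define u where "u = Abs_qubit15 (axis 1 1)"
  define v where "v = Abs_qubit15 (axis 2 1)"
  define w where "w = Abs_qubit15 (axis 1 1 + axis 2 1)"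
  have nz: "axis 1 1 + axis 2 1 \<noteq> (0 :: bit ^ 4)"
    by (simp add: vec_eq_iff forall_4 axis_def)
  have vec: "vec_of u = axis 1 1" "vec_of v = axis 2 1" "vec_of w = axis 1 1 + axis 2 1"
    using nz by (simp_all add: u_def v_def w_def vec_of_axis Abs_qubit15_inverse)
  have "vec_of u \<noteq> vec_of v" "vec_of u \<noteq> vec_of w"
    unfolding vec by (simp_all add: vec_eq_iff forall_4 axis_def)
  then have uv: "u \<noteq> v" "u \<noteq> w" by auto
  define f where "f x = x(u := (x u \<noteq> (x v \<noteq> x w)))" for x :: "qubit15 \<Rightarrow> bool"
  have ff: "f (f x) = x" for x
    using uv by (auto simp: f_def fun_eq_iff)
  obtain ps where ps: "set ps = UNIV - {u}" "distinct ps"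
    using finite_distinct_list[of "UNIV - {u}"] by auto
  let ?B = "map (\<lambda>p. permutation_op (cnot_fun u p)) ps"
  define g where "g = fanout_fun u (UNIV - {u})"
  have gg: "g (g x) = x" for x by (auto simp: g_def fanout_fun_def fun_eq_iff)
  let ?L = "permutation_op f # ?B @ local_op u M # ?B @ [permutation_op f]"
  have B: "(circuit_op ?B ** V) $ x $ a = V $ g x $ a" for V :: "complex ^ bool ^ (qubit15 \<Rightarrow> bool)" and x a
    using fanout_circuit[of u ps V x a] ps by (simp add: g_def)
  have F: "(permutation_op f ** V) $ x $ a = V $ f x $ a" for V :: "complex ^ bool ^ (qubit15 \<Rightarrow> bool)" and x a
    by (rule permutation_op_involution_mult[OF ff])
  define N where "N = circuit_op ?B ** (permutation_op f ** enc15)"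
  obtain c where c: "\<And>x a. enc15 $ x $ a = (if x \<in> range (\<lambda>l. codeword l a) then c else 0)"
    using enc15_eq by blast
  \<comment> \<open>The amplitude of the 14 qubits other than \<open>u\<close> once they are
    decoupled. They then hold only the linear part of the codeword, so the logical bit does not
    enter.\<close>
  define \<phi> where "\<phi> y = (if \<exists>l. \<forall>p. p \<noteq> u \<longrightarrow> y p = (dot4 l (vec_of p) = 1) then c else 0)" for y
  have \<phi>u: "\<phi> (y(u := b)) = \<phi> y" for y b
  proof -
    have "(\<forall>p. p \<noteq> u \<longrightarrow> (y(u := b)) p = (dot4 l (vec_of p) = 1)) \<longleftrightarrow> (\<forall>p. p \<noteq> u \<longrightarrow> y p = (dot4 l (vec_of p) = 1))" for l
      by auto
    then show ?thesis by (simp only: \<phi>_def)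
  qed
  have N: "N $ y $ a = (if y u = a then \<phi> y else 0)" for y a
  proof -
    have code: "g (f (codeword l a)) = (\<lambda>p. if p = u then a else dot4 l (vec_of p) = 1)" for l
    proof -
      \<comment> \<open>The linear part cancels over the points u, v and u + v, and the three
        constants add up to \<open>a\<close>.\<close>
      have "f (codeword l a) u = a"
        unfolding f_def codeword_def vec dot4_add_right by (auto simp: bit_add_eq_1)
      moreover have "f (codeword l a) p = codeword l a p" if "p \<noteq> u" for p
        using that by (simp add: f_def)
      ultimately show ?thesis
        by (auto simp: g_def fanout_fun_def fun_eq_iff codeword_def)
    qed
    have e: "f (g y) = codeword l a \<longleftrightarrow> y = (\<lambda>p. if p = u then a else dot4 l (vec_of p) = 1)" for l
      unfolding code[symmetric] using ff gg by metis
    have "f (g y) \<in> range (\<lambda>l. codeword l a) \<longleftrightarrow> (\<exists>l. y = (\<lambda>p. if p = u then a else dot4 l (vec_of p) = 1))"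
      unfolding e[symmetric] by blast
    also have "\<dots> \<longleftrightarrow> y u = a \<and> (\<exists>l. \<forall>p. p \<noteq> u \<longrightarrow> y p = (dot4 l (vec_of p) = 1))"
      unfolding fun_eq_iff by auto
    finally have "f (g y) \<in> range (\<lambda>l. codeword l a) \<longleftrightarrow>
        y u = a \<and> (\<exists>l. \<forall>p. p \<noteq> u \<longrightarrow> y p = (dot4 l (vec_of p) = 1))" .
    then show ?thesis by (auto simp: N_def B F c \<phi>_def)
  qed
  have MN: "local_op u M ** N = N ** M"
  proof (rule matrix_ext)
    fix y a
    show "(local_op u M ** N) $ y $ a = (N ** M) $ y $ a"
      unfolding local_op_mult_nth bool_mult_nth N \<phi>u by (cases a; cases "y u") simp_all
  qed
  have "circuit_op ?L ** enc15 = permutation_op f ** (circuit_op ?B ** (local_op u M ** N))"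
    by (simp add: circuit_op_append N_def matrix_mul_assoc)
  also have "\<dots> = (permutation_op f ** (circuit_op ?B ** N)) ** M"
    unfolding MN by (simp add: matrix_mul_assoc)
  also have "permutation_op f ** (circuit_op ?B ** N) = enc15"
    by (rule matrix_ext) (simp add: F B N_def gg ff)
  finally have "circuit_op ?L ** enc15 = enc15 ** M" .
  moreover have "unitary W \<and> (\<exists>A. card A \<le> 3 \<and> acts_within A W)" if "W \<in> set ?L" for W
  proof -
    have "unitary (permutation_op f)" by (rule unitary_permutation_op[OF ff])
    moreover have "acts_within {u, v, w} (permutation_op f)"
      by (rule acts_within_permutation_op) (auto simp: f_def)
    moreover have "card {u, v, w} \<le> 3" by (simp add: card_insert_if)
    moreover have "unitary (local_op u M)" by (rule unitary_local_op[OF M])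
    moreover have "acts_within {u} (local_op u M)" by (rule acts_within_local_op)
    moreover have "unitary (permutation_op (cnot_fun u p)) \<and> acts_within {u, p} (permutation_op (cnot_fun u p))" if "p \<noteq> u" for p
      using that by (intro conjI unitary_permutation_op acts_within_permutation_op) (auto simp: cnot_fun_def fun_eq_iff)
    moreover have "card {u, p} \<le> 3" for p by (simp add: card_insert_if)
    moreover have "W = permutation_op f \<or> W = local_op u M \<or> (\<exists>p. p \<noteq> u \<and> W = permutation_op (cnot_fun u p))"
      using that ps(1) by auto
    moreover have "card {u} \<le> 3" by simp
    ultimately show ?thesis by blast
  qed
  ultimately show ?thesis by blast
qed

section \<open>The 47-qubit code\<close>

subsection \<open>Tensor products over the five blocks\<close>

text \<open>The factors may have different index types, which \<open>tensor\<close> does not permit: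
  blocks of 15 qubits stand next to single qubits, and encoders are not square.\<close>

definition kron5 ::
  "complex ^ 'a1::finite ^ 'b1::finite \<Rightarrow> complex ^ 'a2::finite ^ 'b2::finite \<Rightarrow> complex ^ 'a3::finite ^ 'b3::finite \<Rightarrow>
   complex ^ 'a4::finite ^ 'b4::finite \<Rightarrow> complex ^ 'a5::finite ^ 'b5::finite \<Rightarrow>
   complex ^ ('a1 \<times> 'a2 \<times> 'a3 \<times> 'a4 \<times> 'a5) ^ ('b1 \<times> 'b2 \<times> 'b3 \<times> 'b4 \<times> 'b5)" where
  "kron5 A1 A2 A3 A4 A5 = (\<chi> x y.
     A1 $ fst x $ fst y * A2 $ fst (snd x) $ fst (snd y) * A3 $ fst (snd (snd x)) $ fst (snd (snd y)) *
     A4 $ fst (snd (snd (snd x))) $ fst (snd (snd (snd y))) * A5 $ snd (snd (snd (snd x))) $ snd (snd (snd (snd y))))"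

text \<open>Carries a product indexed by tuples back to a register, whose basis consists of
  functions.\<close>

definition reindex :: "('x::finite \<Rightarrow> 'b::finite) \<Rightarrow> ('y::finite \<Rightarrow> 'a::finite) \<Rightarrow> complex ^ 'a ^ 'b \<Rightarrow> complex ^ 'y ^ 'x" where
  "reindex f g M = (\<chi> x y. M $ f x $ g y)"

lemma kron5_nth:
  "kron5 A1 A2 A3 A4 A5 $ (x1, x2, x3, x4, x5) $ (y1, y2, y3, y4, y5) =
     A1 $ x1 $ y1 * A2 $ x2 $ y2 * A3 $ x3 $ y3 * A4 $ x4 $ y4 * A5 $ x5 $ y5"
  by (simp add: kron5_def)

lemma sum_prod5:
  "(\<Sum>z\<in>UNIV. f1 (fst z) * f2 (fst (snd z)) * f3 (fst (snd (snd z))) * f4 (fst (snd (snd (snd z)))) * f5 (snd (snd (snd (snd z))))) =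
     (\<Sum>a\<in>UNIV. f1 a) * (\<Sum>b\<in>UNIV. f2 b) * (\<Sum>c\<in>UNIV. f3 c) * (\<Sum>d\<in>UNIV. f4 d) * (\<Sum>e\<in>UNIV. f5 e)"
  for f1 :: "'a::finite \<Rightarrow> complex" and f2 :: "'b::finite \<Rightarrow> complex" and f3 :: "'c::finite \<Rightarrow> complex"
    and f4 :: "'d::finite \<Rightarrow> complex" and f5 :: "'e::finite \<Rightarrow> complex"
proof -
  have two: "(\<Sum>z\<in>UNIV. g1 (fst z) * g2 (snd z)) = (\<Sum>a\<in>UNIV. g1 a) * (\<Sum>b\<in>UNIV. g2 b :: complex)"
    for g1 :: "'x::finite \<Rightarrow> complex" and g2 :: "'y::finite \<Rightarrow> complex"
    by (simp add: sum_product sum.cartesian_product split_def flip: UNIV_Times_UNIV)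
  show ?thesis
    unfolding mult.assoc
    by (simp only: two[of f1 "\<lambda>z. f2 (fst z) * (f3 (fst (snd z)) * (f4 (fst (snd (snd z))) * f5 (snd (snd (snd z)))))"]
        two[of f2 "\<lambda>z. f3 (fst z) * (f4 (fst (snd z)) * f5 (snd (snd z)))"]
        two[of f3 "\<lambda>z. f4 (fst z) * f5 (snd z)"] two[of f4 f5])
qed

lemma kron5_mult:
  "kron5 A1 A2 A3 A4 A5 ** kron5 B1 B2 B3 B4 B5 = kron5 (A1 ** B1) (A2 ** B2) (A3 ** B3) (A4 ** B4) (A5 ** B5)"
proof (rule matrix_ext)
  fix x y
  show "(kron5 A1 A2 A3 A4 A5 ** kron5 B1 B2 B3 B4 B5) $ x $ y = kron5 (A1 ** B1) (A2 ** B2) (A3 ** B3) (A4 ** B4) (A5 ** B5) $ x $ y"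
    unfolding mult_nth kron5_def vec_lambda_beta sum_prod5[symmetric]
    by (intro sum.cong refl) (simp only: mult_ac)
qed

lemma kron5_mat_1: "kron5 (mat 1) (mat 1) (mat 1) (mat 1) (mat 1) = mat 1"
  by (rule matrix_ext) (auto simp: kron5_def mat_nth prod_eq_iff)

lemma adj_kron5: "adj (kron5 A1 A2 A3 A4 A5) = kron5 (adj A1) (adj A2) (adj A3) (adj A4) (adj A5)"
  by (rule matrix_ext) (simp add: kron5_def)

lemma kron5_sum:
  "(\<Sum>s\<in>UNIV. \<Sum>t\<in>UNIV. \<Sum>u\<in>UNIV. kron5 (A s) B (C t) D (E u)) =
     kron5 (\<Sum>s\<in>UNIV. A s) B (\<Sum>t\<in>UNIV. C t) D (\<Sum>u\<in>UNIV. E u)"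
  by (rule matrix_ext) (simp add: kron5_def sum_distrib_left sum_distrib_right mult_ac)

lemma reindex_mult: "bij g \<Longrightarrow> reindex f g M ** reindex g h N = reindex f h (M ** N)"
  by (rule matrix_ext)
     (simp add: mult_nth reindex_def sum.reindex_bij_betw[of g UNIV UNIV "\<lambda>k. M $ f _ $ k * N $ k $ h _"])

lemma reindex_mat_1: "inj f \<Longrightarrow> reindex f f (mat 1) = mat 1"
  by (rule matrix_ext) (simp add: reindex_def mat_nth inj_eq)

lemma adj_reindex: "adj (reindex f g M) = reindex g f (adj M)"
  by (rule matrix_ext) (simp add: reindex_def)

lemma reindex_sum: "reindex f g (\<Sum>s\<in>S. M s) = (\<Sum>s\<in>S. reindex f g (M s))"
  by (rule matrix_ext) (simp add: reindex_def)

section \<open>Splitting registers into the five slots of the 5'-code\<close>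

definition split5 :: "(qubit5 \<Rightarrow> bool) \<Rightarrow> bool \<times> bool \<times> bool \<times> bool \<times> bool" where
  "split5 y = (y Q1, y Q2, y Q3, y Q4, y Q5)"

definition split47 ::
  "(qubit47 \<Rightarrow> bool) \<Rightarrow> (qubit15 \<Rightarrow> bool) \<times> bool \<times> (qubit15 \<Rightarrow> bool) \<times> bool \<times> (qubit15 \<Rightarrow> bool)" where
  "split47 x = (x \<circ> Block1, x Bare2, x \<circ> Block3, x Bare4, x \<circ> Block5)"

lemma bij_split5: "bij split5"
proof (rule bijI')
  fix x y show "split5 x = split5 y \<longleftrightarrow> x = y"
    unfolding split5_def using bits5_eta[of x] bits5_eta[of y] by auto
next
  fix z show "\<exists>x. z = split5 x"
    by (intro exI[of _ "bits5 (fst z) (fst (snd z)) (fst (snd (snd z))) (fst (snd (snd (snd z)))) (snd (snd (snd (snd z))))"])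
       (simp add: split5_def)
qed

lemma fun47_eqI:
  "x \<circ> Block1 = y \<circ> Block1 \<Longrightarrow> x Bare2 = y Bare2 \<Longrightarrow> x \<circ> Block3 = y \<circ> Block3 \<Longrightarrow> x Bare4 = y Bare4 \<Longrightarrow>
   x \<circ> Block5 = y \<circ> Block5 \<Longrightarrow> x = y"
proof
  fix q assume "x \<circ> Block1 = y \<circ> Block1" "x Bare2 = y Bare2" "x \<circ> Block3 = y \<circ> Block3" "x Bare4 = y Bare4" "x \<circ> Block5 = y \<circ> Block5"
  then show "x q = y q" by (cases q) (simp_all add: fun_eq_iff)
qed

lemma bij_split47: "bij split47"
proof (rule bijI')
  fix x y show "split47 x = split47 y \<longleftrightarrow> x = y"
    unfolding split47_def using fun47_eqI[of x y] by auto
next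
  fix z show "\<exists>x. z = split47 x"
    by (intro exI[of _ "\<lambda>q. case q of Block1 v \<Rightarrow> fst z v | Bare2 \<Rightarrow> fst (snd z) | Block3 v \<Rightarrow> fst (snd (snd z)) v
          | Bare4 \<Rightarrow> fst (snd (snd (snd z))) | Block5 v \<Rightarrow> snd (snd (snd (snd z))) v"])
       (simp add: split47_def o_def)
qed

definition op5 :: "bool op \<Rightarrow> bool op \<Rightarrow> bool op \<Rightarrow> bool op \<Rightarrow> bool op \<Rightarrow> (qubit5 \<Rightarrow> bool) op" where
  "op5 a1 a2 a3 a4 a5 = reindex split5 split5 (kron5 a1 a2 a3 a4 a5)"

definition op47 :: "(qubit15 \<Rightarrow> bool) op \<Rightarrow> bool op \<Rightarrow> (qubit15 \<Rightarrow> bool) op \<Rightarrow> bool op \<Rightarrow> (qubit15 \<Rightarrow> bool) op \<Rightarrow> (qubit47 \<Rightarrow> bool) op" where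
  "op47 A1 a2 A3 a4 A5 = reindex split47 split47 (kron5 A1 a2 A3 a4 A5)"

lemma op47_nth:
  "op47 A1 a2 A3 a4 A5 $ x $ y = A1 $ (x \<circ> Block1) $ (y \<circ> Block1) * a2 $ x Bare2 $ y Bare2 *
     A3 $ (x \<circ> Block3) $ (y \<circ> Block3) * a4 $ x Bare4 $ y Bare4 * A5 $ (x \<circ> Block5) $ (y \<circ> Block5)"
  by (simp add: op47_def reindex_def split47_def kron5_nth)

lemma op5_tensor: "op5 (A Q1) (A Q2) (A Q3) (A Q4) (A Q5) = tensor A"
  by (rule matrix_ext) (simp add: op5_def reindex_def split5_def kron5_nth tensor_nth prod_qubit5)

lemma prod_qubit47:
  "(\<Prod>q\<in>UNIV. f q) = (\<Prod>v\<in>UNIV. f (Block1 v)) * f Bare2 * (\<Prod>v\<in>UNIV. f (Block3 v)) * f Bare4 * (\<Prod>v\<in>UNIV. f (Block5 v) :: complex)"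
proof -
  have "(\<Prod>q\<in>UNIV. f q) = (\<Prod>q\<in>range Block1 \<union> ({Bare2} \<union> (range Block3 \<union> ({Bare4} \<union> range Block5))). f q)"
    unfolding UNIV_qubit47 by (simp only: Un_assoc)
  also have "\<dots> = (\<Prod>q\<in>range Block1. f q) * (f Bare2 * ((\<Prod>q\<in>range Block3. f q) * (f Bare4 * (\<Prod>q\<in>range Block5. f q))))"
    by (subst prod.union_disjoint; (auto; fail)?)+
  finally show ?thesis
    by (simp add: prod.reindex inj_def mult.assoc)
qed

lemma op47_tensor:
  "op47 (tensor (\<lambda>v. A (Block1 v))) (A Bare2) (tensor (\<lambda>v. A (Block3 v))) (A Bare4) (tensor (\<lambda>v. A (Block5 v))) = tensor A"
  by (rule matrix_ext) (simp add: op47_nth tensor_nth prod_qubit47)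

lemma op47_mult:
  "op47 A1 a2 A3 a4 A5 ** op47 B1 b2 B3 b4 B5 = op47 (A1 ** B1) (a2 ** b2) (A3 ** B3) (a4 ** b4) (A5 ** B5)"
  by (simp add: op47_def reindex_mult[OF bij_split47] kron5_mult)

lemma op47_mat_1: "op47 (mat 1) (mat 1) (mat 1) (mat 1) (mat 1) = mat 1"
  by (simp add: op47_def kron5_mat_1 reindex_mat_1 bij_is_inj[OF bij_split47])

lemma adj_op47: "adj (op47 A1 a2 A3 a4 A5) = op47 (adj A1) (adj a2) (adj A3) (adj a4) (adj A5)"
  by (simp add: op47_def adj_reindex adj_kron5)

lemma unitary_op47:
  "unitary A1 \<Longrightarrow> unitary a2 \<Longrightarrow> unitary A3 \<Longrightarrow> unitary a4 \<Longrightarrow> unitary A5 \<Longrightarrow> unitary (op47 A1 a2 A3 a4 A5)"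
  by (simp add: unitary_def adj_op47 op47_mult op47_mat_1)

lemma rm_layer_eq: "rm_layer = reindex split47 split5 (kron5 enc15 (mat 1) enc15 (mat 1) enc15)"
  by (rule matrix_ext) (simp add: rm_layer_def reindex_def split47_def split5_def kron5_nth)

lemma enc47_isometry: "adj enc47 ** enc47 = mat 1"
proof -
  have "adj rm_layer ** rm_layer = mat 1"
    unfolding rm_layer_eq adj_reindex adj_kron5 reindex_mult[OF bij_split47] kron5_mult
    by (simp add: enc15_properties(1) kron5_mat_1 reindex_mat_1 bij_is_inj[OF bij_split5])
  then have "adj enc47 ** enc47 = adj enc5' ** (mat 1 ** enc5')"
    unfolding enc47_def adj_mult by (simp only: matrix_mul_assoc) (simp add: matrix_mul_assoc[symmetric])
  then show ?thesis by (simp add: enc5'_isometry)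
qed

lemma op47_rm_layer:
  assumes "A1 ** enc15 = enc15 ** m1" "A3 ** enc15 = enc15 ** m3" "A5 ** enc15 = enc15 ** m5"
  shows "op47 A1 m2 A3 m4 A5 ** rm_layer = rm_layer ** op5 m1 m2 m3 m4 m5"
  unfolding op47_def op5_def rm_layer_eq reindex_mult[OF bij_split47] reindex_mult[OF bij_split5] kron5_mult
  by (simp add: assms)

lemma enc47_support:
  assumes "enc47 $ x $ a \<noteq> 0"
  shows "\<exists>l. \<forall>v. ((x (Block1 v) \<noteq> x (Block3 v)) \<noteq> x (Block5 v)) = codeword l a v"
proof -
  have "\<exists>y. rm_layer $ x $ y * enc5' $ y $ a \<noteq> 0"
    using assms unfolding enc47_def mult_nth by (metis (mono_tags, lifting) sum.neutral)
  then obtain y where y: "rm_layer $ x $ y \<noteq> 0" "enc5' $ y $ a \<noteq> 0" by auto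
  then have "enc15 $ (x \<circ> Block1) $ y Q1 \<noteq> 0" "enc15 $ (x \<circ> Block3) $ y Q3 \<noteq> 0" "enc15 $ (x \<circ> Block5) $ y Q5 \<noteq> 0"
    by (auto simp: rm_layer_def)
  then obtain l1 l3 l5 where l: "x \<circ> Block1 = codeword l1 (y Q1)" "x \<circ> Block3 = codeword l3 (y Q3)" "x \<circ> Block5 = codeword l5 (y Q5)"
    using enc15_support by (metis imageE)
  have "((x (Block1 v) \<noteq> x (Block3 v)) \<noteq> x (Block5 v)) = codeword (l1 + l3 + l5) a v" for v
    using fun_cong[OF l(1), of v] fun_cong[OF l(2), of v] fun_cong[OF l(3), of v] enc5'_support[OF y(2)]
      codeword_xor[of l1 "y Q1" v l3 "y Q3"] codeword_xor[of "l1 + l3" "y Q1 \<noteq> y Q3" v l5 "y Q5"]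
    by simp
  then show ?thesis by blast
qed

subsection \<open>Recovery\<close>

type_synonym index15 = "(qubit15 \<Rightarrow> bool) \<times> (qubit15 \<Rightarrow> bool) + (qubit15 \<Rightarrow> bool)"
type_synonym index5 = "(qubit5 \<Rightarrow> bool) \<times> (qubit5 \<Rightarrow> bool) + (qubit5 \<Rightarrow> bool)"
type_synonym index47 = "index15 \<times> index15 \<times> index15 \<times> index5"

text \<open>The decoder \<open>D\<close> removes the error in \<open>A\<close> and leaves the logical gate \<open>m\<close>.\<close>

definition decodes_to :: "(index15 \<Rightarrow> complex ^ (qubit15 \<Rightarrow> bool) ^ bool) \<Rightarrow> (qubit15 \<Rightarrow> bool) op \<Rightarrow> bool op \<Rightarrow> bool" where
  "decodes_to D A m \<longleftrightarrow> (\<forall>s. \<exists>e. D s ** (A ** enc15) = mat e ** m)"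

text \<open>Whatever stands at slot \<open>i\<close> is the right gate followed by the one-qubit
  error \<open>B i ** adj (M i)\<close>; the other slots are right up to scalars. So the outer
  decoder sees the transversal gate and a single error.\<close>

lemma five_decoder_slot:
  fixes D5 :: "index5 \<Rightarrow> complex ^ (qubit5 \<Rightarrow> bool) ^ bool"
  assumes D5: "\<And>s q E. \<exists>e. D5 s ** (local_op q E ** enc5') = mat e"
    and M: "\<And>q. unitary (M q)" "tensor M ** enc5' = mat c ** (enc5' ** G)"
    and B: "\<And>q. q \<noteq> i \<Longrightarrow> \<exists>e. B q = mat e ** M q"
  shows "\<exists>e. D5 t ** (tensor B ** enc5') = mat e ** G"
proof -
  obtain e where e: "\<And>q. q \<noteq> i \<Longrightarrow> B q = mat (e q) ** M q" using B by metis
  define d where "d q = (if q = i then 1 else e q)" for q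
  have "B q = mat (d q) ** ((if q = i then B i ** adj (M i) else mat 1) ** M q)" for q
    using e[of q] unitaryD(1)[OF M(1), of i] by (cases "q = i") (simp_all add: d_def flip: matrix_mul_assoc)
  then have "tensor B = tensor (\<lambda>q. mat (d q) ** ((if q = i then B i ** adj (M i) else mat 1) ** M q))"
    by (intro arg_cong[of _ _ tensor]) (rule ext)
  also have "\<dots> = mat (\<Prod>q\<in>UNIV. d q) ** (local_op i (B i ** adj (M i)) ** tensor M)"
    unfolding tensor_smult local_op_def tensor_mult ..
  finally have "D5 t ** (tensor B ** enc5') =
      D5 t ** (mat (\<Prod>q\<in>UNIV. d q) ** (local_op i (B i ** adj (M i)) ** (tensor M ** enc5')))"
    by (simp only: matrix_mul_assoc)
  also have "\<dots> = mat ((\<Prod>q\<in>UNIV. d q) * c) ** ((D5 t ** (local_op i (B i ** adj (M i)) ** enc5')) ** G)"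
    unfolding M(2) mult_mat_left[of "local_op i _"] mult_mat_left[of "D5 t"] mat_mult_mat_left
    by (simp only: matrix_mul_assoc)
  finally show ?thesis
    using D5[of t i "B i ** adj (M i)"] by auto
qed

text \<open>The interface through which the gate proofs use the recovery, without unfolding the
  decoders. In the last clause nothing is assumed of slot \<open>i\<close>, so the operator there
  may be arbitrary.\<close>

definition recovery_operators ::
  "(index47 \<Rightarrow> (qubit47 \<Rightarrow> bool) op) \<Rightarrow> (index15 \<Rightarrow> complex ^ (qubit15 \<Rightarrow> bool) ^ bool) \<Rightarrow> bool" where
  "recovery_operators Kr D \<longleftrightarrow>
    (\<Sum>k\<in>UNIV. adj (Kr k) ** Kr k) = mat 1 \<and>
    (\<forall>q E. decodes_to D (local_op q E) (mat 1)) \<and>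
    (\<forall>A m. A ** enc15 = enc15 ** m \<longrightarrow> decodes_to D A m) \<and>
    (\<forall>A1 a2 A3 a4 A5 M c G i k.
      (\<forall>q. unitary (M q)) \<longrightarrow> tensor M ** enc5' = mat c ** (enc5' ** G) \<longrightarrow>
      (i \<noteq> Q1 \<longrightarrow> decodes_to D A1 (M Q1)) \<longrightarrow> (i \<noteq> Q2 \<longrightarrow> a2 = M Q2) \<longrightarrow>
      (i \<noteq> Q3 \<longrightarrow> decodes_to D A3 (M Q3)) \<longrightarrow> (i \<noteq> Q4 \<longrightarrow> a4 = M Q4) \<longrightarrow>
      (i \<noteq> Q5 \<longrightarrow> decodes_to D A5 (M Q5)) \<longrightarrow>
      (\<exists>e. Kr k ** op47 A1 a2 A3 a4 A5 ** enc47 = mat e ** (enc47 ** G)))"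

lemma recovery_exists: "\<exists>Kr D. recovery_operators Kr D"
proof -
  obtain D :: "index15 \<Rightarrow> complex ^ (qubit15 \<Rightarrow> bool) ^ bool"
    where D: "(\<Sum>s\<in>UNIV. adj (D s) ** D s) = mat 1" "\<And>s q E. \<exists>e. D s ** (local_op q E ** enc15) = mat e"
    using enc15_decoder by blast
  obtain D5 :: "index5 \<Rightarrow> complex ^ (qubit5 \<Rightarrow> bool) ^ bool"
    where D5: "(\<Sum>s\<in>UNIV. adj (D5 s) ** D5 s) = mat 1" "\<And>s q E. \<exists>e. D5 s ** (local_op q E ** enc5') = mat e"
    using five_decoder by blast
  \<comment> \<open>The recovery decodes the blocks by \<open>L\<close>, decodes the 5'-code by
    \<open>D5\<close>, and encodes the resulting logical qubit again.\<close>
  define L where "L = (\<lambda>s1 s3 s5. reindex split5 split47 (kron5 (D s1) (mat 1) (D s3) (mat 1) (D s5)))"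
  define Kr :: "index47 \<Rightarrow> (qubit47 \<Rightarrow> bool) op" where
    "Kr = (\<lambda>(s1, s3, s5, t). enc47 ** (D5 t ** L s1 s3 s5))"
  have LL: "adj (L s1 s3 s5) ** L s1 s3 s5 =
      reindex split47 split47 (kron5 (adj (D s1) ** D s1) (mat 1) (adj (D s3) ** D s3) (mat 1) (adj (D s5) ** D s5))" for s1 s3 s5
    unfolding L_def adj_reindex adj_kron5 reindex_mult[OF bij_split5] kron5_mult by simp
  have KK: "adj (Kr (s1, s3, s5, t)) ** Kr (s1, s3, s5, t) = adj (L s1 s3 s5) ** (adj (D5 t) ** D5 t) ** L s1 s3 s5" for s1 s3 s5 t
  proof -
    have "adj (Kr (s1, s3, s5, t)) ** Kr (s1, s3, s5, t) =
        adj (L s1 s3 s5) ** (adj (D5 t) ** (adj enc47 ** enc47) ** D5 t) ** L s1 s3 s5"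
      by (simp add: Kr_def adj_mult matrix_mul_assoc)
    then show ?thesis by (simp add: enc47_isometry)
  qed
  have "(\<Sum>k\<in>UNIV. adj (Kr k) ** Kr k) =
      (\<Sum>s1\<in>UNIV. \<Sum>s3\<in>UNIV. \<Sum>s5\<in>UNIV. \<Sum>t\<in>UNIV. adj (Kr (s1, s3, s5, t)) ** Kr (s1, s3, s5, t))"
    by (simp add: sum.cartesian_product split_def flip: UNIV_Times_UNIV)
  also have "\<dots> = (\<Sum>s1\<in>UNIV. \<Sum>s3\<in>UNIV. \<Sum>s5\<in>UNIV. adj (L s1 s3 s5) ** L s1 s3 s5)"
    unfolding KK matrix_sum_left[symmetric] matrix_sum_right[symmetric] D5(1) by simp
  also have "\<dots> = mat 1"
    unfolding LL reindex_sum[symmetric] kron5_sum D(1) kron5_mat_1 by (rule reindex_mat_1[OF bij_is_inj[OF bij_split47]])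
  finally have complete: "(\<Sum>k\<in>UNIV. adj (Kr k) ** Kr k) = mat 1" .
  have local: "decodes_to D (local_op q E) (mat 1)" for q E
    using D(2) by (simp add: decodes_to_def)
  have gate: "decodes_to D A m" if "A ** enc15 = enc15 ** m" for A m
    unfolding decodes_to_def that
  proof
    fix s
    obtain e where "D s ** enc15 = mat e" using D(2)[of s _ "mat 1"] by auto
    then have "D s ** (enc15 ** m) = mat e ** m" by (simp add: matrix_mul_assoc)
    then show "\<exists>e. D s ** (enc15 ** m) = mat e ** m" by blast
  qed
  \<comment> \<open>A decoded block leaves a two-by-two matrix in its slot, so only a question about
    the 5'-code remains.\<close>
  have Kr_op47: "Kr (s1, s3, s5, t) ** op47 A1 a2 A3 a4 A5 ** enc47 =
      enc47 ** (D5 t ** (op5 (D s1 ** (A1 ** enc15)) a2 (D s3 ** (A3 ** enc15)) a4 (D s5 ** (A5 ** enc15)) ** enc5'))"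
    for s1 s3 s5 t A1 a2 A3 a4 A5
  proof -
    have "L s1 s3 s5 ** (op47 A1 a2 A3 a4 A5 ** rm_layer) =
        op5 (D s1 ** (A1 ** enc15)) a2 (D s3 ** (A3 ** enc15)) a4 (D s5 ** (A5 ** enc15))"
      unfolding L_def op47_def op5_def rm_layer_eq reindex_mult[OF bij_split47] kron5_mult by simp
    moreover have "Kr (s1, s3, s5, t) ** op47 A1 a2 A3 a4 A5 ** enc47 =
        enc47 ** (D5 t ** ((L s1 s3 s5 ** (op47 A1 a2 A3 a4 A5 ** rm_layer)) ** enc5'))"
      unfolding Kr_def prod.case enc47_def by (simp only: matrix_mul_assoc)
    ultimately show ?thesis by simp
  qed
  have recover: "\<exists>e. Kr k ** op47 A1 a2 A3 a4 A5 ** enc47 = mat e ** (enc47 ** G)"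
    if M: "\<forall>q. unitary (M q)" "tensor M ** enc5' = mat c ** (enc5' ** G)"
      and A: "i \<noteq> Q1 \<longrightarrow> decodes_to D A1 (M Q1)" "i \<noteq> Q2 \<longrightarrow> a2 = M Q2"
        "i \<noteq> Q3 \<longrightarrow> decodes_to D A3 (M Q3)" "i \<noteq> Q4 \<longrightarrow> a4 = M Q4" "i \<noteq> Q5 \<longrightarrow> decodes_to D A5 (M Q5)"
    for A1 a2 A3 a4 A5 M c G i k
  proof -
    obtain s1 s3 s5 t where k: "k = (s1, s3, s5, t)" by (metis prod_cases4)
    define B where "B q = (case q of Q1 \<Rightarrow> D s1 ** (A1 ** enc15) | Q2 \<Rightarrow> a2 | Q3 \<Rightarrow> D s3 ** (A3 ** enc15)
      | Q4 \<Rightarrow> a4 | Q5 \<Rightarrow> D s5 ** (A5 ** enc15))" for q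
    have triv: "\<exists>e. M q = mat e ** M q" for q by (intro exI[of _ 1]) simp
    have "\<exists>e. B q = mat e ** M q" if "q \<noteq> i" for q
      using A that triv by (cases q) (auto simp: B_def decodes_to_def)
    then obtain e where "D5 t ** (tensor B ** enc5') = mat e ** G"
      using five_decoder_slot[of D5 M c G i B t] D5(2) M by blast
    then have "Kr k ** op47 A1 a2 A3 a4 A5 ** enc47 = mat e ** (enc47 ** G)"
      unfolding k Kr_op47 using op5_tensor[of B] by (simp add: B_def mult_mat_left)
    then show ?thesis by blast
  qed
  show ?thesis
    unfolding recovery_operators_def using complete local gate recover by (intro exI[of _ Kr] exI[of _ D] conjI) blast+
qed

lemma recovery_operatorsD:
  assumes "recovery_operators Kr D"
  shows "(\<Sum>k\<in>UNIV. adj (Kr k) ** Kr k) = mat 1" "decodes_to D (local_op q E) (mat 1)"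
    "A ** enc15 = enc15 ** m \<Longrightarrow> decodes_to D A m"
    "\<lbrakk>\<And>q. unitary (M q); tensor M ** enc5' = mat c ** (enc5' ** G); i \<noteq> Q1 \<Longrightarrow> decodes_to D A1 (M Q1); i \<noteq> Q2 \<Longrightarrow> a2 = M Q2;
      i \<noteq> Q3 \<Longrightarrow> decodes_to D A3 (M Q3); i \<noteq> Q4 \<Longrightarrow> a4 = M Q4; i \<noteq> Q5 \<Longrightarrow> decodes_to D A5 (M Q5)\<rbrakk> \<Longrightarrow>
      \<exists>e. Kr k ** op47 A1 a2 A3 a4 A5 ** enc47 = mat e ** (enc47 ** G)"
  using assms unfolding recovery_operators_def by blast+

lemma recovery_identity:
  assumes "recovery_operators Kr D"
    and "i \<noteq> Q1 \<Longrightarrow> decodes_to D A1 (mat 1)" "i \<noteq> Q2 \<Longrightarrow> a2 = mat 1"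
    "i \<noteq> Q3 \<Longrightarrow> decodes_to D A3 (mat 1)" "i \<noteq> Q4 \<Longrightarrow> a4 = mat 1" "i \<noteq> Q5 \<Longrightarrow> decodes_to D A5 (mat 1)"
  shows "\<exists>e. Kr k ** op47 A1 a2 A3 a4 A5 ** enc47 = mat e ** enc47"
  using recovery_operatorsD(4)[OF assms(1), of "\<lambda>_. mat 1" 1 "mat 1" i A1 a2 A3 a4 A5 k] assms(2-)
  by (simp add: unitary_mat_1 tensor_mat_1)

lemma decodes_to_mat_1: "recovery_operators Kr D \<Longrightarrow> decodes_to D (mat 1) (mat 1)"
  by (rule recovery_operatorsD(3)) simp_all

lemma local_op_47:
  "local_op (Block1 v) P = op47 (local_op v P) (mat 1) (mat 1) (mat 1) (mat 1)"
  "local_op Bare2 P = op47 (mat 1) P (mat 1) (mat 1) (mat 1)"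
  "local_op (Block3 v) P = op47 (mat 1) (mat 1) (local_op v P) (mat 1) (mat 1)"
  "local_op Bare4 P = op47 (mat 1) (mat 1) (mat 1) P (mat 1)"
  "local_op (Block5 v) P = op47 (mat 1) (mat 1) (mat 1) (mat 1) (local_op v P)"
  unfolding local_op_def[of "Block1 v"] local_op_def[of "Bare2"] local_op_def[of "Block3 v"] local_op_def[of "Bare4"]
    local_op_def[of "Block5 v"] op47_tensor[symmetric]
  by (simp_all add: tensor_mat_1 local_op_def)

lemma recovery_local_op:
  assumes "recovery_operators Kr D"
  shows "\<exists>e. Kr k ** local_op p P ** enc47 = mat e ** enc47"
  \<comment> \<open>An error in a block is removed by the inner decoder, so \<open>Q1\<close> serves
    for all three blocks. An error on a bare qubit is left to the 5'-code, with that qubit as slot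
    \<open>i\<close>.\<close>
  using recovery_identity[OF assms, where i = Q1] recovery_identity[OF assms, where i = Q2]
    recovery_identity[OF assms, where i = Q4] decodes_to_mat_1[OF assms] recovery_operatorsD(2)[OF assms]
  by (cases p) (simp_all add: local_op_47)

text \<open>
  The diagonal gates used below spread an error only within such a column, which has at most one
  qubit in each Reed-Muller block.
\<close>

definition error_column :: "qubit47 \<Rightarrow> qubit47 set" where
  "error_column p = (case p of Block1 v \<Rightarrow> {Block1 v, Block3 v, Block5 v} | Block3 v \<Rightarrow> {Block1 v, Block3 v, Block5 v}
     | Block5 v \<Rightarrow> {Block1 v, Block3 v, Block5 v} | Bare2 \<Rightarrow> {Bare2} | Bare4 \<Rightarrow> {Bare4})"

text \<open>For fixed \<open>B\<close> these operators span the operators that act on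
  \<open>B\<close> alone, and they factor over the blocks.\<close>

definition unit_on :: "'q::finite set \<Rightarrow> ('q \<Rightarrow> bool) \<Rightarrow> ('q \<Rightarrow> bool) \<Rightarrow> ('q \<Rightarrow> bool) op" where
  "unit_on B a b = tensor (\<lambda>q. if q \<in> B then matrix_unit (a q) (b q) else mat 1)"

text \<open>Each of the three inner decoders meets at most one error, so they all succeed; a column
  that is a single bare qubit is left to the outer code.\<close>

lemma recovery_error_column:
  assumes "recovery_operators Kr D"
  shows "\<exists>e. Kr k ** unit_on (error_column p) a b ** enc47 = mat e ** enc47"
proof -
  have "(\<exists>v. error_column p = {Block1 v, Block3 v, Block5 v}) \<or> (\<exists>q. error_column p = {q})"
    by (cases p) (auto simp: error_column_def)
  then show ?thesis
  proof (elim disjE exE)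
    fix v assume v: "error_column p = {Block1 v, Block3 v, Block5 v}"
    have "unit_on (error_column p) a b = op47 (local_op v (matrix_unit (a (Block1 v)) (b (Block1 v)))) (mat 1)
        (local_op v (matrix_unit (a (Block3 v)) (b (Block3 v)))) (mat 1)
        (local_op v (matrix_unit (a (Block5 v)) (b (Block5 v))))"
    proof -
      have l: "tensor (\<lambda>w. if w = v then matrix_unit (f w) (g w) else mat 1) = local_op v (matrix_unit (f v) (g v))" for f g
        unfolding local_op_def by (rule arg_cong[of _ _ tensor]) auto
      show ?thesis
        unfolding unit_on_def op47_tensor[symmetric] v by (simp add: l)
    qed
    then show ?thesis
      using recovery_identity[OF assms, where i = Q1] decodes_to_mat_1[OF assms] recovery_operatorsD(2)[OF assms] by simp
  next
    fix q assume q: "error_column p = {q}"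
    have "unit_on (error_column p) a b = local_op q (matrix_unit (a q) (b q))"
      unfolding unit_on_def local_op_def q by (rule arg_cong[of _ _ tensor]) auto
    then show ?thesis using recovery_local_op[OF assms] by simp
  qed
qed

subsection \<open>The gate K\<close>

text \<open>No gate of the circuit for \<open>K\<close> couples different slots. Stored as tuples,
  the gates form five independent circuits that can be read off slot by slot.\<close>

type_synonym blocks = "(qubit15 \<Rightarrow> bool) op \<times> bool op \<times> (qubit15 \<Rightarrow> bool) op \<times> bool op \<times> (qubit15 \<Rightarrow> bool) op"

definition blocks_op :: "blocks \<Rightarrow> (qubit47 \<Rightarrow> bool) op" where
  "blocks_op g = op47 (fst g) (fst (snd g)) (fst (snd (snd g))) (fst (snd (snd (snd g)))) (snd (snd (snd (snd g))))"

lemma circuit_op_blocks: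
  "circuit_op (map blocks_op gs) = op47 (circuit_op (map fst gs)) (circuit_op (map (\<lambda>g. fst (snd g)) gs))
     (circuit_op (map (\<lambda>g. fst (snd (snd g))) gs)) (circuit_op (map (\<lambda>g. fst (snd (snd (snd g)))) gs))
     (circuit_op (map (\<lambda>g. snd (snd (snd (snd g)))) gs))"
  by (induction gs) (simp_all add: op47_mat_1 op47_mult blocks_op_def)

lemma circuit_op_tensor: "circuit_op (map (\<lambda>g. tensor (\<lambda>_. f g)) gs) = tensor (\<lambda>_. circuit_op (map f gs))"
  by (induction gs) (simp_all add: tensor_mat_1 tensor_mult)

lemma circuit_op_mat_1: "circuit_op (map (\<lambda>_. mat 1) gs) = mat 1"
  by (induction gs) simp_all

text \<open>An error inserted into the circuit is invisible in every slot where its component is the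
  identity.\<close>

lemma circuit_op_insert:
  assumes "f g = mat 1"
  shows "circuit_op (map f (take k gs @ g # drop k gs)) = circuit_op (map f gs)"
proof -
  have "circuit_op (map f (take k gs @ g # drop k gs)) = circuit_op (map f (take k gs @ drop k gs))"
    by (simp only: map_append list.map circuit_op_append circuit_op.simps assms matrix_mul_rid)
  then show ?thesis by simp
qed

lemma all_qubit47:
  "(\<forall>q. P q) \<longleftrightarrow> (\<forall>v. P (Block1 v)) \<and> P Bare2 \<and> (\<forall>v. P (Block3 v)) \<and> P Bare4 \<and> (\<forall>v. P (Block5 v))"
  by (metis qubit47.exhaust)

lemma acts_within_op47:
  assumes "acts_within A W"
  shows "acts_within (Block1 ` A) (op47 W (mat 1) (mat 1) (mat 1) (mat 1))"
    "acts_within (Block3 ` A) (op47 (mat 1) (mat 1) W (mat 1) (mat 1))"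
    "acts_within (Block5 ` A) (op47 (mat 1) (mat 1) (mat 1) (mat 1) W)"
proof -
  have W: "W $ x $ y = (if \<forall>p. p \<notin> A \<longrightarrow> x p = y p then W $ (\<lambda>p. p \<in> A \<and> x p) $ (\<lambda>p. p \<in> A \<and> y p) else 0)" for x y
    using assms unfolding acts_within_def by blast
  have r: "(\<lambda>p. p \<in> Block1 ` A \<and> x p) \<circ> Block1 = (\<lambda>p. p \<in> A \<and> (x \<circ> Block1) p)"
    "(\<lambda>p. p \<in> Block1 ` A \<and> x p) \<circ> Block3 = (\<lambda>_. False)" "(\<lambda>p. p \<in> Block1 ` A \<and> x p) \<circ> Block5 = (\<lambda>_. False)"
    "(\<lambda>p. p \<in> Block3 ` A \<and> x p) \<circ> Block3 = (\<lambda>p. p \<in> A \<and> (x \<circ> Block3) p)"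
    "(\<lambda>p. p \<in> Block3 ` A \<and> x p) \<circ> Block1 = (\<lambda>_. False)" "(\<lambda>p. p \<in> Block3 ` A \<and> x p) \<circ> Block5 = (\<lambda>_. False)"
    "(\<lambda>p. p \<in> Block5 ` A \<and> x p) \<circ> Block5 = (\<lambda>p. p \<in> A \<and> (x \<circ> Block5) p)"
    "(\<lambda>p. p \<in> Block5 ` A \<and> x p) \<circ> Block1 = (\<lambda>_. False)" "(\<lambda>p. p \<in> Block5 ` A \<and> x p) \<circ> Block3 = (\<lambda>_. False)" for x
    by (auto simp: fun_eq_iff)
  have mem: "Block1 v \<in> Block1 ` A \<longleftrightarrow> v \<in> A" "Block3 v \<in> Block3 ` A \<longleftrightarrow> v \<in> A" "Block5 v \<in> Block5 ` A \<longleftrightarrow> v \<in> A"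
    "Block1 v \<in> Block3 ` A \<longleftrightarrow> False" "Block1 v \<in> Block5 ` A \<longleftrightarrow> False" "Block3 v \<in> Block1 ` A \<longleftrightarrow> False"
    "Block3 v \<in> Block5 ` A \<longleftrightarrow> False" "Block5 v \<in> Block1 ` A \<longleftrightarrow> False" "Block5 v \<in> Block3 ` A \<longleftrightarrow> False"
    "Bare2 \<in> Block1 ` A \<longleftrightarrow> False" "Bare2 \<in> Block3 ` A \<longleftrightarrow> False" "Bare2 \<in> Block5 ` A \<longleftrightarrow> False"
    "Bare4 \<in> Block1 ` A \<longleftrightarrow> False" "Bare4 \<in> Block3 ` A \<longleftrightarrow> False" "Bare4 \<in> Block5 ` A \<longleftrightarrow> False" for v
    by auto
  have q: "(\<forall>p. p \<notin> Block1 ` A \<longrightarrow> x p = y p) \<longleftrightarrow> (\<forall>p. p \<notin> A \<longrightarrow> (x \<circ> Block1) p = (y \<circ> Block1) p) \<and> x Bare2 = y Bare2 \<and>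
      x \<circ> Block3 = y \<circ> Block3 \<and> x Bare4 = y Bare4 \<and> x \<circ> Block5 = y \<circ> Block5"
    "(\<forall>p. p \<notin> Block3 ` A \<longrightarrow> x p = y p) \<longleftrightarrow> (\<forall>p. p \<notin> A \<longrightarrow> (x \<circ> Block3) p = (y \<circ> Block3) p) \<and> x Bare2 = y Bare2 \<and>
      x \<circ> Block1 = y \<circ> Block1 \<and> x Bare4 = y Bare4 \<and> x \<circ> Block5 = y \<circ> Block5"
    "(\<forall>p. p \<notin> Block5 ` A \<longrightarrow> x p = y p) \<longleftrightarrow> (\<forall>p. p \<notin> A \<longrightarrow> (x \<circ> Block5) p = (y \<circ> Block5) p) \<and> x Bare2 = y Bare2 \<and>
      x \<circ> Block1 = y \<circ> Block1 \<and> x Bare4 = y Bare4 \<and> x \<circ> Block3 = y \<circ> Block3" for x y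
    unfolding all_qubit47 mem fun_eq_iff o_apply simp_thms by (simp_all only: conj_ac)
  show "acts_within (Block1 ` A) (op47 W (mat 1) (mat 1) (mat 1) (mat 1))"
    unfolding acts_within_def
  proof (intro allI)
    fix x y
    show "op47 W (mat 1) (mat 1) (mat 1) (mat 1) $ x $ y = (if \<forall>p. p \<notin> Block1 ` A \<longrightarrow> x p = y p
      then op47 W (mat 1) (mat 1) (mat 1) (mat 1) $ (\<lambda>p. p \<in> Block1 ` A \<and> x p) $ (\<lambda>p. p \<in> Block1 ` A \<and> y p) else 0)"
      unfolding op47_nth r q by (subst W) (auto simp: mat_nth)
  qed
  show "acts_within (Block3 ` A) (op47 (mat 1) (mat 1) W (mat 1) (mat 1))"
    unfolding acts_within_def
  proof (intro allI)
    fix x y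
    show "op47 (mat 1) (mat 1) W (mat 1) (mat 1) $ x $ y = (if \<forall>p. p \<notin> Block3 ` A \<longrightarrow> x p = y p
      then op47 (mat 1) (mat 1) W (mat 1) (mat 1) $ (\<lambda>p. p \<in> Block3 ` A \<and> x p) $ (\<lambda>p. p \<in> Block3 ` A \<and> y p) else 0)"
      unfolding op47_nth r q by (subst W) (auto simp: mat_nth)
  qed
  show "acts_within (Block5 ` A) (op47 (mat 1) (mat 1) (mat 1) (mat 1) W)"
    unfolding acts_within_def
  proof (intro allI)
    fix x y
    show "op47 (mat 1) (mat 1) (mat 1) (mat 1) W $ x $ y = (if \<forall>p. p \<notin> Block5 ` A \<longrightarrow> x p = y p
      then op47 (mat 1) (mat 1) (mat 1) (mat 1) W $ (\<lambda>p. p \<in> Block5 ` A \<and> x p) $ (\<lambda>p. p \<in> Block5 ` A \<and> y p) else 0)"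
      unfolding op47_nth r q by (subst W) (auto simp: mat_nth)
  qed
qed

lemma acts_on_one_block:
  assumes "acts_within B W"
  shows "acts_on (UNIV \<times> B) (tensor (\<lambda>_ :: 1. W))"
proof -
  have W: "W $ x $ y = (if \<forall>p. p \<notin> B \<longrightarrow> x p = y p then W $ (\<lambda>p. p \<in> B \<and> x p) $ (\<lambda>p. p \<in> B \<and> y p) else 0)" for x y
    using assms unfolding acts_within_def by blast
  have one: "(\<forall>j :: 1. Q j) \<longleftrightarrow> Q 1" for Q by (metis num1_eq1)
  show ?thesis
    unfolding acts_on_def
  proof (intro allI)
    fix x y :: "1 \<Rightarrow> 'a \<Rightarrow> bool"
    show "tensor (\<lambda>_. W) $ x $ y = (if \<forall>j p. (j, p) \<notin> UNIV \<times> B \<longrightarrow> x j p = y j p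
        then tensor (\<lambda>_. W) $ (\<lambda>j p. (j, p) \<in> UNIV \<times> B \<and> x j p) $ (\<lambda>j p. (j, p) \<in> UNIV \<times> B \<and> y j p) else 0)"
      unfolding one by (simp add: tensor_nth UNIV_1 W[of "x 1" "y 1"]) auto
  qed
qed

lemma fault_tolerant_K:
  assumes rec: "recovery_operators Kr D"
  shows "fault_tolerant (kraus Kr) (on_one_qubit gate_K)"
proof -
  let ?ok = "\<lambda>L m. (\<forall>W\<in>set L. unitary W \<and> (\<exists>A. card A \<le> 3 \<and> acts_within A W)) \<and> circuit_op L ** enc15 = enc15 ** m"
  note gate = enc15_logical_gate[OF unitary_five_K]
  obtain L1 where L1: "?ok L1 (five_K Q1)" using gate by (rule exE)
  obtain L3 where L3: "?ok L3 (five_K Q3)" using gate by (rule exE)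
  obtain L5 where L5: "?ok L5 (five_K Q5)" using gate by (rule exE)
  note L = L1 L3 L5
  define gs :: "blocks list" where
    "gs = map (\<lambda>W. (W, mat 1, mat 1, mat 1, mat 1)) L1 @ map (\<lambda>W. (mat 1, mat 1, W, mat 1, mat 1)) L3 @
      map (\<lambda>W. (mat 1, mat 1, mat 1, mat 1, W)) L5 @
      [(mat 1, five_K Q2, mat 1, mat 1, mat 1), (mat 1, mat 1, mat 1, five_K Q4, mat 1)]"
  have comp: "circuit_op (map fst gs) = circuit_op L1" "circuit_op (map (\<lambda>g. fst (snd g)) gs) = five_K Q2"
    "circuit_op (map (\<lambda>g. fst (snd (snd g))) gs) = circuit_op L3"
    "circuit_op (map (\<lambda>g. fst (snd (snd (snd g)))) gs) = five_K Q4"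
    "circuit_op (map (\<lambda>g. snd (snd (snd (snd g)))) gs) = circuit_op L5"
    by (simp_all add: gs_def circuit_op_append circuit_op_mat_1 o_def)
  obtain c where c: "cmod c = 1" "tensor five_K ** enc5' = mat c ** (enc5' ** gate_K)"
    using enc5'_gate_K by blast
  let ?Ws = "map (\<lambda>g. tensor (\<lambda>_ :: 1. blocks_op g)) gs"
  have total: "circuit_op (map blocks_op gs) ** enc47 = mat c ** (enc47 ** gate_K)"
  proof -
    have "circuit_op (map blocks_op gs) ** enc47 = (op47 (circuit_op L1) (five_K Q2) (circuit_op L3) (five_K Q4) (circuit_op L5) ** rm_layer) ** enc5'"
      unfolding circuit_op_blocks comp enc47_def by (simp only: matrix_mul_assoc)
    also have "\<dots> = rm_layer ** (tensor five_K ** enc5')"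
      using L by (simp add: op47_rm_layer op5_tensor matrix_mul_assoc)
    finally show ?thesis
      unfolding c(2) mult_mat_left[of rm_layer] enc47_def by (simp only: matrix_mul_assoc)
  qed
  have G: "tensor (\<lambda>_ :: 1. mat e ** (enc47 ** gate_K)) = mat e ** (tensor (\<lambda>_. enc47) ** on_one_qubit gate_K)" for e
    unfolding on_one_qubit_def tensor_mult tensor_smult by (simp add: UNIV_1)
  show ?thesis
  proof (rule fault_tolerantI[OF recovery_operatorsD(1)[OF rec] enc47_isometry _ _ c(1)])
    show "unitary (on_one_qubit gate_K)" unfolding on_one_qubit_def by (rule unitary_tensor[OF unitary_gate_K])
    show "unitary W \<and> (\<exists>A. card A \<le> 3 \<and> acts_on A W)" if "W \<in> set ?Ws" for W
    proof -
      obtain g where g: "g \<in> set gs" "W = tensor (\<lambda>_ :: 1. blocks_op g)" using \<open>W \<in> set ?Ws\<close> by auto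
      have "unitary (blocks_op g) \<and> (\<exists>B. card B \<le> 3 \<and> acts_within B (blocks_op g))"
        using g(1) unfolding gs_def set_append set_map Un_iff
      proof (elim disjE imageE)
        fix W assume "g = (W, mat 1, mat 1, mat 1, mat 1)" "W \<in> set L1"
        moreover obtain A where "card A \<le> 3" "acts_within A W" using L(1) \<open>W \<in> set L1\<close> by blast
        ultimately show ?thesis
          using L(1) acts_within_op47(1)[of A W] card_image_le[of A Block1]
          by (auto simp: blocks_op_def unitary_op47 unitary_mat_1 intro!: exI[of _ "Block1 ` A"])
      next
        fix W assume "g = (mat 1, mat 1, W, mat 1, mat 1)" "W \<in> set L3"
        moreover obtain A where "card A \<le> 3" "acts_within A W" using L(2) \<open>W \<in> set L3\<close> by blast
        ultimately show ?thesis
          using L(2) acts_within_op47(2)[of A W] card_image_le[of A Block3]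
          by (auto simp: blocks_op_def unitary_op47 unitary_mat_1 intro!: exI[of _ "Block3 ` A"])
      next
        fix W assume "g = (mat 1, mat 1, mat 1, mat 1, W)" "W \<in> set L5"
        moreover obtain A where "card A \<le> 3" "acts_within A W" using L(3) \<open>W \<in> set L5\<close> by blast
        ultimately show ?thesis
          using L(3) acts_within_op47(3)[of A W] card_image_le[of A Block5]
          by (auto simp: blocks_op_def unitary_op47 unitary_mat_1 intro!: exI[of _ "Block5 ` A"])
      next
        assume "g \<in> set [(mat 1, five_K Q2, mat 1, mat 1, mat 1), (mat 1, mat 1, mat 1, five_K Q4, mat 1)]"
        then obtain p q where "blocks_op g = local_op p (five_K q)"
          by (auto simp: blocks_op_def local_op_47(2,4)[symmetric])
        then show ?thesis
          using acts_within_local_op[of p "five_K q"] unitary_local_op[OF unitary_five_K] by (auto intro!: exI[of _ "{p}"])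
      qed
      then obtain B where "unitary (blocks_op g)" "card B \<le> 3" "acts_within B (blocks_op g)" by blast
      then show ?thesis
        using acts_on_one_block[of B "blocks_op g"]
        by (auto simp: g(2) unitary_tensor card_cartesian_product intro!: exI[of _ "UNIV \<times> B"])
    qed
    show "circuit_op ?Ws ** tensor (\<lambda>_ :: 1. enc47) = mat c ** (tensor (\<lambda>_. enc47) ** on_one_qubit gate_K)"
      unfolding circuit_op_tensor[of blocks_op] tensor_mult total by (rule G)
    fix k j p P and \<kappa> :: "1 \<Rightarrow> index47"
    define g :: blocks where "g = (case p of Block1 v \<Rightarrow> (local_op v P, mat 1, mat 1, mat 1, mat 1)
      | Bare2 \<Rightarrow> (mat 1, P, mat 1, mat 1, mat 1) | Block3 v \<Rightarrow> (mat 1, mat 1, local_op v P, mat 1, mat 1)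
      | Bare4 \<Rightarrow> (mat 1, mat 1, mat 1, P, mat 1) | Block5 v \<Rightarrow> (mat 1, mat 1, mat 1, mat 1, local_op v P))"
    \<comment> \<open>The slot of the damaged qubit. The circuit on it may spread the error over the
      whole block.\<close>
    define i where "i = (case p of Block1 v \<Rightarrow> Q1 | Bare2 \<Rightarrow> Q2 | Block3 v \<Rightarrow> Q3 | Bare4 \<Rightarrow> Q4 | Block5 v \<Rightarrow> Q5)"
    have g: "local_op p P = blocks_op g"
      by (cases p) (simp_all add: g_def blocks_op_def local_op_47)
    have gi: "i \<noteq> Q1 \<Longrightarrow> fst g = mat 1" "i \<noteq> Q2 \<Longrightarrow> fst (snd g) = mat 1" "i \<noteq> Q3 \<Longrightarrow> fst (snd (snd g)) = mat 1"
      "i \<noteq> Q4 \<Longrightarrow> fst (snd (snd (snd g))) = mat 1" "i \<noteq> Q5 \<Longrightarrow> snd (snd (snd (snd g))) = mat 1"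
      by (cases p; simp add: g_def i_def)+
    \<comment> \<open>The error is treated as one more gate, placed after the first \<open>k\<close>
      gates.\<close>
    let ?hs = "take k gs @ g # drop k gs"
    have "\<exists>e. Kr (\<kappa> 1) ** circuit_op (map blocks_op ?hs) ** enc47 = mat e ** (enc47 ** gate_K)"
      unfolding circuit_op_blocks
    proof (rule recovery_operatorsD(4)[OF rec unitary_five_K c(2), of i])
      show "decodes_to D (circuit_op (map fst ?hs)) (five_K Q1)" if "i \<noteq> Q1"
        unfolding circuit_op_insert[of fst, OF gi(1)[OF that]] comp using L(1) by (intro recovery_operatorsD(3)[OF rec]) simp
      show "circuit_op (map (\<lambda>g. fst (snd g)) ?hs) = five_K Q2" if "i \<noteq> Q2"
        using circuit_op_insert[of "\<lambda>g. fst (snd g)", OF gi(2)[OF that]] comp by simp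
      show "decodes_to D (circuit_op (map (\<lambda>g. fst (snd (snd g))) ?hs)) (five_K Q3)" if "i \<noteq> Q3"
        unfolding circuit_op_insert[of "\<lambda>g. fst (snd (snd g))", OF gi(3)[OF that]] comp
        using L(2) by (intro recovery_operatorsD(3)[OF rec]) simp
      show "circuit_op (map (\<lambda>g. fst (snd (snd (snd g)))) ?hs) = five_K Q4" if "i \<noteq> Q4"
        using circuit_op_insert[of "\<lambda>g. fst (snd (snd (snd g)))", OF gi(4)[OF that]] comp by simp
      show "decodes_to D (circuit_op (map (\<lambda>g. snd (snd (snd (snd g)))) ?hs)) (five_K Q5)" if "i \<noteq> Q5"
        unfolding circuit_op_insert[of "\<lambda>g. snd (snd (snd (snd g)))", OF gi(5)[OF that]] comp
        using L(3) by (intro recovery_operatorsD(3)[OF rec]) simp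
    qed
    then obtain e where e: "Kr (\<kappa> 1) ** circuit_op (map blocks_op ?hs) ** enc47 = mat e ** (enc47 ** gate_K)" by blast
    have one: "(i :: 1) = 1" for i by (rule num1_eq1)
    have err: "local_op j (local_op p P) = tensor (\<lambda>_ :: 1. blocks_op g)"
      unfolding g local_op_def[of j] using one by (intro arg_cong[of _ _ tensor] ext) metis
    have "tensor (\<lambda>j. Kr (\<kappa> j)) ** circuit_op (drop k ?Ws) ** local_op j (local_op p P) ** circuit_op (take k ?Ws) **
        tensor (\<lambda>_. enc47) = tensor (\<lambda>j. Kr (\<kappa> j) ** circuit_op (map blocks_op ?hs) ** enc47)"
      unfolding drop_map take_map circuit_op_tensor[of blocks_op] err tensor_mult
      by (simp add: circuit_op_append matrix_mul_assoc)
    also have "(\<lambda>j. Kr (\<kappa> j) ** circuit_op (map blocks_op ?hs) ** enc47) = (\<lambda>_. mat e ** (enc47 ** gate_K))"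
    proof
      show "Kr (\<kappa> j) ** circuit_op (map blocks_op ?hs) ** enc47 = mat e ** (enc47 ** gate_K)" for j
        unfolding one[of j] by (rule e)
    qed
    finally show "\<exists>e. tensor (\<lambda>j. Kr (\<kappa> j)) ** circuit_op (drop k ?Ws) ** local_op j (local_op p P) ** circuit_op (take k ?Ws) **
        tensor (\<lambda>_. enc47) = mat e ** (tensor (\<lambda>_. enc47) ** on_one_qubit gate_K)"
      unfolding G by (rule exI)
  qed
qed

subsection \<open>Diagonal gates\<close>

definition diag_op :: "('b \<Rightarrow> complex) \<Rightarrow> 'b::finite op" where
  "diag_op f = (\<chi> x y. if x = y then f x else 0)"

definition restrict_to :: "('r \<times> 'p) set \<Rightarrow> ('r \<Rightarrow> 'p \<Rightarrow> bool) \<Rightarrow> 'r \<Rightarrow> 'p \<Rightarrow> bool" where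
  "restrict_to A x = (\<lambda>j p. (j, p) \<in> A \<and> x j p)"

lemma diag_op_mult_nth: "(diag_op f ** M) $ x $ y = f x * M $ x $ y" "(N ** diag_op g) $ u $ w = N $ u $ w * g w"
  by (simp_all add: diag_op_def mult_nth if_mult_sum)

lemma circuit_op_diag: "circuit_op (map diag_op fs) = diag_op (\<lambda>x. prod_list (map (\<lambda>f. f x) fs))"
proof (induction fs)
  case Nil
  show ?case by (rule matrix_ext) (simp add: diag_op_def mat_nth)
next
  case (Cons f fs)
  show ?case
    unfolding list.map circuit_op.simps Cons
    by (rule matrix_ext, unfold diag_op_mult_nth) (auto simp: diag_op_def)
qed

lemma unitary_diag_op: "(\<And>x. cmod (f x) = 1) \<Longrightarrow> unitary (diag_op f)"
proof -
  assume f: "\<And>x. cmod (f x) = 1"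
  have n: "f x * cnj (f x) = 1" for x using f[of x] by (simp add: complex_norm_square[symmetric])
  have "adj (diag_op f) = diag_op (\<lambda>x. cnj (f x))" by (rule matrix_ext) (auto simp: diag_op_def)
  moreover have "diag_op (\<lambda>x. cnj (f x)) ** diag_op f = mat 1" "diag_op f ** diag_op (\<lambda>x. cnj (f x)) = mat 1"
    by (rule matrix_ext, simp add: diag_op_mult_nth, simp add: diag_op_def mat_nth n mult.commute)+
  ultimately show ?thesis by (simp add: unitary_def)
qed

lemma restrict_to_eq_iff: "restrict_to A x = restrict_to A y \<longleftrightarrow> (\<forall>j p. (j, p) \<in> A \<longrightarrow> x j p = y j p)"
  by (auto simp: restrict_to_def fun_eq_iff)

lemma acts_on_diag_op:
  assumes "\<And>x. f x = f (restrict_to A x)"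
  shows "acts_on A (diag_op f)"
  unfolding acts_on_def
proof (intro allI)
  fix x y
  have i: "(if P \<and> Q then z else 0) = (if P then if Q then z else 0 else (0 :: complex))" for P Q z
    by simp
  have e: "x = y \<longleftrightarrow> (\<forall>j p. (j, p) \<notin> A \<longrightarrow> x j p = y j p) \<and> restrict_to A x = restrict_to A y"
  proof
    assume "(\<forall>j p. (j, p) \<notin> A \<longrightarrow> x j p = y j p) \<and> restrict_to A x = restrict_to A y"
    then show "x = y" unfolding restrict_to_eq_iff by (intro ext) blast
  qed simp
  show "diag_op f $ x $ y = (if \<forall>j p. (j, p) \<notin> A \<longrightarrow> x j p = y j p
      then diag_op f $ (\<lambda>j p. (j, p) \<in> A \<and> x j p) $ (\<lambda>j p. (j, p) \<in> A \<and> y j p) else 0)"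
    unfolding diag_op_def vec_lambda_beta restrict_to_def[symmetric] e i assms[of x, symmetric] ..
qed

text \<open>
  The operator \<open>X\<close> is a linear combination of tensor products of matrix units on \<open>B\<close>, one factor
  for every block.
\<close>

lemma acts_on_error:
  fixes K :: "'r::finite \<Rightarrow> ('p::finite \<Rightarrow> bool) op" and V :: "complex ^ 'c::finite ^ ('p \<Rightarrow> bool)"
  assumes X: "acts_on (UNIV \<times> B) X" and e: "\<And>j a b. \<exists>e. K j ** unit_on B a b ** V = mat e ** V"
  shows "\<exists>e. tensor K ** X ** tensor (\<lambda>_. V) = mat e ** tensor (\<lambda>_. V)"
proof -
  let ?C = "UNIV \<times> B :: ('r \<times> 'p) set"
  \<comment> \<open>Only representatives that are False off \<open>?C\<close> carry a coefficient,
    so that each product of matrix units is counted once.\<close>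
  let ?c = "\<lambda>a b. if a = restrict_to ?C a \<and> b = restrict_to ?C b then X $ a $ b else 0"
  have unit: "tensor (\<lambda>j. unit_on B (a j) (b j)) $ x $ y =
      (if (\<forall>j p. p \<in> B \<longrightarrow> x j p = a j p \<and> y j p = b j p) \<and> (\<forall>j p. p \<notin> B \<longrightarrow> x j p = y j p) then 1 else 0)" for a b x y
  proof -
    have u: "unit_on B (a j) (b j) $ x j $ y j = (if \<forall>p. (p \<in> B \<longrightarrow> x j p = a j p \<and> y j p = b j p) \<and> (p \<notin> B \<longrightarrow> x j p = y j p) then 1 else 0)" for j
    proof -
      have "unit_on B (a j) (b j) $ x j $ y j = (\<Prod>p\<in>UNIV. if (p \<in> B \<longrightarrow> x j p = a j p \<and> y j p = b j p) \<and> (p \<notin> B \<longrightarrow> x j p = y j p) then 1 else 0)"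
        unfolding unit_on_def tensor_nth by (intro prod.cong refl) (auto simp: matrix_unit_nth mat_nth)
      then show ?thesis unfolding prod_indicator .
    qed
    show ?thesis unfolding tensor_nth u prod_indicator by (intro if_cong) auto
  qed
  have "X = (\<Sum>a\<in>UNIV. \<Sum>b\<in>UNIV. mat (?c a b) ** tensor (\<lambda>j. unit_on B (a j) (b j)))"
  proof (rule matrix_ext)
    fix x y
    have "(\<Sum>a\<in>UNIV. \<Sum>b\<in>UNIV. mat (?c a b) ** tensor (\<lambda>j. unit_on B (a j) (b j))) $ x $ y =
        (\<Sum>a\<in>UNIV. \<Sum>b\<in>UNIV. ?c a b * tensor (\<lambda>j. unit_on B (a j) (b j)) $ x $ y)"
      by simp
    also have "\<dots> = (\<Sum>a\<in>UNIV. if a = restrict_to ?C x then (\<Sum>b\<in>UNIV. if b = restrict_to ?C y then X $ x $ y else 0) else 0)"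
    proof (intro sum.cong refl)
      fix a
      have "?c a b * tensor (\<lambda>j. unit_on B (a j) (b j)) $ x $ y =
          (if a = restrict_to ?C x \<and> b = restrict_to ?C y then X $ x $ y else 0)" for b
      proof (cases "a = restrict_to ?C x \<and> b = restrict_to ?C y")
        case True
        moreover have "restrict_to ?C (restrict_to ?C z) = restrict_to ?C z" for z :: "'r \<Rightarrow> 'p \<Rightarrow> bool"
          by (auto simp: restrict_to_def)
        moreover have "(\<forall>j p. p \<in> B \<longrightarrow> x j p = restrict_to ?C x j p \<and> y j p = restrict_to ?C y j p)"
          by (auto simp: restrict_to_def)
        moreover have "X $ x $ y = (if \<forall>j p. p \<notin> B \<longrightarrow> x j p = y j p then X $ restrict_to ?C x $ restrict_to ?C y else 0)"
        proof -
          have c: "(\<forall>j p. (j, p) \<notin> ?C \<longrightarrow> x j p = y j p) \<longleftrightarrow> (\<forall>j p. p \<notin> B \<longrightarrow> x j p = y j p)" by auto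
          show ?thesis
            using X[unfolded acts_on_def, rule_format, of x y] unfolding c restrict_to_def .
        qed
        ultimately show ?thesis unfolding unit by auto
      next
        case False
        have "\<not> (a = restrict_to ?C a \<and> b = restrict_to ?C b \<and> (\<forall>j p. p \<in> B \<longrightarrow> x j p = a j p \<and> y j p = b j p))"
        proof
          assume h: "a = restrict_to ?C a \<and> b = restrict_to ?C b \<and> (\<forall>j p. p \<in> B \<longrightarrow> x j p = a j p \<and> y j p = b j p)"
          then have "restrict_to ?C a = restrict_to ?C x" "restrict_to ?C b = restrict_to ?C y"
            unfolding restrict_to_eq_iff by auto
          then show False using h False by simp
        qed
        then show ?thesis using False unfolding unit by auto
      qed
      then have "(\<Sum>b\<in>UNIV. ?c a b * tensor (\<lambda>j. unit_on B (a j) (b j)) $ x $ y) =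
          (\<Sum>b\<in>UNIV. if a = restrict_to ?C x \<and> b = restrict_to ?C y then X $ x $ y else 0)"
        by (intro sum.cong refl)
      then show "(\<Sum>b\<in>UNIV. ?c a b * tensor (\<lambda>j. unit_on B (a j) (b j)) $ x $ y) =
          (if a = restrict_to ?C x then (\<Sum>b\<in>UNIV. if b = restrict_to ?C y then X $ x $ y else 0) else 0)"
        by simp
    qed
    also have "\<dots> = X $ x $ y" by simp
    finally show "X $ x $ y = (\<Sum>a\<in>UNIV. \<Sum>b\<in>UNIV. mat (?c a b) ** tensor (\<lambda>j. unit_on B (a j) (b j))) $ x $ y" ..
  qed
  then have "tensor K ** X ** tensor (\<lambda>_. V) =
      tensor K ** (\<Sum>a\<in>UNIV. \<Sum>b\<in>UNIV. mat (?c a b) ** tensor (\<lambda>j. unit_on B (a j) (b j))) ** tensor (\<lambda>_. V)"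
    by (rule arg_cong)
  also have "\<dots> = (\<Sum>a\<in>UNIV. \<Sum>b\<in>UNIV. mat (?c a b) ** tensor (\<lambda>j. K j ** unit_on B (a j) (b j) ** V))"
    unfolding matrix_sum_right matrix_sum_left mult_mat_left[of "tensor K"] matrix_mul_assoc[symmetric] tensor_mult ..
  finally have eq: "tensor K ** X ** tensor (\<lambda>_. V) =
      (\<Sum>a\<in>UNIV. \<Sum>b\<in>UNIV. mat (?c a b) ** tensor (\<lambda>j. K j ** unit_on B (a j) (b j) ** V))" .
  obtain d where d: "\<And>j a b. K j ** unit_on B a b ** V = mat (d j a b) ** V" using e by metis
  have "tensor K ** X ** tensor (\<lambda>_. V) =
      mat (\<Sum>a\<in>UNIV. \<Sum>b\<in>UNIV. ?c a b * (\<Prod>j\<in>UNIV. d j (a j) (b j))) ** tensor (\<lambda>_. V)"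
    unfolding eq d tensor_smult mat_mult_mat_left mat_sum matrix_sum_left ..
  then show ?thesis by blast
qed

text \<open>
  Commuting an error \<open>Q\<close> past the remaining diagonal gates \<open>F\<close> replaces it by \<open>F Q F\<^sup>*\<close>, which
  acts on the column of the damaged qubit in every block only.
\<close>

lemma fault_tolerant_diag:
  fixes fs :: "(('r::finite \<Rightarrow> qubit47 \<Rightarrow> bool) \<Rightarrow> complex) list"
  assumes rec: "recovery_operators Kr D"
    and norm: "\<And>f x. f \<in> set fs \<Longrightarrow> cmod (f x) = 1" "\<And>a. cmod (G a) = 1"
    and loc: "\<And>f. f \<in> set fs \<Longrightarrow> \<exists>v A. A \<subseteq> UNIV \<times> {Block1 v, Block3 v, Block5 v} \<and> card A \<le> 3 \<and> (\<forall>x. f x = f (restrict_to A x))"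
    and total: "\<And>x a. (\<And>j. enc47 $ x j $ a j \<noteq> 0) \<Longrightarrow> prod_list (map (\<lambda>f. f x) fs) = G a"
  shows "fault_tolerant (kraus Kr) (diag_op G)"
proof (rule fault_tolerantI[OF recovery_operatorsD(1)[OF rec] enc47_isometry, of _ "map diag_op fs" 1])
  let ?ENC = "tensor (\<lambda>_ :: 'r. enc47)"
  let ?F = "\<lambda>fs x. prod_list (map (\<lambda>f. f x) fs)"
  show "unitary (diag_op G)" by (rule unitary_diag_op[OF norm(2)])
  show "unitary W \<and> (\<exists>A. card A \<le> 3 \<and> acts_on A W)" if "W \<in> set (map diag_op fs)" for W
  proof -
    obtain f where f: "f \<in> set fs" "W = diag_op f" using \<open>W \<in> set (map diag_op fs)\<close> by auto
    obtain A where "card A \<le> 3" "\<And>x. f x = f (restrict_to A x)" using loc[OF f(1)] by blast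
    then show ?thesis using norm(1)[OF f(1)] acts_on_diag_op[of f A] unitary_diag_op[of f] f(2) by blast
  qed
  show "cmod 1 = 1" by simp
  \<comment> \<open>The phases have to agree only at basis states with nonzero encoded amplitude;
    elsewhere both sides vanish.\<close>
  have tot: "diag_op (?F fs) ** ?ENC = ?ENC ** diag_op G"
  proof (rule matrix_ext)
    fix x a
    show "(diag_op (?F fs) ** ?ENC) $ x $ a = (?ENC ** diag_op G) $ x $ a"
    proof (cases "\<forall>j. enc47 $ x j $ a j \<noteq> 0")
      case True
      then show ?thesis unfolding diag_op_mult_nth using total[of x a] by simp
    next
      case False
      then have "?ENC $ x $ a = 0" by (auto simp: tensor_nth)
      then show ?thesis unfolding diag_op_mult_nth by simp
    qed
  qed
  then show "circuit_op (map diag_op fs) ** ?ENC = mat 1 ** (?ENC ** diag_op G)"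
    unfolding circuit_op_diag by simp
  fix k and j :: 'r and p :: qubit47 and P :: "bool op" and \<kappa> :: "'r \<Rightarrow> index47"
  let ?Q = "local_op j (local_op p P)"
  let ?F1 = "?F (take k fs)" and ?F2 = "?F (drop k fs)"
  have n2: "cmod (?F2 x) = 1" for x
  proof -
    have "set hs \<subseteq> set fs \<Longrightarrow> cmod (?F hs x) = 1" for hs
      using norm(1) by (induction hs) (auto simp: norm_mult)
    from this[OF set_drop_subset] show ?thesis .
  qed
  define X :: "('r \<Rightarrow> qubit47 \<Rightarrow> bool) op" where "X = (\<chi> x y. ?F2 x * ?Q $ x $ y * cnj (?F2 y))"
  have XF: "diag_op ?F2 ** ?Q = X ** diag_op ?F2"
  proof (rule matrix_ext)
    fix x y
    have "cnj (?F2 y) * ?F2 y = 1"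
      using n2[of y] by (simp add: complex_norm_square[symmetric] mult.commute)
    then show "(diag_op ?F2 ** ?Q) $ x $ y = (X ** diag_op ?F2) $ x $ y"
      unfolding diag_op_mult_nth X_def by (simp add: mult.assoc)
  qed
  have Qn: "?Q $ x $ y = (if \<forall>i q. (i, q) \<noteq> (j, p) \<longrightarrow> x i q = y i q then P $ x j p $ y j p else 0)" for x y
    unfolding local_op_nth by (auto simp: fun_eq_iff)
  have pc: "p \<in> error_column p" by (cases p) (simp_all add: error_column_def)
  have X: "acts_on (UNIV \<times> error_column p) X"
    unfolding acts_on_def
  proof (intro allI)
    fix x y :: "'r \<Rightarrow> qubit47 \<Rightarrow> bool"
    let ?C = "UNIV \<times> error_column p :: ('r \<times> qubit47) set"
    have "X $ x $ y = (if \<forall>i q. (i, q) \<notin> ?C \<longrightarrow> x i q = y i q then X $ restrict_to ?C x $ restrict_to ?C y else 0)"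
    proof (cases "\<forall>i q. (i, q) \<noteq> (j, p) \<longrightarrow> x i q = y i q")
      case True
      have "?F hs x * cnj (?F hs y) = ?F hs (restrict_to ?C x) * cnj (?F hs (restrict_to ?C y))" if "set hs \<subseteq> set fs" for hs
        using that
      proof (induction hs)
        case (Cons f hs)
        then have f: "f \<in> set fs" by simp
        obtain v A where A: "A \<subseteq> UNIV \<times> {Block1 v, Block3 v, Block5 v}" "\<And>x. f x = f (restrict_to A x)"
          using loc[OF f] by blast
        \<comment> \<open>If \<open>f\<close> lives on the column of \<open>p\<close>, restriction
          to \<open>?C\<close> does not change its values. Otherwise \<open>f\<close> cannot
          distinguish \<open>x\<close> from \<open>y\<close>, and the two phases cancel.\<close>
        have "f x * cnj (f y) = f (restrict_to ?C x) * cnj (f (restrict_to ?C y))"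
        proof (cases "error_column p = {Block1 v, Block3 v, Block5 v}")
          case True
          then have "restrict_to A (restrict_to ?C z) = restrict_to A z" for z :: "'r \<Rightarrow> qubit47 \<Rightarrow> bool"
            using A(1) unfolding restrict_to_eq_iff by (auto simp: restrict_to_def)
          then show ?thesis using A(2) by metis
        next
          case False
          then have "p \<notin> {Block1 v, Block3 v, Block5 v}" by (cases p) (auto simp: error_column_def)
          then have "(j, p) \<notin> A" using A(1) by auto
          then have "restrict_to A x = restrict_to A y" "restrict_to A (restrict_to ?C x) = restrict_to A (restrict_to ?C y)"
            using True unfolding restrict_to_eq_iff by (auto simp: restrict_to_def)
          then have "f x = f y" "f (restrict_to ?C x) = f (restrict_to ?C y)" using A(2) by metis+
          moreover have "f z * cnj (f z) = 1" for z
            using norm(1)[OF f, of z] by (simp add: complex_norm_square[symmetric])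
          ultimately show ?thesis by simp
        qed
        moreover have "?F hs x * cnj (?F hs y) = ?F hs (restrict_to ?C x) * cnj (?F hs (restrict_to ?C y))"
          using Cons by simp
        ultimately have "(f x * cnj (f y)) * (?F hs x * cnj (?F hs y)) =
            (f (restrict_to ?C x) * cnj (f (restrict_to ?C y))) * (?F hs (restrict_to ?C x) * cnj (?F hs (restrict_to ?C y)))"
          by simp
        then show ?case by (simp add: mult_ac)
      qed simp
      from this[OF set_drop_subset]
      have F: "?F2 x * cnj (?F2 y) = ?F2 (restrict_to ?C x) * cnj (?F2 (restrict_to ?C y))" .
      have "(j, p) \<in> ?C" using pc by simp
      then have a: "\<forall>i q. (i, q) \<notin> ?C \<longrightarrow> x i q = y i q" using True by metis
      have b: "\<forall>i q. (i, q) \<noteq> (j, p) \<longrightarrow> restrict_to ?C x i q = restrict_to ?C y i q"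
        using True by (auto simp: restrict_to_def)
      have q: "?Q $ x $ y = ?Q $ restrict_to ?C x $ restrict_to ?C y"
        unfolding Qn if_P[OF True] if_P[OF b] using \<open>(j, p) \<in> ?C\<close> by (simp add: restrict_to_def)
      have "X $ x $ y = (?F2 x * cnj (?F2 y)) * ?Q $ x $ y" by (simp add: X_def mult_ac)
      also have "\<dots> = X $ restrict_to ?C x $ restrict_to ?C y" unfolding F q by (simp add: X_def mult_ac)
      finally show ?thesis unfolding if_P[OF a] .
    next
      case False
      then have "X $ x $ y = 0" unfolding X_def vec_lambda_beta Qn if_not_P[OF False] by simp
      moreover have "X $ restrict_to ?C x $ restrict_to ?C y = 0" if a: "\<forall>i q. (i, q) \<notin> ?C \<longrightarrow> x i q = y i q"
      proof -
        have n: "\<not> (\<forall>i q. (i, q) \<noteq> (j, p) \<longrightarrow> restrict_to ?C x i q = restrict_to ?C y i q)"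
          using False a unfolding restrict_to_def by metis
        show ?thesis unfolding X_def vec_lambda_beta Qn if_not_P[OF n] by simp
      qed
      ultimately show ?thesis by simp
    qed
    then show "X $ x $ y = (if \<forall>i q. (i, q) \<notin> ?C \<longrightarrow> x i q = y i q
        then X $ (\<lambda>i q. (i, q) \<in> ?C \<and> x i q) $ (\<lambda>i q. (i, q) \<in> ?C \<and> y i q) else 0)"
      unfolding restrict_to_def .
  qed
  obtain e where e: "tensor (\<lambda>j. Kr (\<kappa> j)) ** X ** ?ENC = mat e ** ?ENC"
    using acts_on_error[OF X, of "\<lambda>j. Kr (\<kappa> j)" enc47] recovery_error_column[OF rec] by blast
  have F12: "diag_op ?F2 ** diag_op ?F1 = diag_op (?F fs)"
  proof -
    have "?F fs x = ?F2 x * ?F1 x" for x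
      using append_take_drop_id[of k fs] by (metis map_append prod_list.append mult.commute)
    then show ?thesis by (intro matrix_ext) (simp add: diag_op_mult_nth, simp add: diag_op_def)
  qed
  have "tensor (\<lambda>j. Kr (\<kappa> j)) ** circuit_op (drop k (map diag_op fs)) ** ?Q ** circuit_op (take k (map diag_op fs)) ** ?ENC =
      tensor (\<lambda>j. Kr (\<kappa> j)) ** (diag_op ?F2 ** ?Q) ** diag_op ?F1 ** ?ENC"
    unfolding drop_map take_map circuit_op_diag by (simp only: matrix_mul_assoc)
  also have "\<dots> = tensor (\<lambda>j. Kr (\<kappa> j)) ** X ** ((diag_op ?F2 ** diag_op ?F1) ** ?ENC)"
    unfolding XF by (simp only: matrix_mul_assoc)
  also have "\<dots> = mat e ** (?ENC ** diag_op G)"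
    unfolding F12 tot matrix_mul_assoc e ..
  finally show "\<exists>e. tensor (\<lambda>j. Kr (\<kappa> j)) ** circuit_op (drop k (map diag_op fs)) ** ?Q ** circuit_op (take k (map diag_op fs)) ** ?ENC =
      mat e ** (?ENC ** diag_op G)" by blast
qed


text \<open>One gate per point \<open>v\<close> applies the inverse phase to the sum of the three
  bits there. The exponents are 0 or 7 modulo 8, and the seventh power of the inverse of
  \<open>z\<close> is \<open>z\<close>.\<close>

lemma fault_tolerant_phase:
  assumes rec: "recovery_operators Kr D" and z: "z ^ 8 = 1" "cmod z = 1"
  shows "fault_tolerant (kraus Kr) (on_one_qubit (mat2 1 0 0 z))"
proof -
  have gate: "on_one_qubit (mat2 1 0 0 z) = diag_op (\<lambda>a. if a 1 then z else 1)"
    by (rule matrix_ext) (auto simp: on_one_qubit_def diag_op_def tensor_nth UNIV_1 mat2_def fun_eq_iff)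
  obtain vs :: "qubit15 list" where vs: "set vs = UNIV" "distinct vs"
    using finite_distinct_list[OF finite[of "UNIV :: qubit15 set"]] by auto
  define f where "f v x = (if (x (1 :: 1) (Block1 v) \<noteq> x 1 (Block3 v)) \<noteq> x 1 (Block5 v) then cnj z else 1)" for v x
  have zz: "cnj z * z = 1"
    using z(2) by (simp add: complex_norm_square[symmetric] mult.commute)
  have "cnj z ^ 7 = cnj z ^ 7 * z ^ 8" using z(1) by simp
  also have "\<dots> = (cnj z * z) ^ 7 * z" by (simp add: power_mult_distrib eval_nat_numeral mult_ac)
  finally have z7: "cnj z ^ 7 = z" using zz by simp
  have z8: "cnj z ^ 8 = 1" using z(1) by (metis complex_cnj_one complex_cnj_power)
  show ?thesis
    unfolding gate
  proof (rule fault_tolerant_diag[OF rec, of "map f vs"])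
    fix g assume "g \<in> set (map f vs)"
    then obtain v where v: "g = f v" by auto
    show "cmod (g x) = 1" for x unfolding v f_def using z(2) by simp
    show "\<exists>v A. A \<subseteq> UNIV \<times> {Block1 v, Block3 v, Block5 v} \<and> card A \<le> 3 \<and> (\<forall>x. g x = g (restrict_to A x))"
      by (rule exI[of _ v], rule exI[of _ "{(1, Block1 v), (1, Block3 v), (1, Block5 v)}"])
         (auto simp: v f_def restrict_to_def)
  next
    show "cmod (if a 1 then z else 1) = 1" for a :: "1 \<Rightarrow> bool" using z(2) by simp
  next
    fix x :: "1 \<Rightarrow> qubit47 \<Rightarrow> bool" and a assume "\<And>j. enc47 $ x j $ a j \<noteq> 0"
    then obtain l where "\<And>v. ((x 1 (Block1 v) \<noteq> x 1 (Block3 v)) \<noteq> x 1 (Block5 v)) = codeword l (a 1) v"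
      using enc47_support by blast
    then have "prod_list (map (\<lambda>g. g x) (map f vs)) = (\<Prod>v\<in>UNIV. if codeword l (a 1) v then cnj z else 1)"
      unfolding vs(1)[symmetric] prod.distinct_set_conv_list[OF vs(2)] by (simp add: f_def o_def)
    then show "prod_list (map (\<lambda>g. g x) (map f vs)) = (if a 1 then z else 1)"
      unfolding prod_codeword_phase[OF z8] z7 .
  qed
qed

lemma prod_list_concat_map: "prod_list (map h (concat (map g xs))) = prod_list (map (\<lambda>x. prod_list (map h (g x))) xs)"
  by (induction xs) simp_all

text \<open>Signs multiply as bits add, so signs controlled by the three bits and a common condition
  \<open>R\<close> combine into one controlled by the sum of the bits.\<close>

lemma prod_list_blocks:
  "prod_list (map (\<lambda>b. if R \<and> x (b v) then - 1 else 1) [Block1, Block3, Block5]) =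
    (if R \<and> ((x (Block1 v) \<noteq> x (Block3 v)) \<noteq> x (Block5 v)) then - 1 else 1 :: complex)"
  by auto

text \<open>The exponent of the sign is bilinear over F_2, so at each point nine two-qubit gates
  realize the controlled sign of the two block sums.\<close>

lemma fault_tolerant_CZ:
  assumes rec: "recovery_operators Kr D"
  shows "fault_tolerant (kraus Kr) gate_CZ"
proof -
  let ?b = "[Block1, Block3, Block5]"
  have gate: "gate_CZ = diag_op (\<lambda>a. if a 1 \<and> a 2 then - 1 else 1)"
    by (rule matrix_ext) (simp add: gate_CZ_def diag_op_def forall_2)
  obtain vs :: "qubit15 list" where vs: "set vs = UNIV" "distinct vs"
    using finite_distinct_list[OF finite[of "UNIV :: qubit15 set"]] by auto
  define f where "f v b c x = (if x (1 :: 2) (b v) \<and> x 2 (c v) then - 1 else 1 :: complex)"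
    for v :: qubit15 and b c :: "qubit15 \<Rightarrow> qubit47" and x
  define fs where "fs = concat (map (\<lambda>v. concat (map (\<lambda>b. map (f v b) ?b) ?b)) vs)"
  show ?thesis
    unfolding gate
  proof (rule fault_tolerant_diag[OF rec, of fs])
    fix g assume "g \<in> set fs"
    then obtain v b c where g: "g = f v b c" "b \<in> set ?b" "c \<in> set ?b" unfolding fs_def by auto
    show "cmod (g x) = 1" for x unfolding g(1) f_def by simp
    show "\<exists>v A. A \<subseteq> UNIV \<times> {Block1 v, Block3 v, Block5 v} \<and> card A \<le> 3 \<and> (\<forall>x. g x = g (restrict_to A x))"
      by (rule exI[of _ v], rule exI[of _ "{(1, b v), (2, c v)}"])
         (use g in \<open>auto simp: f_def restrict_to_def card_insert_if\<close>)
  next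
    show "cmod (if a 1 \<and> a 2 then - 1 else 1) = 1" for a :: "2 \<Rightarrow> bool" by simp
  next
    fix x :: "2 \<Rightarrow> qubit47 \<Rightarrow> bool" and a assume a: "\<And>j. enc47 $ x j $ a j \<noteq> 0"
    define p where "p j v = ((x j (Block1 v) \<noteq> x j (Block3 v)) \<noteq> x j (Block5 v))" for j v
    have "\<exists>l. \<forall>v. p j v = codeword l (a j) v" for j using enc47_support[OF a[of j]] by (simp add: p_def)
    then obtain l where l: "\<And>j v. p j v = codeword (l j) (a j) v" by metis
    have "prod_list (map (\<lambda>g. g x) (concat (map (\<lambda>b. map (f v b) ?b) ?b))) = (if p 1 v \<and> p 2 v then - 1 else 1)" for v
    proof -
      have "prod_list (map (\<lambda>g. g x) (concat (map (\<lambda>b. map (f v b) ?b) ?b))) =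
          prod_list (map (\<lambda>b. prod_list (map (\<lambda>c. if x 1 (b v) \<and> x 2 (c v) then - 1 else 1) ?b)) ?b)"
        unfolding prod_list_concat_map map_map o_def f_def ..
      also have "\<dots> = prod_list (map (\<lambda>b. if x 1 (b v) \<and> p 2 v then - 1 else 1) ?b)"
        unfolding prod_list_blocks p_def[symmetric] ..
      also have "\<dots> = prod_list (map (\<lambda>b. if p 2 v \<and> x 1 (b v) then - 1 else 1) ?b)"
        by (simp only: conj_commute)
      also have "\<dots> = (if p 2 v \<and> p 1 v then - 1 else 1)"
        unfolding prod_list_blocks p_def[symmetric] ..
      finally show ?thesis by (simp only: conj_commute)
    qed
    then have "prod_list (map (\<lambda>g. g x) fs) = (\<Prod>v\<in>UNIV. if p 1 v \<and> p 2 v then - 1 else 1)"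
      unfolding fs_def prod_list_concat_map[of "\<lambda>g. g x" _ vs] vs(1)[symmetric] prod.distinct_set_conv_list[OF vs(2)] by simp
    \<comment> \<open>The third codeword is the constant 1.\<close>
    also have "\<dots> = (if a 1 \<and> a 2 then - 1 else 1)"
      using prod_codewords_3[of "l 1" "a 1" "l 2" "a 2" 0 True] by (simp add: l codeword_0)
    finally show "prod_list (map (\<lambda>g. g x) fs) = (if a 1 \<and> a 2 then - 1 else 1)" .
  qed
qed

text \<open>By trilinearity, 27 three-qubit gates at each point give the controlled sign of the
  three block sums. Three logical qubits are the most that \<open>prod_codewords_3\<close>
  allows.\<close>

lemma fault_tolerant_CCZ:
  assumes rec: "recovery_operators Kr D"
  shows "fault_tolerant (kraus Kr) gate_CCZ"
proof -
  let ?b = "[Block1, Block3, Block5]"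
  have gate: "gate_CCZ = diag_op (\<lambda>a. if a 1 \<and> a 2 \<and> a 3 then - 1 else 1)"
    by (rule matrix_ext) (simp add: gate_CCZ_def diag_op_def forall_3)
  obtain vs :: "qubit15 list" where vs: "set vs = UNIV" "distinct vs"
    using finite_distinct_list[OF finite[of "UNIV :: qubit15 set"]] by auto
  define f where "f v b c d x = (if (x (1 :: 3) (b v) \<and> x 2 (c v)) \<and> x 3 (d v) then - 1 else 1 :: complex)"
    for v :: qubit15 and b c d :: "qubit15 \<Rightarrow> qubit47" and x
  define fs where "fs = concat (map (\<lambda>v. concat (map (\<lambda>b. concat (map (\<lambda>c. map (f v b c) ?b) ?b)) ?b)) vs)"
  show ?thesis
    unfolding gate
  proof (rule fault_tolerant_diag[OF rec, of fs])
    fix g assume "g \<in> set fs"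
    then obtain v b c d where g: "g = f v b c d" "b \<in> set ?b" "c \<in> set ?b" "d \<in> set ?b" unfolding fs_def by auto
    show "cmod (g x) = 1" for x unfolding g(1) f_def by simp
    show "\<exists>v A. A \<subseteq> UNIV \<times> {Block1 v, Block3 v, Block5 v} \<and> card A \<le> 3 \<and> (\<forall>x. g x = g (restrict_to A x))"
      by (rule exI[of _ v], rule exI[of _ "{(1, b v), (2, c v), (3, d v)}"])
         (use g in \<open>auto simp: f_def restrict_to_def card_insert_if\<close>)
  next
    show "cmod (if a 1 \<and> a 2 \<and> a 3 then - 1 else 1) = 1" for a :: "3 \<Rightarrow> bool" by simp
  next
    fix x :: "3 \<Rightarrow> qubit47 \<Rightarrow> bool" and a assume a: "\<And>j. enc47 $ x j $ a j \<noteq> 0"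
    define p where "p j v = ((x j (Block1 v) \<noteq> x j (Block3 v)) \<noteq> x j (Block5 v))" for j v
    have "\<exists>l. \<forall>v. p j v = codeword l (a j) v" for j using enc47_support[OF a[of j]] by (simp add: p_def)
    then obtain l where l: "\<And>j v. p j v = codeword (l j) (a j) v" by metis
    have "prod_list (map (\<lambda>g. g x) (concat (map (\<lambda>b. concat (map (\<lambda>c. map (f v b c) ?b) ?b)) ?b))) =
        (if p 1 v \<and> p 2 v \<and> p 3 v then - 1 else 1)" for v
    proof -
      \<comment> \<open>Rotating the conditions brings the next block variable to the last place,
        where \<open>prod_list_blocks\<close> sums over it.\<close>
      have s: "(if (A \<and> B) \<and> C then - 1 else 1 :: complex) = (if (C \<and> A) \<and> B then - 1 else 1)" for A B C by auto
      have "prod_list (map (\<lambda>g. g x) (concat (map (\<lambda>b. concat (map (\<lambda>c. map (f v b c) ?b) ?b)) ?b))) =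
          prod_list (map (\<lambda>b. prod_list (map (\<lambda>c. prod_list (map (\<lambda>d. if (x 1 (b v) \<and> x 2 (c v)) \<and> x 3 (d v) then - 1 else 1) ?b)) ?b)) ?b)"
        unfolding prod_list_concat_map map_map o_def f_def ..
      also have "\<dots> = prod_list (map (\<lambda>b. prod_list (map (\<lambda>c. if (x 1 (b v) \<and> x 2 (c v)) \<and> p 3 v then - 1 else 1) ?b)) ?b)"
        unfolding prod_list_blocks p_def[symmetric] ..
      also have "\<dots> = prod_list (map (\<lambda>b. prod_list (map (\<lambda>c. if (p 3 v \<and> x 1 (b v)) \<and> x 2 (c v) then - 1 else 1) ?b)) ?b)"
        by (subst s) (rule refl)
      also have "\<dots> = prod_list (map (\<lambda>b. if (p 3 v \<and> x 1 (b v)) \<and> p 2 v then - 1 else 1) ?b)"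
        unfolding prod_list_blocks p_def[symmetric] ..
      also have "\<dots> = prod_list (map (\<lambda>b. if (p 2 v \<and> p 3 v) \<and> x 1 (b v) then - 1 else 1) ?b)"
        by (subst s) (rule refl)
      also have "\<dots> = (if (p 2 v \<and> p 3 v) \<and> p 1 v then - 1 else 1)"
        unfolding prod_list_blocks p_def[symmetric] ..
      also have "\<dots> = (if (p 1 v \<and> p 2 v) \<and> p 3 v then - 1 else 1)"
        by (subst s) (rule refl)
      finally show ?thesis by (simp only: conj_assoc)
    qed
    then have "prod_list (map (\<lambda>g. g x) fs) = (\<Prod>v\<in>UNIV. if p 1 v \<and> p 2 v \<and> p 3 v then - 1 else 1)"
      unfolding fs_def prod_list_concat_map[of "\<lambda>g. g x" _ vs] vs(1)[symmetric] prod.distinct_set_conv_list[OF vs(2)] by simp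
    also have "\<dots> = (if a 1 \<and> a 2 \<and> a 3 then - 1 else 1)"
      unfolding l prod_codewords_3 by simp
    finally show "prod_list (map (\<lambda>g. g x) fs) = (if a 1 \<and> a 2 \<and> a 3 then - 1 else 1)" .
  qed
qed


lemma exp_pi_quarter_power: "exp (\<i> * of_real pi / 4) ^ 8 = 1"
proof -
  have "exp (\<i> * of_real pi / 4) ^ 8 = exp (of_nat 8 * (\<i> * of_real pi / 4))" by (rule exp_of_nat_mult[symmetric])
  also have "\<dots> = exp (2 * of_real pi * \<i>)" by (simp add: mult_ac)
  finally show ?thesis by simp
qed

theorem mainTheorem2:
  shows
    "(3 \<le> CARD('n::finite) \<longrightarrow>
        dense_up_to_phase (generated_group (K_T_S_CZ_CCZ_gates :: ('n \<Rightarrow> bool) op set))) \<and>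
     (\<exists>R :: (qubit47 \<Rightarrow> bool) op \<Rightarrow> (qubit47 \<Rightarrow> bool) op.
        quantum_channel R \<and>
        (\<forall>p E. quantum_channel E \<longrightarrow> corrects R (channel_at p E)) \<and>
        fault_tolerant R (on_one_qubit gate_K) \<and>
        fault_tolerant R (on_one_qubit gate_T) \<and>
        fault_tolerant R (on_one_qubit gate_S) \<and>
        fault_tolerant R gate_CZ \<and>
        fault_tolerant R gate_CCZ)"
proof -
  obtain Kr D where rec: "recovery_operators Kr D" using recovery_exists by blast
  note complete = recovery_operatorsD(1)[OF rec]
  have "quantum_channel (kraus Kr)" using complete by (rule quantum_channel_kraus)
  moreover have "\<forall>p E. quantum_channel E \<longrightarrow> corrects (kraus Kr) (channel_at p E)"
    using correctsI[OF complete enc47_isometry recovery_local_op[OF rec]] by blast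
  moreover have "fault_tolerant (kraus Kr) (on_one_qubit gate_T)"
    unfolding gate_T_def using fault_tolerant_phase[OF rec exp_pi_quarter_power] by simp
  moreover have "fault_tolerant (kraus Kr) (on_one_qubit gate_S)"
    unfolding gate_S_def
  proof (rule fault_tolerant_phase[OF rec])
    have "\<i> ^ 8 = (\<i>\<^sup>2) ^ 4" by (simp only: power_mult[symmetric])  simp
    then show "\<i> ^ 8 = 1" by simp
  qed simp
  ultimately show ?thesis
    using universality fault_tolerant_K[OF rec] fault_tolerant_CZ[OF rec] fault_tolerant_CCZ[OF rec] by blast
qed

end
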